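(* Let $m_0=\sum_{i=1}^N a_{0,i}\delta_{x_{0,i}}$ be a discrete measure on $\mathbb{T}$ (with $a_{0,i}\in\mathbb{R}\setminus\{0\}$ and pairwise distinct $x_{0,i}\in\mathbb{T}$), let $a_0=(a_{0,i})_i$, $x_0=(x_{0,i})_i$, and let $y_0=\Phi m_0$. Assume that $\Gamma_{x_0}$ has full rank and that $m_0$ satisfies the Non Degenerate Source Condition. Then there exist $\alpha>0$ and $\lambda_0>0$ such that for all $(\lambda,w)\in D_{\alpha,\lambda_0}$ the solution $\tilde m_\lambda$ of $\mathcal{P}_\lambda(y_0+w)$ is unique and is composed of exactly $N$ spikes. Moreover, up to a permutation of indices, one may write $\tilde m_\lambda=\sum_{i=1}^N\tilde a_{\lambda,i}\delta_{\tilde x_{\lambda,i}}$ with $\tilde a_{\lambda,i}\neq 0$ and $\operatorname{sign}(\tilde a_{\lambda,i})=\operatorname{sign}(a_{0,i})$ for $1\le i\le N$, and, with $(\tilde a_0,\tilde x_0)=(a_0,x_0)$ at $(\lambda,w)=(0,0)$, the mapping $$(\lambda,w)\in D_{\alpha,\lambda_0}\mapsto(\tilde a_\lambda,\tilde x_\lambda)\in\mathbb{R}^N\times\mathbb{T}^N$$ is $C^{k-1}$ whenever $\varphi\in C^k(\mathbb{T})$ ($k\ge 2$). In particular, for $\lambda=\frac1\alpha\|w\|_2$, one has, for all $i\in\{1,\dots,N\}$, $|\tilde x_{\lambda,i}-x_{0,i}|=O(\|w\|_2)$ and $|\tilde a_{\lambda,i}-a_{0,i}|=O(\|w\|_2)$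 (as $\|w\|_2\to0$).
   Context: $\mathbb{T}=\mathbb{R}/\mathbb{Z}$; $|t-t'|$ is the distance on the torus. $\mathcal{M}(\mathbb{T})$ is the space of real Radon measures on $\mathbb{T}$ (dual of $C(\mathbb{T})$) and $\|m\|_{TV}=\sup\{\int\psi\,dm:\psi\in C(\mathbb{T}),\|\psi\|_\infty\le1\}$. Fix a real-valued $\varphi\in C^2(\mathbb{T})$ and let $\Phi:\mathcal{M}(\mathbb{T})\to L^2(\mathbb{T})$, $(\Phi m)(t)=\int_{\mathbb{T}}\varphi(x-t)\,dm(x)$, with adjoint $\Phi^*:L^2(\mathbb{T})\to C(\mathbb{T})$, $(\Phi^*p)(t)=\int_{\mathbb{T}}\varphi(t-x)p(x)\,dx$. For $y\in L^2(\mathbb{T})$: for $\lambda>0$, $\mathcal{P}_\lambda(y)$ is the problem $\min_{m\in\mathcal{M}(\mathbb{T})}\frac12\|\Phi m-y\|_2^2+\lambda\|m\|_{TV}$; $\mathcal{P}_0(y)$ is $\min_{\Phi m=y}\|m\|_{TV}$; $\mathcal{D}_0(y)$ is $\sup\{\langle y,p\rangle: p\in L^2(\mathbb{T}),\ \|\Phi^*p\|_\infty\le1\}$. $D_{\alpha,\lambda_0}=\{(\lambda,w)\in\mathbb{R}_+\times L^2(\mathbb{T}):0\le\lambda\le\lambda_0,\ \|w\|_2\le\alpha\lambda\}$. A map is $C^{k-1}$ on $D_{\alpha,\lambda_0}$ if it is the restriction of a $C^{k-1}$ map defined on a neighborhood of $D_{\alpha,\lambda_0}$ in $\mathbb{R}\times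 L^2(\mathbb{T})$. For $x\in\mathbb{T}^N$, $\Gamma_x:\mathbb{R}^N\times\mathbb{R}^N\to L^2(\mathbb{T})$ is $\Gamma_x(u,v)=\sum_{i=1}^N u_i\varphi(x_i-\cdot)+\sum_{i=1}^N v_i\varphi'(x_i-\cdot)$; full rank means injective. $\partial\|m\|_{TV}=\{\eta\in C(\mathbb{T}):\|\eta\|_\infty\le1,\ \int\eta\,dm=\|m\|_{TV}\}$. When $\mathcal{D}_0(y_0)$ has a solution, the minimal norm certificate is $\eta_0=\Phi^*p_0$, where $p_0$ is the solution of $\mathcal{D}_0(y_0)$ of minimal $L^2$ norm. Non Degenerate Source Condition for $m_0=\sum_{i=1}^N a_{0,i}\delta_{x_{0,i}}$ (with $y_0=\Phi m_0$): there exists $\eta\in\operatorname{Im}\Phi^*$ with $\eta\in\partial\|m_0\|_{TV}$ (this makes $\eta_0$ well defined), and $\eta_0$ satisfies $|\eta_0(s)|<1$ for all $s\in\mathbb{T}\setminus\{x_{0,1},\dots,x_{0,N}\}$ and $\eta_0''(x_{0,i})\neq0$ for all $i$. *)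

theory Defs
  imports "HOL-Analysis.Analysis" "HOL-Library.Landau_Symbols"
begin

section \<open>The torus\<close>

lemma equivp_diff_Ints: "equivp (\<lambda>x y :: real. x - y \<in> \<int>)"
proof (rule equivpI)
  show "reflp (\<lambda>x y :: real. x - y \<in> \<int>)" by (simp add: reflp_def)
  show "symp (\<lambda>x y :: real. x - y \<in> \<int>)"
    unfolding symp_def by (metis Ints_minus minus_diff_eq)
  show "transp (\<lambda>x y :: real. x - y \<in> \<int>)"
    unfolding transp_def by (metis Ints_add diff_add_cancel add_diff_eq)
qed

quotient_type torus = real / "\<lambda>x y :: real. x - y \<in> \<int>"
  by (rule equivp_diff_Ints)

lift_definition to_torus :: "real \<Rightarrow> torus" is "\<lambda>x. x" .

instantiation torus :: ab_group_add
begin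

lift_definition zero_torus :: torus is 0 .

lift_definition plus_torus :: "torus \<Rightarrow> torus \<Rightarrow> torus" is "(+)"
  by (metis Ints_add add_diff_add)

lift_definition uminus_torus :: "torus \<Rightarrow> torus" is uminus
  by (metis Ints_minus minus_diff_minus)

lift_definition minus_torus :: "torus \<Rightarrow> torus \<Rightarrow> torus" is "(-)"
proof -
  fix a b c d :: real
  assume "a - b \<in> \<int>" "c - d \<in> \<int>"
  then have "(a - b) - (c - d) \<in> \<int>" by (rule Ints_diff)
  then show "(a - c) - (b - d) \<in> \<int>" by (simp add: algebra_simps)
qed

instance
  by standard (transfer; simp add: algebra_simps)+

end

lemma abs_diff_round_cong:
  fixes a b :: real
  assumes "a - b \<in> \<int>"
  shows "\<bar>a - of_int (round a)\<bar> = \<bar>b - of_int (round b)\<bar>"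
proof -
  obtain k where k: "a = b + of_int k"
    using assms by (metis Ints_cases diff_add_cancel add.commute)
  have "\<bar>a - of_int (round a)\<bar> \<le> \<bar>a - of_int (round b + k)\<bar>" by (rule round_diff_minimal)
  moreover have "\<bar>b - of_int (round b)\<bar> \<le> \<bar>b - of_int (round a - k)\<bar>" by (rule round_diff_minimal)
  ultimately show ?thesis using k by (simp add: algebra_simps)
qed

instantiation torus :: metric_space
begin

lift_definition dist_torus :: "torus \<Rightarrow> torus \<Rightarrow> real"
  is "\<lambda>x y. \<bar>(x - y) - of_int (round (x - y))\<bar>"
proof -
  fix a b c d :: real
  assume "a - b \<in> \<int>" "c - d \<in> \<int>"
  then have "(a - b) - (c - d) \<in> \<int>" by (rule Ints_diff)
  then have "(a - c) - (b - d) \<in> \<int>" by (simp add: algebra_simps)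
  then show "\<bar>a - c - of_int (round (a - c))\<bar> = \<bar>b - d - of_int (round (b - d))\<bar>"
    by (rule abs_diff_round_cong)
qed

definition uniformity_torus :: "(torus \<times> torus) filter" where
  "uniformity_torus = (INF e\<in>{0 <..}. principal {(x, y). dist x y < e})"

definition open_torus :: "torus set \<Rightarrow> bool" where
  "open_torus U \<longleftrightarrow> (\<forall>x\<in>U. eventually (\<lambda>(x', y). x' = x \<longrightarrow> y \<in> U) uniformity)"

instance
proof
  show "dist x y = 0 \<longleftrightarrow> x = y" for x y :: torus
  proof transfer
    fix x y :: real
    show "\<bar>x - y - of_int (round (x - y))\<bar> = 0 \<longleftrightarrow> x - y \<in> \<int>"
      by (metis Ints_cases Ints_of_int abs_0_eq diff_self eq_iff_diff_eq_0 round_of_int abs_eq_0)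
  qed
  show "dist x y \<le> dist x z + dist y z" for x y z :: torus
  proof transfer
    fix x y z :: real
    have "\<bar>(x - y) - of_int (round (x - y))\<bar>
        \<le> \<bar>(x - y) - of_int (round (x - z) - round (y - z))\<bar>"
      by (rule round_diff_minimal)
    then show "\<bar>x - y - of_int (round (x - y))\<bar>
        \<le> \<bar>x - z - of_int (round (x - z))\<bar> + \<bar>y - z - of_int (round (y - z))\<bar>"
      by (simp add: algebra_simps)
  qed
qed (rule uniformity_torus_def open_torus_def)+

end

lemma dist_to_torus_le: "dist (to_torus a) (to_torus b) \<le> \<bar>a - b\<bar>"
proof transfer
  fix a b :: real
  show "\<bar>a - b - of_int (round (a - b))\<bar> \<le> \<bar>a - b\<bar>"
    using round_diff_minimal[of "a - b" 0] by simp
qed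

lemma continuous_to_torus: "continuous_on S to_torus"
  unfolding continuous_on_iff dist_real_def
  by (metis dist_to_torus_le le_less_trans abs_minus_commute)

lemma to_torus_eq_iff: "to_torus a = to_torus b \<longleftrightarrow> a - b \<in> \<int>"
  by transfer simp

lemma surj_to_torus: "\<exists>a. 0 \<le> a \<and> a < 1 \<and> t = to_torus a"
proof transfer
  fix t :: real
  have "t - frac t \<in> \<int>" by (simp add: frac_def)
  then show "\<exists>a\<ge>0. a < 1 \<and> t - a \<in> \<int>"
    using frac_ge_0 frac_lt_1 by blast
qed

lemma compact_torus: "compact (UNIV :: torus set)"
proof -
  have "(UNIV :: torus set) = to_torus ` {0..1}"
    using surj_to_torus by force
  then show ?thesis
    by (metis compact_Icc compact_continuous_image continuous_to_torus)
qed

definition torus_measure :: "torus measure" where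
  "torus_measure = distr (restrict_space lborel {0..<1}) borel to_torus"

definition tderiv :: "(torus \<Rightarrow> real) \<Rightarrow> torus \<Rightarrow> real" where
  "tderiv f t = deriv (\<lambda>s. f (t + to_torus s)) 0"

primrec Ck_torus :: "nat \<Rightarrow> (torus \<Rightarrow> real) \<Rightarrow> bool" where
  "Ck_torus 0 f \<longleftrightarrow> continuous_on UNIV f"
| "Ck_torus (Suc k) f \<longleftrightarrow>
     (\<forall>t. (\<lambda>s. f (t + to_torus s)) differentiable at 0) \<and> Ck_torus k (tderiv f)"


section \<open>The Hilbert space of square-integrable functions on the torus\<close>

definition square_integrable :: "(torus \<Rightarrow> real) \<Rightarrow> bool" where
  "square_integrable f \<longleftrightarrow>
     f \<in> borel_measurable torus_measure \<and> integrable torus_measure (\<lambda>t. (f t)\<^sup>2)"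

lemma square_integrable_mult:
  assumes "square_integrable f" "square_integrable g"
  shows "integrable torus_measure (\<lambda>t. f t * g t)"
proof (rule Bochner_Integration.integrable_bound)
  show "integrable torus_measure (\<lambda>t. (f t)\<^sup>2 + (g t)\<^sup>2)"
    using assms by (auto simp: square_integrable_def)
  show "(\<lambda>t. f t * g t) \<in> borel_measurable torus_measure"
    using assms by (auto simp: square_integrable_def)
  show "AE t in torus_measure. norm (f t * g t) \<le> norm ((f t)\<^sup>2 + (g t)\<^sup>2)"
  proof (rule AE_I2)
    fix t
    have "2 * (\<bar>f t\<bar> * \<bar>g t\<bar>) \<le> (f t)\<^sup>2 + (g t)\<^sup>2"
      using sum_squares_bound[of "\<bar>f t\<bar>" "\<bar>g t\<bar>"] by (simp add: mult.assoc)
    moreover have "0 \<le> \<bar>f t\<bar> * \<bar>g t\<bar>" by simp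
    ultimately have "\<bar>f t\<bar> * \<bar>g t\<bar> \<le> (f t)\<^sup>2 + (g t)\<^sup>2" by linarith
    then show "norm (f t * g t) \<le> norm ((f t)\<^sup>2 + (g t)\<^sup>2)"
      by (simp only: real_norm_def abs_mult)
  qed
qed

lemma square_integrable_zero: "square_integrable (\<lambda>_. 0)"
  by (simp add: square_integrable_def)

lemma square_integrable_scale: "square_integrable f \<Longrightarrow> square_integrable (\<lambda>t. c * f t)"
  by (auto simp: square_integrable_def power_mult_distrib)

lemma square_integrable_add:
  assumes "square_integrable f" "square_integrable g"
  shows "square_integrable (\<lambda>t. f t + g t)"
  using assms square_integrable_mult[OF assms]
  by (auto simp: square_integrable_def power2_sum mult.assoc)

lemma square_integrable_uminus: "square_integrable f \<Longrightarrow> square_integrable (\<lambda>t. - f t)"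
  using square_integrable_scale[of f "-1"] by simp

lemma square_integrable_diff:
  "square_integrable f \<Longrightarrow> square_integrable g \<Longrightarrow> square_integrable (\<lambda>t. f t - g t)"
  using square_integrable_add[of f "\<lambda>t. - g t"] square_integrable_uminus[of g] by simp

definition l2_rel :: "(torus \<Rightarrow> real) \<Rightarrow> (torus \<Rightarrow> real) \<Rightarrow> bool" where
  "l2_rel f g \<longleftrightarrow> square_integrable f \<and> square_integrable g \<and> (AE t in torus_measure. f t = g t)"

lemma part_equivp_l2_rel: "part_equivp l2_rel"
proof (rule part_equivpI)
  show "\<exists>f. l2_rel f f"
    using square_integrable_zero by (auto simp: l2_rel_def)
  show "symp l2_rel"
    by (auto simp: symp_def l2_rel_def elim!: AE_mp)
  show "transp l2_rel"
    unfolding transp_def l2_rel_def by (auto elim: eventually_elim2)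
qed

quotient_type l2 = "torus \<Rightarrow> real" / partial: l2_rel
  by (rule part_equivp_l2_rel)

instantiation l2 :: real_inner
begin

lift_definition zero_l2 :: l2 is "\<lambda>_. 0"
  by (simp add: l2_rel_def square_integrable_zero)

lift_definition plus_l2 :: "l2 \<Rightarrow> l2 \<Rightarrow> l2" is "\<lambda>f g t. f t + g t"
  by (auto simp: l2_rel_def square_integrable_add elim: eventually_elim2)

lift_definition minus_l2 :: "l2 \<Rightarrow> l2 \<Rightarrow> l2" is "\<lambda>f g t. f t - g t"
  by (auto simp: l2_rel_def square_integrable_diff elim: eventually_elim2)

lift_definition uminus_l2 :: "l2 \<Rightarrow> l2" is "\<lambda>f t. - f t"
  by (auto simp: l2_rel_def square_integrable_uminus)

lift_definition scaleR_l2 :: "real \<Rightarrow> l2 \<Rightarrow> l2" is "\<lambda>c f t. c * f t"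
  by (auto simp: l2_rel_def square_integrable_scale elim: eventually_mono)

lift_definition inner_l2 :: "l2 \<Rightarrow> l2 \<Rightarrow> real" is "\<lambda>f g. \<integral>t. f t * g t \<partial>torus_measure"
  unfolding l2_rel_def square_integrable_def
  by (intro integral_cong_AE) (auto elim: eventually_elim2)

definition norm_l2 :: "l2 \<Rightarrow> real" where
  "norm_l2 f = sqrt (inner f f)"

definition sgn_l2 :: "l2 \<Rightarrow> l2" where
  "sgn_l2 f = scaleR (inverse (norm f)) f"

definition dist_l2 :: "l2 \<Rightarrow> l2 \<Rightarrow> real" where
  "dist_l2 f g = norm (f - g)"

definition uniformity_l2 :: "(l2 \<times> l2) filter" where
  "uniformity_l2 = (INF e\<in>{0 <..}. principal {(x, y). dist x y < e})"

definition open_l2 :: "l2 set \<Rightarrow> bool" where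
  "open_l2 U \<longleftrightarrow> (\<forall>x\<in>U. eventually (\<lambda>(x', y). x' = x \<longrightarrow> y \<in> U) uniformity)"

instance
proof
  fix f g h :: l2 and c d :: real
  show "f + g + h = f + (g + h)"
    by transfer (auto simp: l2_rel_def square_integrable_add)
  show "f + g = g + f"
    by transfer (auto simp: l2_rel_def square_integrable_add)
  show "0 + f = f"
    by transfer (auto simp: l2_rel_def)
  show "- f + f = 0"
    by transfer (auto simp: l2_rel_def square_integrable_zero)
  show "f - g = f + - g"
    by transfer (auto simp: l2_rel_def square_integrable_diff)
  show "c *\<^sub>R (f + g) = c *\<^sub>R f + c *\<^sub>R g"
    by transfer (auto simp: l2_rel_def distrib_left square_integrable_add square_integrable_scale)
  show "(c + d) *\<^sub>R f = c *\<^sub>R f + d *\<^sub>R f"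
    by transfer (auto simp: l2_rel_def distrib_right square_integrable_add square_integrable_scale)
  show "c *\<^sub>R d *\<^sub>R f = (c * d) *\<^sub>R f"
    by transfer (auto simp: l2_rel_def mult.assoc square_integrable_scale)
  show "1 *\<^sub>R f = f"
    by transfer (auto simp: l2_rel_def)
  show "dist f g = norm (f - g)" by (rule dist_l2_def)
  show "sgn f = scaleR (inverse (norm f)) f" by (rule sgn_l2_def)
  show "inner f g = inner g f"
    by transfer (simp add: mult.commute)
  show "inner (f + g) h = inner f h + inner g h"
    by transfer (simp add: l2_rel_def distrib_right square_integrable_mult)
  show "inner (c *\<^sub>R f) g = c * inner f g"
    by transfer (simp add: mult.assoc)
  show "0 \<le> inner f f"
    by transfer simp
  show "inner f f = 0 \<longleftrightarrow> f = 0"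
    by transfer
      (auto simp: l2_rel_def square_integrable_zero square_integrable_mult
        integral_nonneg_eq_0_iff_AE)
  show "norm f = sqrt (inner f f)" by (rule norm_l2_def)
qed (rule uniformity_l2_def open_l2_def)+

end


section \<open>Radon measures, the forward operator and its adjoint\<close>

text \<open>
  The torus is compact, so \<open>torus \<Rightarrow>\<^sub>C real\<close> is \<open>C(T)\<close> with the supremum norm.
  A real Radon measure is represented by the continuous linear functional
  \<open>\<psi> \<mapsto> \<integral> \<psi> dm\<close> on \<open>C(T)\<close>.
\<close>
type_synonym radon = "(torus \<Rightarrow>\<^sub>C real) \<Rightarrow>\<^sub>L real"

definition tv_norm :: "radon \<Rightarrow> real" where
  "tv_norm m = Sup {blinfun_apply m \<psi> | \<psi>. norm \<psi> \<le> 1}"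

definition dirac :: "torus \<Rightarrow> radon" where
  "dirac x = Blinfun (\<lambda>\<psi>. apply_bcontfun \<psi> x)"

lemma dirac_apply: "blinfun_apply (dirac x) \<psi> = apply_bcontfun \<psi> x"
proof -
  have "bounded_linear (\<lambda>\<psi> :: torus \<Rightarrow>\<^sub>C real. apply_bcontfun \<psi> x)"
    by (rule bounded_linear_intro[where K = 1])
      (use norm_bounded[where ?'b = real]
        in \<open>auto simp: plus_bcontfun.rep_eq scaleR_bcontfun.rep_eq simp flip: real_norm_def\<close>)
  then show ?thesis
    by (simp add: dirac_def bounded_linear_Blinfun_apply)
qed

definition spikes :: "real ^ 'n \<Rightarrow> torus ^ 'n \<Rightarrow> radon" where
  "spikes a x = (\<Sum>i\<in>UNIV. (a $ i) *\<^sub>R dirac (x $ i))"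

definition forward :: "(torus \<Rightarrow> real) \<Rightarrow> radon \<Rightarrow> l2" where
  "forward \<phi> m = abs_l2 (\<lambda>t. blinfun_apply m (Bcontfun (\<lambda>x. \<phi> (x - t))))"

definition adjoint_forward :: "(torus \<Rightarrow> real) \<Rightarrow> l2 \<Rightarrow> (torus \<Rightarrow>\<^sub>C real)" where
  "adjoint_forward \<phi> p = Bcontfun (\<lambda>t. \<integral>x. \<phi> (t - x) * rep_l2 p x \<partial>torus_measure)"

definition Gamma_map ::
    "(torus \<Rightarrow> real) \<Rightarrow> torus ^ 'n \<Rightarrow> (real ^ 'n) \<times> (real ^ 'n) \<Rightarrow> l2" where
  "Gamma_map \<phi> x = (\<lambda>(u, v).
     (\<Sum>i\<in>UNIV. (u $ i) *\<^sub>R abs_l2 (\<lambda>t. \<phi> (x $ i - t))) +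
     (\<Sum>i\<in>UNIV. (v $ i) *\<^sub>R abs_l2 (\<lambda>t. tderiv \<phi> (x $ i - t))))"


section \<open>The optimisation problems and the source condition\<close>

text \<open>Solutions of the penalised problem for \<open>\<lambda> > 0\<close>, of the constrained one for \<open>\<lambda> = 0\<close>.\<close>
definition solves_P :: "(torus \<Rightarrow> real) \<Rightarrow> real \<Rightarrow> l2 \<Rightarrow> radon \<Rightarrow> bool" where
  "solves_P \<phi> l y m \<longleftrightarrow>
     (if l = 0
      then forward \<phi> m = y \<and> (\<forall>m'. forward \<phi> m' = y \<longrightarrow> tv_norm m \<le> tv_norm m')
      else \<forall>m'. 1/2 * (norm (forward \<phi> m - y))\<^sup>2 + l * tv_norm m
             \<le> 1/2 * (norm (forward \<phi> m' - y))\<^sup>2 + l * tv_norm m')"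

definition solves_D0 :: "(torus \<Rightarrow> real) \<Rightarrow> l2 \<Rightarrow> l2 \<Rightarrow> bool" where
  "solves_D0 \<phi> y p \<longleftrightarrow> norm (adjoint_forward \<phi> p) \<le> 1 \<and>
     (\<forall>q. norm (adjoint_forward \<phi> q) \<le> 1 \<longrightarrow> inner y q \<le> inner y p)"

definition subdiff_tv :: "radon \<Rightarrow> (torus \<Rightarrow>\<^sub>C real) set" where
  "subdiff_tv m = {\<eta>. norm \<eta> \<le> 1 \<and> blinfun_apply m \<eta> = tv_norm m}"

definition min_norm_certificate :: "(torus \<Rightarrow> real) \<Rightarrow> l2 \<Rightarrow> (torus \<Rightarrow>\<^sub>C real)" where
  "min_norm_certificate \<phi> y = adjoint_forward \<phi>
     (THE p. solves_D0 \<phi> y p \<and> (\<forall>q. solves_D0 \<phi> y q \<longrightarrow> norm p \<le> norm q))"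

definition ndsc :: "(torus \<Rightarrow> real) \<Rightarrow> real ^ 'n \<Rightarrow> torus ^ 'n \<Rightarrow> bool" where
  "ndsc \<phi> a x \<longleftrightarrow>
     (\<exists>\<eta>. \<eta> \<in> range (adjoint_forward \<phi>) \<and> \<eta> \<in> subdiff_tv (spikes a x)) \<and>
     (let \<eta>0 = apply_bcontfun (min_norm_certificate \<phi> (forward \<phi> (spikes a x))) in
        (\<forall>s. s \<notin> range (\<lambda>i. x $ i) \<longrightarrow> \<bar>\<eta>0 s\<bar> < 1) \<and>
        (\<forall>i. tderiv (tderiv \<eta>0) (x $ i) \<noteq> 0))"

definition noise_domain :: "real \<Rightarrow> real \<Rightarrow> (real \<times> l2) set" where
  "noise_domain \<alpha> l0 = {(l, w). 0 \<le> l \<and> l \<le> l0 \<and> norm w \<le> \<alpha> * l}"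


section \<open>Maps of class \<open>C^k\<close>\<close>

definition bounded_multilinear_form ::
    "nat \<Rightarrow> ('a::real_normed_vector list \<Rightarrow> 'b::real_normed_vector) \<Rightarrow> bool" where
  "bounded_multilinear_form j T \<longleftrightarrow>
     (\<forall>us vs. length us + length vs + 1 = j \<longrightarrow> linear (\<lambda>v. T (us @ v # vs))) \<and>
     (\<exists>K. \<forall>vs. length vs = j \<longrightarrow> norm (T vs) \<le> K * prod_list (map norm vs))"

text \<open>
  \<open>C^k\<close> in the Frechet sense. \<open>D j z\<close> is the \<open>j\<close>-th derivative at \<open>z\<close>, a bounded
  \<open>j\<close>-linear map given on lists of length \<open>j\<close>. Differentiability of \<open>D j\<close> and
  continuity of \<open>D k\<close> are with respect to the operator norm of multilinear maps; on an
  infinite-dimensional domain this is stronger than asking for it along each fixed list of vectors.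
\<close>
definition Ck_on ::
    "nat \<Rightarrow> 'a::real_normed_vector set \<Rightarrow> ('a \<Rightarrow> 'b::real_normed_vector) \<Rightarrow> bool" where
  "Ck_on k U f \<longleftrightarrow> open U \<and> (\<exists>D :: nat \<Rightarrow> 'a \<Rightarrow> 'a list \<Rightarrow> 'b.
     (\<forall>z\<in>U. D 0 z [] = f z) \<and>
     (\<forall>j\<le>k. \<forall>z\<in>U. bounded_multilinear_form j (D j z)) \<and>
     (\<forall>j<k. \<forall>z\<in>U. \<forall>e>0. \<exists>d>0. \<forall>h. norm h < d \<longrightarrow> z + h \<in> U \<and>
        (\<forall>vs. length vs = j \<longrightarrow>
           norm (D j (z + h) vs - D j z vs - D (Suc j) z (h # vs))
             \<le> e * norm h * prod_list (map norm vs))) \<and>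
     (\<forall>z\<in>U. \<forall>e>0. \<exists>d>0. \<forall>z'\<in>U. dist z' z < d \<longrightarrow>
        (\<forall>vs. length vs = k \<longrightarrow> norm (D k z' vs - D k z vs) \<le> e * prod_list (map norm vs))))"

text \<open>For maps into \<open>T^N\<close>: locally the projection of a \<open>C^k\<close> map into \<open>R^N\<close>.\<close>
definition Ck_torus_on ::
    "nat \<Rightarrow> 'a::real_normed_vector set \<Rightarrow> ('a \<Rightarrow> torus ^ 'n) \<Rightarrow> bool" where
  "Ck_torus_on k U X \<longleftrightarrow> open U \<and> (\<forall>z\<in>U. \<exists>V (g :: 'a \<Rightarrow> real ^ 'n).
     z \<in> V \<and> V \<subseteq> U \<and> Ck_on k V g \<and> (\<forall>z'\<in>V. X z' = (\<chi> i. to_torus (g z' $ i))))"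

definition Ck_map_on ::
    "nat \<Rightarrow> 'a::real_normed_vector set \<Rightarrow> ('a \<Rightarrow> (real ^ 'n) \<times> (torus ^ 'n)) \<Rightarrow> bool" where
  "Ck_map_on k S F \<longleftrightarrow> (\<exists>U G. S \<subseteq> U \<and> (\<forall>z\<in>S. G z = F z) \<and>
     Ck_on k U (\<lambda>z. fst (G z)) \<and> Ck_torus_on k U (\<lambda>z. snd (G z)))"

end

theory Submission
  imports Defs
begin

text \<open>
  Write \<open>\<Gamma>\<^sub>x\<^sup>* (\<Phi>\<^sub>x a - y\<^sub>0 - w) + \<lambda> (sgn a\<^sub>0, 0) = 0\<close> for the first order conditions with prescribed signs. At
  \<open>\<lambda> = 0, w = 0\<close> the derivative in \<open>(a, x)\<close> is \<open>\<Gamma>\<^sup>* \<Gamma>\<close> composed with a diagonal scaling, hence invertible,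
  and the implicit function theorem gives \<open>(a, x)\<close> as a function of \<open>(\<lambda>, w)\<close> of the smoothness of these equations.
  The minimal norm certificate \<open>p\<^sub>0\<close> lies in the range of \<open>\<Gamma>\<close>, because perturbing it orthogonally to that
  range keeps it admissible. Consequently \<open>p = (y\<^sub>0 + w - \<Phi>\<^sub>x a) / \<lambda>\<close>, which solves \<open>\<Gamma>\<^sub>x\<^sup>* p = (sgn a\<^sub>0, 0)\<close>
  and is up to small terms in the range of \<open>\<Gamma>\<close>, is close to \<open>p\<^sub>0\<close> on the noise domain. Nondegeneracy is stable,
  so \<open>\<Phi>\<^sup>* p\<close> is a strict dual certificate for \<open>(a, x)\<close>; this yields optimality and uniqueness.
\<close>

section \<open>Families of class \<open>C\<^sup>k\<close>, uniformly\<close>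

text \<open>The noise w ranges over an infinite-dimensional space and \<open>Ck_on\<close> asks for
  operator-norm estimates, so smoothness is carried by families of functions: the derivatives of a
  family along unit directions form a family again. The unknown (a, x) stays finite-dimensional,
  which lets injectivity give invertibility and lets directions be expanded in a basis. The radius
  of the implicit function is fixed by C^1 data alone, so one solution branch has every order of
  smoothness that the equations allow; these contain phi', which costs one order. The noise domain
  is a cone because the certificate contains w / \<lambda>, of norm at most \<alpha>. The Taylor
  remainder of the synthesis is small relative to a displacement that is itself O(\<lambda>), so it
  also survives the division by \<lambda>. Measures are functionals throughout: duality with the
  forward operator, the total variation of spikes and the support argument for uniqueness are all
  obtained by testing with continuous functions.\<close>

text \<open>A family of functions is \<open>C\<^sup>k\<close> uniformly if it is so as one map into bounded functions on the
  index set. The derivative family is indexed by the directions in the unit ball, so that uniformity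
  is convergence in operator norm while the type of the functions stays the same.\<close>

fun uniform_Ck ::
    "nat \<Rightarrow> 'a::real_normed_vector set \<Rightarrow> ('a \<Rightarrow> 'b::real_normed_vector) set \<Rightarrow> bool" where
  "uniform_Ck 0 U F \<longleftrightarrow> (\<forall>z\<in>U. (\<exists>K. \<forall>f\<in>F. norm (f z) \<le> K) \<and>
     (\<forall>e>0. \<forall>\<^sub>F h in nhds 0. \<forall>f\<in>F. norm (f (z + h) - f z) \<le> e))"
| "uniform_Ck (Suc k) U F \<longleftrightarrow> uniform_Ck 0 U F \<and> (\<exists>D. (\<forall>z\<in>U. (\<forall>f\<in>F. linear (D f z)) \<and>
     (\<forall>e>0. \<forall>\<^sub>F h in nhds 0. \<forall>f\<in>F. norm (f (z + h) - f z - D f z h) \<le> e * norm h)) \<and>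
     uniform_Ck k U {\<lambda>z. D f z v | f v. f \<in> F \<and> norm v \<le> 1})"

lemma eventually_ball_subset:
  assumes "\<forall>\<^sub>F h in A. \<forall>f\<in>F. P h f" "G \<subseteq> F"
  shows "\<forall>\<^sub>F h in A. \<forall>f\<in>G. P h f"
  using assms(1) by (rule eventually_mono) (use assms(2) in blast)

lemma eventually_add_mem:
  fixes U :: "'a::real_normed_vector set"
  assumes "open U" "z \<in> U"
  shows "\<forall>\<^sub>F h in nhds 0. z + h \<in> U"
proof -
  have "((\<lambda>h. z + h) \<longlongrightarrow> z + 0) (nhds 0)" by (intro tendsto_intros filterlim_ident)
  then show ?thesis using assms topological_tendstoD by fastforce
qed

lemma pos_divide_times_cancel: "q > 0 \<Longrightarrow> a / q * q = a" for a q :: real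
  by simp

text \<open>The witness \<open>D\<close> assigns a derivative to each function, so it serves any
  subfamily. This is how derivative families, written as set comprehensions, are recognised inside
  the families that the closure rules produce.\<close>

lemma uniform_Ck_mono: "uniform_Ck k U F \<Longrightarrow> G \<subseteq> F \<Longrightarrow> uniform_Ck k U G"
proof (induction k arbitrary: F G)
  case 0
  have "\<exists>K. \<forall>f\<in>G. norm (f z) \<le> K" if "z \<in> U" for z
    using 0 that by (simp only: uniform_Ck.simps) (meson subsetD)
  moreover have "\<forall>\<^sub>F h in nhds 0. \<forall>f\<in>G. norm (f (z + h) - f z) \<le> e" if "z \<in> U" "e > 0" for z e
    by (rule eventually_ball_subset[OF _ 0(2)]) (use 0(1) that in simp)
  ultimately show ?case by simp
next
  case (Suc k)
  then obtain D where D: "\<forall>z\<in>U. (\<forall>f\<in>F. linear (D f z)) \<and>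
     (\<forall>e>0. \<forall>\<^sub>F h in nhds 0. \<forall>f\<in>F. norm (f (z + h) - f z - D f z h) \<le> e * norm h)"
     "uniform_Ck k U {\<lambda>z. D f z v | f v. f \<in> F \<and> norm v \<le> 1}" "uniform_Ck 0 U F" by auto
  have "uniform_Ck k U {\<lambda>z. D f z v | f v. f \<in> G \<and> norm v \<le> 1}"
    by (rule Suc.IH[OF D(2)]) (use Suc.prems in blast)
  moreover have "uniform_Ck 0 U G"
  proof -
    have "\<exists>K. \<forall>f\<in>G. norm (f z) \<le> K" if "z \<in> U" for z
      using D(3) Suc.prems(2) that by (simp only: uniform_Ck.simps) (meson subsetD)
    moreover have "\<forall>\<^sub>F h in nhds 0. \<forall>f\<in>G. norm (f (z + h) - f z) \<le> e" if "z \<in> U" "e > 0" for z e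
      by (rule eventually_ball_subset[OF _ Suc.prems(2)]) (use D(3) that in simp)
    ultimately show ?thesis by simp
  qed
  moreover have "\<forall>z\<in>U. (\<forall>f\<in>G. linear (D f z)) \<and>
     (\<forall>e>0. \<forall>\<^sub>F h in nhds 0. \<forall>f\<in>G. norm (f (z + h) - f z - D f z h) \<le> e * norm h)"
  proof (intro ballI conjI allI impI)
    fix z assume z: "z \<in> U"
    show "linear (D f z)" if "f \<in> G" for f using D(1) Suc.prems(2) that z by blast
    fix e :: real assume e: "e > 0"
    have "\<forall>\<^sub>F h in nhds 0. \<forall>f\<in>F. norm (f (z + h) - f z - D f z h) \<le> e * norm h"
      using D(1) z e by blast
    then show "\<forall>\<^sub>F h in nhds 0. \<forall>f\<in>G. norm (f (z + h) - f z - D f z h) \<le> e * norm h"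
      by (rule eventually_ball_subset[OF _ Suc.prems(2)])
  qed
  ultimately show ?case by auto
qed

text \<open>The definition attaches derivatives to functions, whereas constructions attach them to
  indices. Two indices may name the same function with different witnesses, so one index is chosen
  for each function; the resulting derivative family is a subfamily of the given one.\<close>

lemma uniform_Ck_Suc_I:
  assumes "uniform_Ck 0 U (f ` I)"
    and "\<And>z i. z \<in> U \<Longrightarrow> i \<in> I \<Longrightarrow> linear (D i z)"
    and "\<And>z e. z \<in> U \<Longrightarrow> e > 0 \<Longrightarrow>
      \<forall>\<^sub>F h in nhds 0. \<forall>i\<in>I. norm (f i (z + h) - f i z - D i z h) \<le> e * norm h"
    and "uniform_Ck k U {\<lambda>z. D i z v | i v. i \<in> I \<and> norm v \<le> 1}"
  shows "uniform_Ck (Suc k) U (f ` I)"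
proof -
  define s where "s g = (SOME i. i \<in> I \<and> f i = g)" for g
  have s: "s g \<in> I \<and> f (s g) = g" if "g \<in> f ` I" for g
    unfolding s_def by (rule someI_ex) (use that in blast)
  have "uniform_Ck k U {\<lambda>z. D (s g) z v | g v. g \<in> f ` I \<and> norm v \<le> 1}"
    by (rule uniform_Ck_mono[OF assms(4)]) (use s in blast)
  moreover have "\<forall>\<^sub>F h in nhds 0. \<forall>g\<in>f ` I. norm (g (z + h) - g z - D (s g) z h) \<le> e * norm h"
    if "z \<in> U" "e > 0" for z e
    using assms(3)[OF that] by (rule eventually_mono) (use s in metis)
  moreover have "\<forall>z\<in>U. \<forall>g\<in>f`I. linear (D (s g) z)"
    using s assms(2) by blast
  ultimately show ?thesis using assms(1) by (auto intro!: exI[of _ "\<lambda>g. D (s g)"])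
qed

text \<open>The operator bound \<open>K z\<close> is not part of the definition; it is the order 0
  bound of the derivative family over unit directions, extended to all directions by
  linearity.\<close>

lemma uniform_Ck_Suc_E:
  fixes U :: "'a::real_normed_vector set"
  assumes "uniform_Ck (Suc k) U (f ` I)"
  obtains D K where "\<And>z i. z \<in> U \<Longrightarrow> i \<in> I \<Longrightarrow> linear (D i z)"
    "\<And>z e. z \<in> U \<Longrightarrow> e > 0 \<Longrightarrow>
      \<forall>\<^sub>F h in nhds 0. \<forall>i\<in>I. norm (f i (z + h) - f i z - D i z h) \<le> e * norm h"
    "uniform_Ck k U {\<lambda>z. D i z v | i v. i \<in> I \<and> norm v \<le> 1}"
    "\<And>z i h. z \<in> U \<Longrightarrow> i \<in> I \<Longrightarrow> norm (D i z h) \<le> K z * norm h" "\<And>z. K z \<ge> 0"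
proof -
  have "\<exists>D. (\<forall>z\<in>U. (\<forall>g\<in>f ` I. linear (D g z)) \<and>
     (\<forall>e>0. \<forall>\<^sub>F h in nhds 0. \<forall>g\<in>f ` I. norm (g (z + h) - g z - D g z h) \<le> e * norm h)) \<and>
     uniform_Ck k U {\<lambda>z. D g z v | g v. g \<in> f ` I \<and> norm v \<le> 1}"
    using assms unfolding uniform_Ck.simps(2) by (rule conjunct2)
  then obtain D where D0: "\<forall>z\<in>U. (\<forall>g\<in>f ` I. linear (D g z)) \<and>
     (\<forall>e>0. \<forall>\<^sub>F h in nhds 0. \<forall>g\<in>f ` I. norm (g (z + h) - g z - D g z h) \<le> e * norm h)"
     and D3: "uniform_Ck k U {\<lambda>z. D g z v | g v. g \<in> f ` I \<and> norm v \<le> 1}"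
    by (elim exE conjE)
  have D1: "linear (D (f i) z)" if "z \<in> U" "i \<in> I" for z i
    using D0 that by blast
  have D2: "\<forall>\<^sub>F h in nhds 0. \<forall>i\<in>I. norm (f i (z + h) - f i z - D (f i) z h) \<le> e * norm h"
    if "z \<in> U" "e > 0" for z e
  proof -
    have "\<forall>\<^sub>F h in nhds 0. \<forall>g\<in>f ` I. norm (g (z + h) - g z - D g z h) \<le> e * norm h"
      using D0 that by blast
    then show ?thesis by (rule eventually_mono) blast
  qed
  have "uniform_Ck 0 U {\<lambda>z. D g z v | g v. g \<in> f ` I \<and> norm v \<le> 1}"
    using D3 by (cases k) auto
  then have bdd: "\<forall>z\<in>U. \<exists>K. \<forall>p\<in>{\<lambda>z. D g z v | g v. g \<in> f ` I \<and> norm v \<le> 1}. norm (p z) \<le> K"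
    by simp
  have "\<exists>K. \<forall>i\<in>I. \<forall>v. norm v \<le> 1 \<longrightarrow> norm (D (f i) z v) \<le> K" if z: "z \<in> U" for z
  proof -
    obtain K where K: "\<forall>p\<in>{\<lambda>z. D g z v | g v. g \<in> f ` I \<and> norm v \<le> 1}. norm (p z) \<le> K"
      using bspec[OF bdd z] by blast
    show ?thesis
    proof (intro exI ballI allI impI)
      fix i v assume "i \<in> I" "norm (v :: 'a) \<le> 1"
      then have "(\<lambda>z. D (f i) z v) \<in> {\<lambda>z. D g z v | g v. g \<in> f ` I \<and> norm v \<le> 1}" by blast
      from bspec[OF K this] show "norm (D (f i) z v) \<le> K" .
    qed
  qed
  then obtain K where K: "\<And>z i v. z \<in> U \<Longrightarrow> i \<in> I \<Longrightarrow> norm v \<le> 1 \<Longrightarrow> norm (D (f i) z v) \<le> K z"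
    by metis
  have bd: "norm (D (f i) z h) \<le> \<bar>K z\<bar> * norm h" if "z \<in> U" "i \<in> I" for z i h
  proof (cases "h = 0")
    case True
    then show ?thesis using linear_0[OF D1, of z i] that by simp
  next
    case False
    interpret linear "D (f i) z" by (rule D1) (use that in auto)
    have "norm (D (f i) z (h /\<^sub>R norm h)) \<le> K z" by (rule K) (use that False in auto)
    then have "norm (D (f i) z h) \<le> K z * norm h" using False by (simp add: scale field_simps)
    also have "\<dots> \<le> \<bar>K z\<bar> * norm h" by (rule mult_right_mono) auto
    finally show ?thesis .
  qed
  show ?thesis
  proof (rule that[of "\<lambda>i. D (f i)" "\<lambda>z. \<bar>K z\<bar>"])
    show "uniform_Ck k U {\<lambda>z. D (f i) z v | i v. i \<in> I \<and> norm v \<le> 1}"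
      by (rule uniform_Ck_mono[OF D3]) blast
  qed (use D1 D2 bd in auto)
qed

lemma uniform_Ck_imp_0: "uniform_Ck k U F \<Longrightarrow> uniform_Ck 0 U F"
  by (cases k) auto

lemmas uniform_Ck_Suc_E_set = uniform_Ck_Suc_E[where f = "\<lambda>f. f", unfolded image_ident]

text \<open>Only the derivative family has to lose an order, which is the induction hypothesis; the
  derivative witnesses are kept.\<close>

lemma uniform_Ck_SucD: "uniform_Ck (Suc k) U F \<Longrightarrow> uniform_Ck k U F"
proof (induction k arbitrary: F)
  case 0
  then show ?case by simp
next
  case (Suc k)
  show ?case
  proof (rule uniform_Ck_Suc_E_set[OF Suc.prems])
    fix D K
    assume D: "\<And>z i. z \<in> U \<Longrightarrow> i \<in> F \<Longrightarrow> linear (D i z)"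
      "\<And>z e. z \<in> U \<Longrightarrow> e > 0 \<Longrightarrow>
      \<forall>\<^sub>F h in nhds 0. \<forall>i\<in>F. norm (i (z + h) - i z - D i z h) \<le> e * norm h"
      "uniform_Ck (Suc k) U {\<lambda>z. D i z v | i v. i \<in> F \<and> norm v \<le> 1}"
    have "uniform_Ck (Suc k) U ((\<lambda>f. f) ` F)"
      by (rule uniform_Ck_Suc_I[where D = D])
        (use D(1,2) Suc.IH[OF D(3)] uniform_Ck_imp_0[OF Suc.prems] in \<open>simp_all only: image_ident\<close>)
    then show ?case by simp
  qed
qed

lemma uniform_Ck_le: "uniform_Ck k U F \<Longrightarrow> j \<le> k \<Longrightarrow> uniform_Ck j U F"
  by (induction k) (auto simp del: uniform_Ck.simps simp: le_Suc_eq dest: uniform_Ck_SucD)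

lemma uniform_Ck_0_D:
  assumes "uniform_Ck k U (f ` I)" "z \<in> U"
  obtains K where "K \<ge> 0" "\<And>i. i \<in> I \<Longrightarrow> norm (f i z) \<le> K"
    "\<And>e. e > 0 \<Longrightarrow> \<forall>\<^sub>F h in nhds 0. \<forall>i\<in>I. norm (f i (z + h) - f i z) \<le> e"
proof -
  have 0: "uniform_Ck 0 U (f ` I)" using assms(1) by (rule uniform_Ck_imp_0)
  then obtain K where K: "\<forall>g\<in>f ` I. norm (g z) \<le> K" using assms(2) by auto
  show ?thesis
  proof (rule that[of "\<bar>K\<bar>"])
    show "norm (f i z) \<le> \<bar>K\<bar>" if "i \<in> I" for i using K that by force
    show "\<forall>\<^sub>F h in nhds 0. \<forall>i\<in>I. norm (f i (z + h) - f i z) \<le> e" if "e > 0" for e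
      using 0 assms(2) that by simp
  qed simp
qed

lemmas uniform_Ck_0_D_set = uniform_Ck_0_D[where f = "\<lambda>f. f", unfolded image_ident]

lemma uniform_Ck_0_I:
  assumes "\<And>z. z \<in> U \<Longrightarrow> \<exists>K. \<forall>i\<in>I. norm (f i z) \<le> K"
    and "\<And>z e. z \<in> U \<Longrightarrow> e > 0 \<Longrightarrow> \<forall>\<^sub>F h in nhds 0. \<forall>i\<in>I. norm (f i (z + h) - f i z) \<le> e"
  shows "uniform_Ck 0 U (f ` I)"
  using assms by auto

text \<open>Openness keeps \<open>z + h\<close> in \<open>U\<close> for small \<open>h\<close>, and
  the derivative witnesses are reused. Identities between derivatives rest on linearity, which is
  known on \<open>U\<close> only.\<close>

lemma uniform_Ck_cong:
  assumes "open U" "\<And>i z. i \<in> I \<Longrightarrow> z \<in> U \<Longrightarrow> f i z = g i z"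
    and "uniform_Ck k U (f ` I)"
  shows "uniform_Ck k U (g ` I)"
proof -
  note nh = eventually_add_mem[OF assms(1)]
  have c0: "uniform_Ck 0 U (g ` I)"
  proof (rule uniform_Ck_0_I)
    fix z assume z: "z \<in> U"
    obtain K where "K \<ge> 0" and K: "\<And>i. i \<in> I \<Longrightarrow> norm (f i z) \<le> K"
      "\<And>e. e > 0 \<Longrightarrow> \<forall>\<^sub>F h in nhds 0. \<forall>i\<in>I. norm (f i (z + h) - f i z) \<le> e"
      using that by (rule uniform_Ck_0_D[OF assms(3) z])
    show "\<exists>K. \<forall>i\<in>I. norm (g i z) \<le> K" using K(1) assms(2) z by metis
    fix e :: real assume "e > 0"
    show "\<forall>\<^sub>F h in nhds 0. \<forall>i\<in>I. norm (g i (z + h) - g i z) \<le> e"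
      using K(2)[OF \<open>e > 0\<close>] nh[OF z] by eventually_elim (use assms(2) z in metis)
  qed
  show ?thesis
  proof (cases k)
    case 0
    then show ?thesis using c0 by simp
  next
    case (Suc l)
    obtain D K where D: "\<And>z i. z \<in> U \<Longrightarrow> i \<in> I \<Longrightarrow> linear (D i z)"
      "\<And>z e. z \<in> U \<Longrightarrow> e > 0 \<Longrightarrow>
        \<forall>\<^sub>F h in nhds 0. \<forall>i\<in>I. norm (f i (z + h) - f i z - D i z h) \<le> e * norm h"
      "uniform_Ck l U {\<lambda>z. D i z v | i v. i \<in> I \<and> norm v \<le> 1}"
      "\<And>z i h. z \<in> U \<Longrightarrow> i \<in> I \<Longrightarrow> norm (D i z h) \<le> K z * norm h" "\<And>z. K z \<ge> 0"
      using that by (rule uniform_Ck_Suc_E[OF assms(3)[unfolded Suc]])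
    have "uniform_Ck (Suc l) U (g ` I)"
    proof (rule uniform_Ck_Suc_I[OF c0])
      fix z e assume z: "z \<in> U" and "e > (0::real)"
      show "\<forall>\<^sub>F h in nhds 0. \<forall>i\<in>I. norm (g i (z + h) - g i z - D i z h) \<le> e * norm h"
        using D(2)[OF z \<open>e > 0\<close>] nh[OF z] by eventually_elim (use assms(2) z in metis)
    qed (use D in auto)
    then show ?thesis using Suc by simp
  qed
qed

text \<open>The bound \<open>K\<close> is what order 0 demands of a family; the derivative family
  contains nothing but the zero function.\<close>

lemma uniform_Ck_const:
  fixes U :: "'a::real_normed_vector set" and c :: "'i \<Rightarrow> 'b::real_normed_vector"
  assumes "\<And>i. i \<in> I \<Longrightarrow> norm (c i) \<le> K"
  shows "uniform_Ck k U ((\<lambda>i z. c i) ` I)"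
proof -
  have zero: "uniform_Ck k U {\<lambda>z. 0 :: 'b}" for k
  proof (induction k)
    case (Suc k)
    have "uniform_Ck k U {\<lambda>z. 0 :: 'b | i v. i \<in> {()} \<and> norm (v :: 'a) \<le> 1}"
      by (rule uniform_Ck_mono[OF Suc]) blast
    then have "uniform_Ck (Suc k) U ((\<lambda>i z. 0 :: 'b) ` {()})"
      by (intro uniform_Ck_Suc_I[where D = "\<lambda>i z v. 0"]) (auto simp: linear_zero)
    then show ?case by simp
  qed auto
  have 0: "uniform_Ck 0 U ((\<lambda>i z. c i) ` I)"
    using assms by auto
  show ?thesis
  proof (cases k)
    case (Suc l)
    have "uniform_Ck l U {\<lambda>z. 0 :: 'b | i v. i \<in> I \<and> norm (v :: 'a) \<le> 1}"
      by (rule uniform_Ck_mono[OF zero]) blast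
    then have "uniform_Ck (Suc l) U ((\<lambda>i z. c i) ` I)"
      by (intro uniform_Ck_Suc_I[OF 0, where D = "\<lambda>i z v. 0"]) (auto simp: linear_zero)
    then show ?thesis using Suc by simp
  qed (use 0 in simp)
qed

lemma uniform_Ck_linear:
  fixes L :: "'a::real_normed_vector \<Rightarrow> 'b::real_normed_vector"
  assumes "bounded_linear L"
  shows "uniform_Ck k U {L}"
proof -
  interpret bounded_linear L by fact
  obtain K where K: "\<And>x. norm (L x) \<le> norm x * K" using bounded by blast
  have 0: "uniform_Ck 0 U ((\<lambda>_. L) ` {()})"
  proof (rule uniform_Ck_0_I)
    fix z e assume "e > (0::real)"
    have "((\<lambda>h. norm (L h)) \<longlongrightarrow> norm (L 0)) (nhds 0)"
      by (intro tendsto_norm tendsto tendsto_ident_at) (simp add: filterlim_ident)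
    then have "\<forall>\<^sub>F h in nhds 0. norm (L h) < e"
      using \<open>e > 0\<close> order_tendstoD(2) by (fastforce simp: zero)
    then show "\<forall>\<^sub>F h in nhds 0. \<forall>i\<in>{()}. norm (L (z + h) - L z) \<le> e"
      by eventually_elim (simp add: add)
  qed auto
  show ?thesis
  proof (cases k)
    case 0 with \<open>uniform_Ck 0 _ _\<close> show ?thesis by simp
  next
    case (Suc l)
    have "uniform_Ck l U ((\<lambda>v z. L v) ` {v. norm v \<le> 1})"
    proof (rule uniform_Ck_const)
      fix v :: "'a" assume "v \<in> {v. norm v \<le> 1}"
      then have "norm v * K \<le> 1 * \<bar>K\<bar>" by (intro order_trans[OF mult_left_mono[OF abs_ge_self] mult_right_mono]) auto
      then show "norm (L v) \<le> \<bar>K\<bar>" using K[of v] by simp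
    qed
    then have "uniform_Ck l U {\<lambda>z. L v | (i::unit) v. i \<in> {()} \<and> norm v \<le> 1}"
      by (rule uniform_Ck_mono) auto
    then have "uniform_Ck (Suc l) U ((\<lambda>_. L) ` {()})"
      by (rule uniform_Ck_Suc_I[OF 0, where D = "\<lambda>_ _. L", rotated 2])
        (auto simp: add intro!: bounded_linear.linear[OF assms])
    then show ?thesis using Suc by simp
  qed
qed

section \<open>Sums, products and rescalings of families\<close>

lemma uniform_Ck_add:
  assumes "uniform_Ck k U F" "uniform_Ck k U G"
  shows "uniform_Ck k U {\<lambda>z. f z + g z | f g. f \<in> F \<and> g \<in> G}"
  using assms
proof (induction k arbitrary: F G)
  case 0
  have "uniform_Ck 0 U ((\<lambda>(f,g) z. f z + g z) ` (F \<times> G))"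
  proof (rule uniform_Ck_0_I)
    fix z assume z: "z \<in> U"
    obtain K where "K \<ge> 0" and K: "\<And>f. f \<in> F \<Longrightarrow> norm (f z) \<le> K"
      "\<And>e. e > 0 \<Longrightarrow> \<forall>\<^sub>F h in nhds 0. \<forall>f\<in>F. norm (f (z + h) - f z) \<le> e"
      using that by (rule uniform_Ck_0_D_set[OF 0(1) z])
    obtain L where "L \<ge> 0" and L: "\<And>f. f \<in> G \<Longrightarrow> norm (f z) \<le> L"
      "\<And>e. e > 0 \<Longrightarrow> \<forall>\<^sub>F h in nhds 0. \<forall>f\<in>G. norm (f (z + h) - f z) \<le> e"
      using that by (rule uniform_Ck_0_D_set[OF 0(2) z])
    show "\<exists>K. \<forall>i\<in>F \<times> G. norm ((case i of (f, g) \<Rightarrow> \<lambda>z. f z + g z) z) \<le> K"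
      by (rule exI[of _ "K + L"]) (auto intro!: norm_triangle_le add_mono K L)
    fix e :: real assume e: "e > 0"
    have e2: "e/2 > 0" using e by simp
    from K(2)[OF e2] L(2)[OF e2]
    show "\<forall>\<^sub>F h in nhds 0. \<forall>i\<in>F \<times> G. norm ((case i of (f, g) \<Rightarrow> \<lambda>z. f z + g z) (z + h) -
               (case i of (f, g) \<Rightarrow> \<lambda>z. f z + g z) z) \<le> e"
    proof eventually_elim
      case (elim h)
      show ?case
      proof safe
        fix f g assume "f \<in> F" "g \<in> G"
        then show "norm (f (z + h) + g (z + h) - (f z + g z)) \<le> e"
          using norm_triangle_ineq[of "f (z + h) - f z" "g (z + h) - g z"] bspec[OF elim(1), of f] bspec[OF elim(2), of g]
          by (simp add: algebra_simps)
      qed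
    qed
  qed
  then show ?case by (rule uniform_Ck_mono) auto
next
  case (Suc k)
  obtain D K where D: "\<And>z f. z \<in> U \<Longrightarrow> f \<in> F \<Longrightarrow> linear (D f z)"
     "\<And>z e. z \<in> U \<Longrightarrow> e > 0 \<Longrightarrow> \<forall>\<^sub>F h in nhds 0. \<forall>f\<in>F. norm (f (z + h) - f z - D f z h) \<le> e * norm h"
     "uniform_Ck k U {\<lambda>z. D f z v | f v. f \<in> F \<and> norm v \<le> 1}"
     "\<And>z f h. z \<in> U \<Longrightarrow> f \<in> F \<Longrightarrow> norm (D f z h) \<le> K z * norm h" "\<And>z. K z \<ge> 0"
    using that by (rule uniform_Ck_Suc_E_set[OF Suc.prems(1)])
  obtain E K where E: "\<And>z f. z \<in> U \<Longrightarrow> f \<in> G \<Longrightarrow> linear (E f z)"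
     "\<And>z e. z \<in> U \<Longrightarrow> e > 0 \<Longrightarrow> \<forall>\<^sub>F h in nhds 0. \<forall>f\<in>G. norm (f (z + h) - f z - E f z h) \<le> e * norm h"
     "uniform_Ck k U {\<lambda>z. E f z v | f v. f \<in> G \<and> norm v \<le> 1}"
     "\<And>z f h. z \<in> U \<Longrightarrow> f \<in> G \<Longrightarrow> norm (E f z h) \<le> K z * norm h" "\<And>z. K z \<ge> 0"
    using that by (rule uniform_Ck_Suc_E_set[OF Suc.prems(2)])
  have "uniform_Ck k U {\<lambda>z. f z + g z | f g. f \<in> F \<and> g \<in> G}"
    using Suc.IH Suc.prems uniform_Ck_SucD by blast
  then have "uniform_Ck 0 U {\<lambda>z. f z + g z | f g. f \<in> F \<and> g \<in> G}" by (rule uniform_Ck_imp_0)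
  then have 0: "uniform_Ck 0 U ((\<lambda>(f,g) z. f z + g z) ` (F \<times> G))"
    by (rule uniform_Ck_mono) auto
  have "uniform_Ck (Suc k) U ((\<lambda>(f,g) z. f z + g z) ` (F \<times> G))"
  proof (rule uniform_Ck_Suc_I[OF 0])
    show "linear ((case i of (f, g) \<Rightarrow> \<lambda>z v. D f z v + E g z v) z)" if "z \<in> U" "i \<in> F \<times> G" for z i
      using that D(1) E(1) by (auto intro: linear_compose_add)
    show "uniform_Ck k U {\<lambda>z. (case i of (f, g) \<Rightarrow> \<lambda>z v. D f z v + E g z v) z v |i v. i \<in> F \<times> G \<and> norm v \<le> 1}"
      using Suc.IH[OF D(3) E(3)] by (rule uniform_Ck_mono) fastforce
    fix z and e :: real assume z: "z \<in> U" and e: "e > 0"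
    have e2: "e/2 > 0" using e by simp
    from D(2)[OF z e2] E(2)[OF z e2]
    show "\<forall>\<^sub>F h in nhds 0. \<forall>i\<in>F \<times> G. norm ((case i of (f, g) \<Rightarrow> \<lambda>z. f z + g z) (z + h) -
               (case i of (f, g) \<Rightarrow> \<lambda>z. f z + g z) z - (case i of (f, g) \<Rightarrow> \<lambda>z v. D f z v + E g z v) z h) \<le> e * norm h"
    proof eventually_elim
      case (elim h)
      show ?case
      proof safe
        fix f g assume "f \<in> F" "g \<in> G"
        then have "norm (f (z + h) - f z - D f z h) \<le> e/2 * norm h" "norm (g (z + h) - g z - E g z h) \<le> e/2 * norm h"
          using elim by blast+
        then show "norm (f (z + h) + g (z + h) - (f z + g z) - (D f z h + E g z h)) \<le> e * norm h"
          using norm_triangle_ineq[of "f (z + h) - f z - D f z h" "g (z + h) - g z - E g z h"]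
          by (simp add: algebra_simps)
      qed
    qed
  qed
  then show ?case by (rule uniform_Ck_mono) auto
qed

lemma uniform_Ck_add_image:
  assumes "uniform_Ck k U (f ` I)" "uniform_Ck k U (g ` I)"
  shows "uniform_Ck k U ((\<lambda>i z. f i z + g i z) ` I)"
  by (rule uniform_Ck_mono[OF uniform_Ck_add[OF assms]]) blast

text \<open>The constant is the operator bound of the derivatives plus 1, the latter from the
  remainder taken with error 1.\<close>

lemma uniform_Ck_lipschitz_at:
  assumes "uniform_Ck (Suc k) U (f ` I)" "z \<in> U"
  obtains C where "C > 0" "\<forall>\<^sub>F h in nhds 0. \<forall>i\<in>I. norm (f i (z + h) - f i z) \<le> C * norm h"
proof -
  obtain D K where "\<And>z i. z \<in> U \<Longrightarrow> i \<in> I \<Longrightarrow> linear (D i z)" and D: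
     "\<And>z e. z \<in> U \<Longrightarrow> e > 0 \<Longrightarrow> \<forall>\<^sub>F h in nhds 0. \<forall>i\<in>I. norm (f i (z + h) - f i z - D i z h) \<le> e * norm h"
     "uniform_Ck k U {\<lambda>z. D i z v | i v. i \<in> I \<and> norm v \<le> 1}"
     "\<And>z i h. z \<in> U \<Longrightarrow> i \<in> I \<Longrightarrow> norm (D i z h) \<le> K z * norm h" "\<And>z. K z \<ge> 0"
    using that by (rule uniform_Ck_Suc_E[OF assms(1)])
  show ?thesis
  proof (rule that[of "K z + 1"])
    show "K z + 1 > 0" using D(4)[of z] by simp
    show "\<forall>\<^sub>F h in nhds 0. \<forall>i\<in>I. norm (f i (z + h) - f i z) \<le> (K z + 1) * norm h"
      using D(1)[OF assms(2) zero_less_one]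
    proof eventually_elim
      case (elim h)
      show ?case
      proof
        fix i assume i: "i \<in> I"
        have "norm (f i (z + h) - f i z) \<le> norm (f i (z + h) - f i z - D i z h) + norm (D i z h)"
          using norm_triangle_sub by (metis add.commute)
        then show "norm (f i (z + h) - f i z) \<le> (K z + 1) * norm h"
          using bspec[OF elim i] D(3)[OF assms(2) i, of h] by (simp add: algebra_simps)
      qed
    qed
  qed
qed

text \<open>Products of all pairs are taken, not of matched indices: then both terms of the Leibniz
  rule are families of such products, with one factor replaced by a derivative family, and the
  induction closes. The remainder is remainder times value, plus value times remainder, plus
  increment times increment.\<close>

lemma uniform_Ck_bilinear:
  fixes U :: "'z::real_normed_vector set"
  assumes "bounded_bilinear bop"
    and "uniform_Ck k U F" "uniform_Ck k U G"
  shows "uniform_Ck k U {\<lambda>z. bop (f z) (g z) | f g. f \<in> F \<and> g \<in> G}"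
  using assms(2,3)
proof (induction k arbitrary: F G)
  case 0
  interpret bounded_bilinear bop by fact
  obtain B where B: "B > 0" "\<And>a b. norm (bop a b) \<le> norm a * norm b * B" using pos_bounded by blast
  have bb: "norm (bop a b) \<le> x * y * B" if "norm a \<le> x" "norm b \<le> y" for a b x y
  proof -
    have "norm a * norm b \<le> x * y"
      by (rule mult_mono[OF that order_trans[OF norm_ge_zero that(1)] norm_ge_zero])
    then show ?thesis by (rule order_trans[OF B(2) mult_right_mono]) (use B(1) in simp)
  qed
  have "uniform_Ck 0 U ((\<lambda>(f,g) z. bop (f z) (g z)) ` (F \<times> G))"
  proof (rule uniform_Ck_0_I)
    fix z assume z: "z \<in> U"
    obtain K where K: "K \<ge> 0" "\<And>f. f \<in> F \<Longrightarrow> norm (f z) \<le> K"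
      "\<And>e. e > 0 \<Longrightarrow> \<forall>\<^sub>F h in nhds 0. \<forall>f\<in>F. norm (f (z + h) - f z) \<le> e"
      using that by (rule uniform_Ck_0_D_set[OF 0(1) z])
    obtain L where L: "L \<ge> 0" "\<And>f. f \<in> G \<Longrightarrow> norm (f z) \<le> L"
      "\<And>e. e > 0 \<Longrightarrow> \<forall>\<^sub>F h in nhds 0. \<forall>f\<in>G. norm (f (z + h) - f z) \<le> e"
      using that by (rule uniform_Ck_0_D_set[OF 0(2) z])
    have "norm (bop (f z) (g z)) \<le> K * L * B" if "f \<in> F" "g \<in> G" for f g
      by (intro bb K(2) L(2) that)
    then show "\<exists>K. \<forall>i\<in>F \<times> G. norm ((case i of (f, g) \<Rightarrow> \<lambda>z. bop (f z) (g z)) z) \<le> K"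
      by (intro exI[of _ "K * L * B"]) auto
    fix e :: real assume e: "e > 0"
    \<comment> \<open>\<open>K\<close> and \<open>L\<close> bound the two values; the cap 1 makes
      the product of the increments at most \<open>d\<close>, so that all three terms are multiples
      of \<open>d\<close>.\<close>
    define d where "d = min 1 (e / (B * (K + L + 1)))"
    have d: "d > 0" "d \<le> 1" "d * (B * (K + L + 1)) \<le> e"
    proof -
      have Q: "B * (K + L + 1) > 0" using B(1) K(1) L(1) by simp
      then show "d > 0" "d \<le> 1" using e by (simp_all add: d_def)
      have "d \<le> e / (B * (K + L + 1))" by (simp add: d_def)
      then show "d * (B * (K + L + 1)) \<le> e" using Q by (simp only: pos_le_divide_eq)
    qed
    from K(3)[OF d(1)] L(3)[OF d(1)]
    show "\<forall>\<^sub>F h in nhds 0. \<forall>i\<in>F \<times> G. norm ((case i of (f, g) \<Rightarrow> \<lambda>z. bop (f z) (g z)) (z + h) -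
               (case i of (f, g) \<Rightarrow> \<lambda>z. bop (f z) (g z)) z) \<le> e"
    proof eventually_elim
      case (elim h)
      show ?case
      proof safe
        fix f g assume fg: "f \<in> F" "g \<in> G"
        let ?u = "f (z + h) - f z" and ?v = "g (z + h) - g z"
        have uv: "norm ?u \<le> d" "norm ?v \<le> d" using elim fg by auto
        have eq: "bop (f (z + h)) (g (z + h)) - bop (f z) (g z) = bop ?u (g z) + bop (f z) ?v + bop ?u ?v"
          by (simp add: diff_left diff_right)
        have "norm (bop ?u (g z) + bop (f z) ?v + bop ?u ?v) \<le> norm (bop ?u (g z)) + norm (bop (f z) ?v) + norm (bop ?u ?v)"
          by (intro norm_triangle_le add_mono order_refl norm_triangle_ineq)
        also have "\<dots> \<le> d * L * B + K * d * B + d * 1 * B"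
          by (rule add_mono[OF add_mono[OF bb[OF uv(1) L(2)[OF fg(2)]] bb[OF K(2)[OF fg(1)] uv(2)]]
                bb[OF uv(1) order_trans[OF uv(2) d(2)]]])
        also have "\<dots> = d * (B * (K + L + 1))" by (simp add: algebra_simps)
        finally show "norm (bop (f (z + h)) (g (z + h)) - bop (f z) (g z)) \<le> e" unfolding eq using d(3) by linarith
      qed
    qed
  qed
  then show ?case by (rule uniform_Ck_mono) auto
next
  case (Suc k)
  interpret bounded_bilinear bop by fact
  obtain B where B: "B > 0" "\<And>a b. norm (bop a b) \<le> norm a * norm b * B" using pos_bounded by blast
  have bb: "norm (bop a b) \<le> x * y * B" if "norm a \<le> x" "norm b \<le> y" for a b x y
  proof -
    have "norm a * norm b \<le> x * y"
      by (rule mult_mono[OF that order_trans[OF norm_ge_zero that(1)] norm_ge_zero])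
    then show ?thesis by (rule order_trans[OF B(2) mult_right_mono]) (use B(1) in simp)
  qed
  obtain D K where D: "\<And>z f. z \<in> U \<Longrightarrow> f \<in> F \<Longrightarrow> linear (D f z)"
     "\<And>z e. z \<in> U \<Longrightarrow> e > 0 \<Longrightarrow> \<forall>\<^sub>F h in nhds 0. \<forall>f\<in>F. norm (f (z + h) - f z - D f z h) \<le> e * norm h"
     "uniform_Ck k U {\<lambda>z. D f z v | f v. f \<in> F \<and> norm v \<le> 1}"
     "\<And>z f h. z \<in> U \<Longrightarrow> f \<in> F \<Longrightarrow> norm (D f z h) \<le> K z * norm h" "\<And>z. K z \<ge> 0"
    using that by (rule uniform_Ck_Suc_E_set[OF Suc.prems(1)])
  obtain E K where E: "\<And>z f. z \<in> U \<Longrightarrow> f \<in> G \<Longrightarrow> linear (E f z)"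
     "\<And>z e. z \<in> U \<Longrightarrow> e > 0 \<Longrightarrow> \<forall>\<^sub>F h in nhds 0. \<forall>f\<in>G. norm (f (z + h) - f z - E f z h) \<le> e * norm h"
     "uniform_Ck k U {\<lambda>z. E f z v | f v. f \<in> G \<and> norm v \<le> 1}"
     "\<And>z f h. z \<in> U \<Longrightarrow> f \<in> G \<Longrightarrow> norm (E f z h) \<le> K z * norm h" "\<And>z. K z \<ge> 0"
    using that by (rule uniform_Ck_Suc_E_set[OF Suc.prems(2)])
  have FG: "uniform_Ck k U F" "uniform_Ck k U G" using Suc.prems uniform_Ck_SucD by blast+
  have "uniform_Ck 0 U {\<lambda>z. bop (f z) (g z) | f g. f \<in> F \<and> g \<in> G}"
    using Suc.IH[OF FG] by (rule uniform_Ck_imp_0)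
  then have 0: "uniform_Ck 0 U ((\<lambda>(f,g) z. bop (f z) (g z)) ` (F \<times> G))"
    by (rule uniform_Ck_mono) auto
  let ?D = "\<lambda>i. case i of (f, g) \<Rightarrow> \<lambda>z v. bop (D f z v) (g z) + bop (f z) (E g z v)"
  have "uniform_Ck (Suc k) U ((\<lambda>(f,g) z. bop (f z) (g z)) ` (F \<times> G))"
  proof (rule uniform_Ck_Suc_I[OF 0])
    show "linear (?D i z)" if zi: "z \<in> U" "i \<in> F \<times> G" for z i
    proof -
      obtain f g where fg: "i = (f, g)" "f \<in> F" "g \<in> G" using zi by auto
      have "linear (\<lambda>v. bop (D f z v) (g z))"
        using linear_compose[OF D(1)[OF zi(1) fg(2)] bounded_linear.linear[OF bounded_linear_left]]
        by (simp add: o_def)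
      moreover have "linear (\<lambda>v. bop (f z) (E g z v))"
        using linear_compose[OF E(1)[OF zi(1) fg(3)] bounded_linear.linear[OF bounded_linear_right]]
        by (simp add: o_def)
      ultimately show ?thesis unfolding fg by (simp add: linear_compose_add)
    qed
    define P where "P = {\<lambda>z. bop (f z) (g z) |f g. f \<in> {\<lambda>z. D f z v | f v. f \<in> F \<and> norm v \<le> 1} \<and> g \<in> G}"
    define Q where "Q = {\<lambda>z. bop (f z) (g z) |f g. f \<in> F \<and> g \<in> {\<lambda>z. E f z v | f v. f \<in> G \<and> norm v \<le> 1}}"
    have "uniform_Ck k U {\<lambda>z. p z + q z | p q. p \<in> P \<and> q \<in> Q}"
      unfolding P_def Q_def by (intro uniform_Ck_add Suc.IH D E FG)
    then show "uniform_Ck k U {\<lambda>z. ?D i z v |i v. i \<in> F \<times> G \<and> norm v \<le> 1}"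
    proof (rule uniform_Ck_mono, safe)
      fix f g and v :: 'z assume fg: "f \<in> F" "g \<in> G" "norm v \<le> 1"
      have "(\<lambda>z. bop (D f z v) (g z)) \<in> P" unfolding P_def
        by (rule CollectI, rule exI[of _ "\<lambda>z. D f z v"], rule exI[of _ g]) (use fg in blast)
      moreover have "(\<lambda>z. bop (f z) (E g z v)) \<in> Q" unfolding Q_def
        by (rule CollectI, rule exI[of _ f], rule exI[of _ "\<lambda>z. E g z v"]) (use fg in blast)
      ultimately show "\<exists>p q. (\<lambda>z. bop (D f z v) (g z) + bop (f z) (E g z v)) = (\<lambda>z. p z + q z) \<and> p \<in> P \<and> q \<in> Q"
        by - (rule exI, rule exI, rule conjI, rule refl, rule conjI)
    qed
    fix z and e :: real assume z: "z \<in> U" and e: "e > 0"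
    obtain K where K: "K \<ge> 0" "\<And>f. f \<in> F \<Longrightarrow> norm (f z) \<le> K"
      "\<And>e. e > 0 \<Longrightarrow> \<forall>\<^sub>F h in nhds 0. \<forall>f\<in>F. norm (f (z + h) - f z) \<le> e"
      using that by (rule uniform_Ck_0_D_set[OF FG(1) z])
    obtain L where L: "L \<ge> 0" "\<And>f. f \<in> G \<Longrightarrow> norm (f z) \<le> L"
      using that by (rule uniform_Ck_0_D_set[OF FG(2) z])
    obtain C where C: "C > 0" "\<forall>\<^sub>F h in nhds 0. \<forall>f\<in>G. norm (f (z + h) - f z) \<le> C * norm h"
      using Suc.prems(2) z by (rule uniform_Ck_lipschitz_at[where f = "\<lambda>f. f", unfolded image_ident])
    \<comment> \<open>\<open>C\<close> is the Lipschitz constant of the second family: the product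
      of the increments is then at most \<open>d * (C * norm h)\<close> up to \<open>B\<close>,
      first order in \<open>h\<close> with a small factor.\<close>
    define d where "d = e / (B * (K + L + C))"
    have d: "d > 0" "d * (B * (K + L + C)) \<le> e"
    proof -
      have Q: "B * (K + L + C) > 0" using B(1) K(1) L(1) C(1) by simp
      then show "d > 0" "d * (B * (K + L + C)) \<le> e" using e by (simp_all add: d_def)
    qed
    from K(3)[OF d(1)] D(2)[OF z d(1)] E(2)[OF z d(1)] C(2)
    show "\<forall>\<^sub>F h in nhds 0. \<forall>i\<in>F \<times> G. norm ((case i of (f, g) \<Rightarrow> \<lambda>z. bop (f z) (g z)) (z + h) -
               (case i of (f, g) \<Rightarrow> \<lambda>z. bop (f z) (g z)) z - ?D i z h) \<le> e * norm h"
    proof eventually_elim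
      case (elim h)
      show ?case
      proof safe
        fix f g assume fg: "f \<in> F" "g \<in> G"
        let ?u = "f (z + h) - f z" and ?v = "g (z + h) - g z"
        let ?u1 = "?u - D f z h" and ?v1 = "?v - E g z h"
        have uv: "norm ?u \<le> d" "norm ?v \<le> C * norm h" "norm ?u1 \<le> d * norm h" "norm ?v1 \<le> d * norm h"
          using elim fg by auto
        have eq: "bop (f (z + h)) (g (z + h)) - bop (f z) (g z) - (bop (D f z h) (g z) + bop (f z) (E g z h))
           = bop ?u1 (g z) + bop (f z) ?v1 + bop ?u ?v"
          by (simp add: diff_left diff_right)
        have "norm (bop ?u1 (g z) + bop (f z) ?v1 + bop ?u ?v) \<le> norm (bop ?u1 (g z)) + norm (bop (f z) ?v1) + norm (bop ?u ?v)"
          by (intro norm_triangle_le add_mono order_refl norm_triangle_ineq)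
        also have "\<dots> \<le> (d * norm h) * L * B + K * (d * norm h) * B + d * (C * norm h) * B"
          by (rule add_mono[OF add_mono[OF bb[OF uv(3) L(2)[OF fg(2)]] bb[OF K(2)[OF fg(1)] uv(4)]]
                bb[OF uv(1) uv(2)]])
        also have "\<dots> = (d * (B * (K + L + C))) * norm h" by (simp add: algebra_simps)
        also have "\<dots> \<le> e * norm h" using d(2) by (rule mult_right_mono) simp
        finally show "norm (bop (f (z + h)) (g (z + h)) - bop (f z) (g z)
            - (bop (D f z h) (g z) + bop (f z) (E g z h))) \<le> e * norm h" unfolding eq .
      qed
    qed
  qed
  then show ?case by (rule uniform_Ck_mono) auto
qed

lemma uniform_Ck_bilinear_image:
  assumes "bounded_bilinear bop" "uniform_Ck k U (f ` I)" "uniform_Ck k U (g ` I)"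
  shows "uniform_Ck k U ((\<lambda>i z. bop (f i z) (g i z)) ` I)"
  by (rule uniform_Ck_mono[OF uniform_Ck_bilinear[OF assms]]) blast

lemma norm_linear_le_of_unit_ball:
  assumes "linear A" "\<And>c. norm c \<le> 1 \<Longrightarrow> norm (A c) \<le> K"
  shows "norm (A c) \<le> K * norm c"
proof (cases "c = 0")
  case True
  then show ?thesis using linear_0[OF assms(1)] by simp
next
  case False
  have "norm (A (c /\<^sub>R norm c)) \<le> K" using False by (intro assms(2)) simp
  then show ?thesis using False by (simp add: linear_scale[OF assms(1)] field_simps)
qed

lemma uniform_Ck_scale:
  assumes "uniform_Ck k U F"
  shows "uniform_Ck k U {\<lambda>z. c *\<^sub>R f z | c f. \<bar>c\<bar> \<le> R \<and> f \<in> F}"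
proof -
  have "uniform_Ck k U ((\<lambda>c z. c) ` {c. \<bar>c\<bar> \<le> R})"
    by (rule uniform_Ck_const[where K = R]) simp
  from uniform_Ck_bilinear[OF bounded_bilinear_scaleR this assms]
  show ?thesis
  proof (rule uniform_Ck_mono, safe)
    fix c :: real and f assume "\<bar>c\<bar> \<le> R" "f \<in> F"
    then show "\<exists>g h. (\<lambda>z. c *\<^sub>R f z) = (\<lambda>z. g z *\<^sub>R h z) \<and> g \<in> (\<lambda>c z. c) ` {c. \<bar>c\<bar> \<le> R} \<and> h \<in> F"
      by - (rule exI[of _ "\<lambda>z. c"], rule exI[of _ f], simp)
  qed
qed

text \<open>Passing from the unit ball to a ball of radius \<open>R\<close> needs linearity of the derivative, which is only
  known on \<open>U\<close>; hence the set has to be open.\<close>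

lemma uniform_Ck_rescale:
  fixes U :: "'a::real_normed_vector set" and D :: "'i \<Rightarrow> 'a \<Rightarrow> 'c::real_normed_vector \<Rightarrow> 'b::real_normed_vector"
  assumes "open U" and lin: "\<And>z i. z \<in> U \<Longrightarrow> i \<in> I \<Longrightarrow> linear (D i z)"
    and "uniform_Ck k U {\<lambda>z. D i z v | i v. i \<in> I \<and> norm v \<le> 1}"
  shows "uniform_Ck k U {\<lambda>z. D i z v | i v. i \<in> I \<and> norm v \<le> R}"
proof -
  define M where "M = max R 1"
  have M: "M > 0" "R \<le> M" by (auto simp: M_def)
  have "uniform_Ck k U ((\<lambda>(i,v) z. M *\<^sub>R D i z (v /\<^sub>R M)) ` (I \<times> {v. norm v \<le> M}))"
  proof (rule uniform_Ck_mono[OF uniform_Ck_scale[OF assms(3), of M]], rule image_subsetI, clarify)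
    fix i and v :: 'c assume i: "i \<in> I" and v: "norm v \<le> M"
    then have "norm (v /\<^sub>R M) \<le> 1" using M(1) by (simp add: field_simps)
    then show "\<exists>c f. (\<lambda>z. M *\<^sub>R D i z (v /\<^sub>R M)) = (\<lambda>z. c *\<^sub>R f z) \<and> \<bar>c\<bar> \<le> M \<and>
        f \<in> {\<lambda>z. D i z v |i v. i \<in> I \<and> norm v \<le> 1}"
      using i M(1) by - (rule exI[of _ M], rule exI[of _ "\<lambda>z. D i z (v /\<^sub>R M)"], intro conjI refl, simp, blast)
  qed
  then have "uniform_Ck k U ((\<lambda>(i,v) z. D i z v) ` (I \<times> {v. norm v \<le> M}))"
  proof (rule uniform_Ck_cong[OF assms(1), rotated], clarify)
    fix i z and v :: 'c assume "i \<in> I" "z \<in> U"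
    then show "M *\<^sub>R D i z (v /\<^sub>R M) = D i z v"
      using linear_scale[OF lin] M(1) by simp
  qed
  then show ?thesis
    by (rule uniform_Ck_mono) (use M(2) in force)
qed

lemma uniform_Ck_minus_image:
  assumes "uniform_Ck k U (f ` I)"
  shows "uniform_Ck k U ((\<lambda>i z. - f i z) ` I)"
proof (rule uniform_Ck_mono[OF uniform_Ck_scale[OF assms, of 1]], rule image_subsetI)
  fix i assume "i \<in> I"
  then show "(\<lambda>z. - f i z) \<in> {\<lambda>z. c *\<^sub>R g z | c g. \<bar>c\<bar> \<le> 1 \<and> g \<in> f ` I}"
    by - (rule CollectI, rule exI[of _ "-1"], rule exI[of _ "f i"], simp)
qed

lemma uniform_Ck_sum_image:
  assumes "finite B" "\<And>b. b \<in> B \<Longrightarrow> uniform_Ck k U (f b ` I)"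
  shows "uniform_Ck k U ((\<lambda>i z. \<Sum>b\<in>B. f b i z) ` I)"
  using assms
proof (induction B)
  case empty
  show ?case using uniform_Ck_const[of I "\<lambda>_. 0" 0 k U] by simp
next
  case (insert b B)
  have "uniform_Ck k U ((\<lambda>i z. f b i z + (\<Sum>b\<in>B. f b i z)) ` I)"
    by (rule uniform_Ck_add_image) (use insert in auto)
  then show ?case using insert(1,2) by simp
qed

text \<open>Application of bounded operators is bilinear, so \<open>L\<close> enters as a constant
  family and the product rule does the rest.\<close>

lemma uniform_Ck_bounded_linear_image:
  assumes "bounded_linear L" "uniform_Ck k U (f ` I)"
  shows "uniform_Ck k U ((\<lambda>i z. L (f i z)) ` I)"
proof -
  have "uniform_Ck k U ((\<lambda>i z. Blinfun L) ` I)"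
    by (rule uniform_Ck_const[where K = "norm (Blinfun L)"]) simp
  from uniform_Ck_bilinear_image[OF bounded_bilinear_blinfun_apply this assms(2)]
  show ?thesis by (simp add: bounded_linear_Blinfun_apply[OF assms(1)])
qed

section \<open>Composition of families with linear maps and with graphs\<close>

lemma uniform_Ck_filterlim:
  assumes "uniform_Ck k U {g}" "z \<in> U"
  shows "((\<lambda>h. g (z + h) - g z) \<longlongrightarrow> 0) (nhds 0)"
proof (rule tendstoI)
  fix e :: real assume "e > 0"
  obtain K where K: "K \<ge> 0" "\<And>f. f \<in> {g} \<Longrightarrow> norm (f z) \<le> K"
      "\<And>e. e > 0 \<Longrightarrow> \<forall>\<^sub>F h in nhds 0. \<forall>f\<in>{g}. norm (f (z + h) - f z) \<le> e"
    using that by (rule uniform_Ck_0_D_set[OF assms])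
  have "\<forall>\<^sub>F h in nhds 0. \<forall>f\<in>{g}. norm (f (z + h) - f z) \<le> e/2"
    by (rule K(3)) (use \<open>e > 0\<close> in simp)
  then show "\<forall>\<^sub>F h in nhds 0. dist (g (z + h) - g z) 0 < e"
    by (rule eventually_mono) (use \<open>e > 0\<close> in simp)
qed

text \<open>The chain rule produces directions \<open>L v\<close>, which may leave the unit ball;
  they stay in the ball of radius \<open>M\<close>, and rescaling the derivative family to that ball
  is where openness of \<open>W\<close> enters.\<close>

lemma uniform_Ck_comp_linear:
  fixes L :: "'c::real_normed_vector \<Rightarrow> 'a::real_normed_vector"
  assumes "uniform_Ck k W F" "open W" "bounded_linear L" "\<And>z. z \<in> U \<Longrightarrow> L z \<in> W"
  shows "uniform_Ck k U ((\<lambda>f z. f (L z)) ` F)"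
  using assms(1)
proof (induction k arbitrary: F)
  case 0
  interpret bounded_linear L by fact
  have L0: "filterlim L (nhds 0) (nhds 0)"
    using tendsto[OF filterlim_ident[of "nhds 0"]] by (simp add: zero)
  show ?case
  proof (rule uniform_Ck_0_I)
    fix z assume "z \<in> U"
    show "\<exists>K. \<forall>i\<in>F. norm (i (L z)) \<le> K" using 0 assms(4)[OF \<open>z \<in> U\<close>] by simp
    fix e :: real assume "e > 0"
    then have "\<forall>\<^sub>F h in nhds 0. \<forall>f\<in>F. norm (f (L z + h) - f (L z)) \<le> e"
      using 0 assms(4)[OF \<open>z \<in> U\<close>] by simp
    from eventually_compose_filterlim[OF this L0]
    show "\<forall>\<^sub>F h in nhds 0. \<forall>i\<in>F. norm (i (L (z + h)) - i (L z)) \<le> e" by (simp add: add)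
  qed
next
  case (Suc k)
  interpret bounded_linear L by fact
  have L0: "filterlim L (nhds 0) (nhds 0)"
    using tendsto[OF filterlim_ident[of "nhds 0"]] by (simp add: zero)
  obtain M where M: "M > 0" "\<And>x. norm (L x) \<le> norm x * M" using pos_bounded by blast
  obtain D K where D: "\<And>z f. z \<in> W \<Longrightarrow> f \<in> F \<Longrightarrow> linear (D f z)"
     "\<And>z e. z \<in> W \<Longrightarrow> e > 0 \<Longrightarrow> \<forall>\<^sub>F h in nhds 0. \<forall>f\<in>F. norm (f (z + h) - f z - D f z h) \<le> e * norm h"
     "uniform_Ck k W {\<lambda>z. D f z v | f v. f \<in> F \<and> norm v \<le> 1}"
     "\<And>z f h. z \<in> W \<Longrightarrow> f \<in> F \<Longrightarrow> norm (D f z h) \<le> K z * norm h" "\<And>z. K z \<ge> 0"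
    using that by (rule uniform_Ck_Suc_E_set[OF Suc.prems(1)])
  have 0: "uniform_Ck 0 U ((\<lambda>f z. f (L z)) ` F)"
    by (rule uniform_Ck_imp_0[OF Suc.IH[OF uniform_Ck_SucD[OF Suc.prems]]])
  show ?case
  proof (rule uniform_Ck_Suc_I[OF 0])
    show "linear ((\<lambda>v. D f (L z) (L v)))" if "z \<in> U" "f \<in> F" for z f
      using linear_compose[OF linear_axioms D(1)[OF assms(4)[OF that(1)] that(2)]] by (simp add: o_def)
    show "uniform_Ck k U {\<lambda>z. D i (L z) (L v) |i v. i \<in> F \<and> norm v \<le> 1}"
    proof (rule uniform_Ck_mono[OF Suc.IH[OF uniform_Ck_rescale[OF assms(2) D(1) D(3), where R = M]]], safe)
      fix f and v :: 'c assume f: "f \<in> F" and v: "norm v \<le> 1"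
      have "norm (L v) \<le> M" using M(2)[of v] mult_right_mono[OF v less_imp_le[OF M(1)]] by simp
      then show "(\<lambda>z. D f (L z) (L v)) \<in> (\<lambda>f z. f (L z)) ` {\<lambda>z. D i z v |i v. i \<in> F \<and> norm v \<le> M}"
        using f by (intro image_eqI[where x = "\<lambda>z. D f z (L v)"]) auto
    qed
    fix z and e :: real assume z: "z \<in> U" and e: "e > 0"
    have "e / M > 0" using e M(1) by simp
    from eventually_compose_filterlim[OF D(2)[OF assms(4)[OF z] this] L0]
    show "\<forall>\<^sub>F h in nhds 0. \<forall>i\<in>F. norm (i (L (z + h)) - i (L z) - D i (L z) (L h)) \<le> e * norm h"
    proof (rule eventually_mono)
      fix h assume h: "\<forall>i\<in>F. norm (i (L z + L h) - i (L z) - D i (L z) (L h)) \<le> e / M * norm (L h)"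
      have "e / M * norm (L h) \<le> e / M * (norm h * M)"
        using \<open>e / M > 0\<close> M(2) by (intro mult_left_mono) auto
      then have "e / M * norm (L h) \<le> e * norm h" using M(1) by simp
      then show "\<forall>i\<in>F. norm (i (L (z + h)) - i (L z) - D i (L z) (L h)) \<le> e * norm h"
        using h unfolding add by (meson order_trans)
    qed
  qed
qed

text \<open>The direction \<open>(v, E g z v)\<close> in the chain rule varies with the base point,
  so the induction hypothesis does not apply to the derivative directly. Expanding the second
  component in the basis of the finite-dimensional space leaves fixed directions
  \<open>(v, 0)\<close> and \<open>(0, b)\<close>, to which it does apply, with scalar coefficients
  that are smooth themselves.\<close>

lemma uniform_Ck_comp_graph:
  fixes g :: "'z::real_normed_vector \<Rightarrow> 'e::euclidean_space" and F :: "('z \<times> 'e \<Rightarrow> 'b::real_normed_vector) set"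
  assumes "uniform_Ck k W F" "uniform_Ck k U {g}" "\<And>z. z \<in> U \<Longrightarrow> (z, g z) \<in> W" "open U"
  shows "uniform_Ck k U ((\<lambda>f z. f (z, g z)) ` F)"
  using assms(1,2)
proof (induction k arbitrary: F)
  case 0
  show ?case
  proof (rule uniform_Ck_0_I)
    fix z assume z: "z \<in> U"
    have lim: "filterlim (\<lambda>h. (h, g (z + h) - g z)) (nhds 0) (nhds 0)"
      using tendsto_Pair[OF filterlim_ident uniform_Ck_filterlim[OF 0(2) z]] by (simp add: zero_prod_def)
    obtain K where K: "K \<ge> 0" "\<And>f. f \<in> F \<Longrightarrow> norm (f (z, g z)) \<le> K"
      "\<And>e. e > 0 \<Longrightarrow> \<forall>\<^sub>F h in nhds 0. \<forall>f\<in>F. norm (f ((z, g z) + h) - f (z, g z)) \<le> e"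
      using that by (rule uniform_Ck_0_D_set[OF 0(1) assms(3)[OF z]])
    show "\<exists>K. \<forall>i\<in>F. norm (i (z, g z)) \<le> K" using K(2) by blast
    fix e :: real assume "e > 0"
    from eventually_compose_filterlim[OF K(3)[OF this] lim]
    show "\<forall>\<^sub>F h in nhds 0. \<forall>i\<in>F. norm (i (z + h, g (z + h)) - i (z, g z)) \<le> e" by simp
  qed
next
  case (Suc k)
  obtain D K where D: "\<And>z f. z \<in> W \<Longrightarrow> f \<in> F \<Longrightarrow> linear (D f z)"
     "\<And>z e. z \<in> W \<Longrightarrow> e > 0 \<Longrightarrow> \<forall>\<^sub>F h in nhds 0. \<forall>f\<in>F. norm (f (z + h) - f z - D f z h) \<le> e * norm h"
     "uniform_Ck k W {\<lambda>z. D f z v | f v. f \<in> F \<and> norm v \<le> 1}"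
     "\<And>z f h. z \<in> W \<Longrightarrow> f \<in> F \<Longrightarrow> norm (D f z h) \<le> K z * norm h" "\<And>z. K z \<ge> 0"
    using that by (rule uniform_Ck_Suc_E_set[OF Suc.prems(1)])
  obtain E K2 where E: "\<And>z f. z \<in> U \<Longrightarrow> f \<in> {g} \<Longrightarrow> linear (E f z)"
     "\<And>z e. z \<in> U \<Longrightarrow> e > 0 \<Longrightarrow> \<forall>\<^sub>F h in nhds 0. \<forall>f\<in>{g}. norm (f (z + h) - f z - E f z h) \<le> e * norm h"
     "uniform_Ck k U {\<lambda>z. E f z v | f v. f \<in> {g} \<and> norm v \<le> 1}"
     "\<And>z f h. z \<in> U \<Longrightarrow> f \<in> {g} \<Longrightarrow> norm (E f z h) \<le> K2 z * norm h" "\<And>z. K2 z \<ge> 0"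
    using that by (rule uniform_Ck_Suc_E_set[OF Suc.prems(2)])
  have g: "uniform_Ck k U {g}" by (rule uniform_Ck_SucD[OF Suc.prems(2)])
  have 0: "uniform_Ck 0 U ((\<lambda>f z. f (z, g z)) ` F)"
    by (rule uniform_Ck_imp_0[OF Suc.IH[OF uniform_Ck_SucD[OF Suc.prems(1)] g]])
  note DG = Suc.IH[OF D(3) g]
  let ?D = "\<lambda>f z v. D f (z, g z) (v, E g z v)"
  have expand: "?D f z v = D f (z, g z) (v, 0) + (\<Sum>b\<in>Basis. (E g z v \<bullet> b) *\<^sub>R D f (z, g z) (0, b))"
    if "z \<in> U" "f \<in> F" for f z v
  proof -
    interpret linear "D f (z, g z)" by (rule D(1)[OF assms(3)[OF that(1)] that(2)])
    have "(v, E g z v) = (v, 0) + (0, \<Sum>b\<in>Basis. (E g z v \<bullet> b) *\<^sub>R b)"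
      by (simp add: euclidean_representation)
    also have "(0::'z, \<Sum>b\<in>Basis. (E g z v \<bullet> b) *\<^sub>R b) = (\<Sum>b\<in>Basis. (E g z v \<bullet> b) *\<^sub>R (0, b))"
      by (simp add: prod_eq_iff fst_sum snd_sum)
    finally have eq: "(v, E g z v) = (v, 0) + (\<Sum>b\<in>Basis. (E g z v \<bullet> b) *\<^sub>R (0, b))" .
    show ?thesis by (subst eq) (simp only: add sum scale)
  qed
  have cont: "uniform_Ck k U ((\<lambda>(f,v) z. D f (z, g z) (v, 0) + (\<Sum>b\<in>Basis. (E g z v \<bullet> b) *\<^sub>R D f (z, g z) (0, b)))
      ` (F \<times> {v. norm v \<le> 1}))"
  proof -
    have 1: "uniform_Ck k U ((\<lambda>p z. D (fst p) (z, g z) (snd p, 0)) ` (F \<times> {v. norm v \<le> 1}))"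
    proof (rule uniform_Ck_mono[OF DG], rule image_subsetI, clarify)
      fix f and v :: 'z assume "f \<in> F" "norm v \<le> 1"
      then have "(\<lambda>p. D f p (v, 0)) \<in> {\<lambda>z. D f z v | f v. f \<in> F \<and> norm v \<le> 1}"
        by (intro CollectI exI[of _ f] exI[of _ "(v, 0)"]) (simp add: norm_Pair)
      then show "(\<lambda>z. D (fst (f, v)) (z, g z) (snd (f, v), 0)) \<in> (\<lambda>f z. f (z, g z)) ` {\<lambda>z. D f z v | f v. f \<in> F \<and> norm v \<le> 1}"
        by (rule rev_image_eqI) simp
    qed
    have 2: "uniform_Ck k U ((\<lambda>p z. D (fst p) (z, g z) (0, b)) ` (F \<times> {v :: 'z. norm v \<le> 1}))" if "b \<in> Basis" for b
    proof (rule uniform_Ck_mono[OF DG], rule image_subsetI, clarify)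
      fix f and v :: 'z assume "f \<in> F" "norm v \<le> 1"
      then have "(\<lambda>p. D f p (0, b)) \<in> {\<lambda>z. D f z v | f v. f \<in> F \<and> norm v \<le> 1}"
        using that by (intro CollectI exI[of _ f] exI[of _ "(0, b)"]) (simp add: norm_Pair)
      then show "(\<lambda>z. D (fst (f, v)) (z, g z) (0, b)) \<in> (\<lambda>f z. f (z, g z)) ` {\<lambda>z. D f z v | f v. f \<in> F \<and> norm v \<le> 1}"
        by (rule rev_image_eqI) simp
    qed
    have 3: "uniform_Ck k U ((\<lambda>p z. E g z (snd p)) ` (F \<times> {v :: 'z. norm v \<le> 1}))"
      by (rule uniform_Ck_mono[OF E(3)]) auto
    have 4: "uniform_Ck k U ((\<lambda>p z. E g z (snd p) \<bullet> b) ` (F \<times> {v :: 'z. norm v \<le> 1}))" for b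
      by (rule uniform_Ck_bounded_linear_image[OF bounded_linear_inner_left 3])
    have "uniform_Ck k U ((\<lambda>p z. D (fst p) (z, g z) (snd p, 0) +
        (\<Sum>b\<in>Basis. (E g z (snd p) \<bullet> b) *\<^sub>R D (fst p) (z, g z) (0, b))) ` (F \<times> {v. norm v \<le> 1}))"
      by (intro uniform_Ck_add_image uniform_Ck_sum_image 1 uniform_Ck_bilinear_image[OF bounded_bilinear_scaleR] 4 2) auto
    then show ?thesis by (simp only: case_prod_unfold)
  qed
  show ?case
  proof (rule uniform_Ck_Suc_I[OF 0])
    show "linear (?D f z)" if "z \<in> U" "f \<in> F" for z f
    proof -
      have "linear (\<lambda>v. (v, E g z v))"
        using E(1)[OF that(1)] by (intro linearI) (auto simp: linear_add linear_scale)
      from linear_compose[OF this D(1)[OF assms(3)[OF that(1)] that(2)]]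
      show ?thesis by (simp add: o_def)
    qed
    have "uniform_Ck k U ((\<lambda>(f,v) z. ?D f z v) ` (F \<times> {v. norm v \<le> 1}))"
      by (rule uniform_Ck_cong[OF assms(4) _ cont]) (auto simp: expand)
    then show "uniform_Ck k U {\<lambda>z. ?D f z v |f v. f \<in> F \<and> norm v \<le> 1}"
      by (rule uniform_Ck_mono) force
    fix z and e :: real assume z: "z \<in> U" and e: "e > 0"
    obtain C where C: "C > 0" "\<forall>\<^sub>F h in nhds 0. \<forall>f\<in>{g}. norm (f (z + h) - f z) \<le> C * norm h"
      using Suc.prems(2) z by (rule uniform_Ck_lipschitz_at[where f = "\<lambda>f. f", unfolded image_ident])
    have lim: "filterlim (\<lambda>h. (h, g (z + h) - g z)) (nhds 0) (nhds 0)"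
      using tendsto_Pair[OF filterlim_ident uniform_Ck_filterlim[OF g z]] by (simp add: zero_prod_def)
    define k where "k = K (z, g z)"
    have k: "k \<ge> 0" using D(5) by (simp add: k_def)
    \<comment> \<open>Half of \<open>e\<close> is spent on the remainder of \<open>f\<close> along
      the graph increment, whose norm is at most \<open>(1 + C) * norm h\<close>, half on
      \<open>D f\<close>, of norm at most \<open>k\<close>, applied to the remainder of
      \<open>g\<close>.\<close>
    define e1 where "e1 = e / 2 / (1 + C)"
    define e2 where "e2 = e / 2 / (k + 1)"
    have e1: "e1 > 0" "e1 * (1 + C) = e / 2"
      using e C(1) by (simp add: e1_def, unfold e1_def, intro pos_divide_times_cancel, simp)
    have e2: "e2 > 0" "e2 * (k + 1) = e / 2"
      using e k by (simp add: e2_def, unfold e2_def, intro pos_divide_times_cancel, simp)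
    from eventually_compose_filterlim[OF D(2)[OF assms(3)[OF z] e1(1)] lim] C(2) E(2)[OF z e2(1)]
    show "\<forall>\<^sub>F h in nhds 0. \<forall>f\<in>F. norm (f (z + h, g (z + h)) - f (z, g z) - ?D f z h) \<le> e * norm h"
    proof eventually_elim
      case (elim h)
      show ?case
      proof
        fix f assume f: "f \<in> F"
        interpret linear "D f (z, g z)" by (rule D(1)[OF assms(3)[OF z] f])
        let ?H = "(h, g (z + h) - g z)" and ?d = "g (z + h) - g z - E g z h"
        have "norm ?H \<le> norm h + norm (g (z + h) - g z)" by (rule norm_Pair_le)
        also have "\<dots> \<le> (1 + C) * norm h" using elim(2) by (simp add: algebra_simps)
        finally have "e1 * norm ?H \<le> e1 * ((1 + C) * norm h)" using e1(1) by (intro mult_left_mono) auto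
        also have "\<dots> = e / 2 * norm h" using e1(2) by (simp only: mult.assoc[symmetric])
        finally have 1: "norm (f ((z, g z) + ?H) - f (z, g z) - D f (z, g z) ?H) \<le> e / 2 * norm h"
          using bspec[OF elim(1) f] by linarith
        have "norm (D f (z, g z) (0, ?d)) \<le> k * norm (0::'z, ?d)"
          unfolding k_def by (rule D(4)[OF assms(3)[OF z] f])
        also have "\<dots> \<le> (k + 1) * (e2 * norm h)"
          using elim(3) k e2(1) by (intro mult_mono) (simp_all add: norm_Pair)
        also have "\<dots> = e / 2 * norm h" using e2(2) by (simp only: mult.assoc[symmetric] mult.commute[of "k + 1"])
        finally have 2: "norm (D f (z, g z) (0, ?d)) \<le> e / 2 * norm h" .
        have "D f (z, g z) ?H - ?D f z h = D f (z, g z) (?H - (h, E g z h))" by (simp only: diff)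
        also have "?H - (h, E g z h) = (0, ?d)" by simp
        finally have eq: "f (z + h, g (z + h)) - f (z, g z) - ?D f z h =
            (f ((z, g z) + ?H) - f (z, g z) - D f (z, g z) ?H) + D f (z, g z) (0, ?d)"
          by (simp add: algebra_simps)
        show "norm (f (z + h, g (z + h)) - f (z, g z) - ?D f z h) \<le> e * norm h"
          unfolding eq using order_trans[OF norm_triangle_ineq add_mono[OF 1 2]] by simp
      qed
    qed
  qed
qed

text \<open>The lower bound \<kappa> takes the place of smoothness of the inverse of
  \<open>J z\<close>. Differentiating \<open>J z (y z)\<close> shows that the derivatives of the
  solutions solve the same linear system with a new right-hand side, one order less smooth, so the
  induction hypothesis applies to the family they form.\<close>

lemma uniform_Ck_linear_solve:
  fixes J :: "'z::real_normed_vector \<Rightarrow> 'e::euclidean_space \<Rightarrow> 'e"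
  assumes U: "open U" and lin: "\<And>z. z \<in> U \<Longrightarrow> linear (J z)"
    and low: "\<kappa> > 0" "\<And>z c. z \<in> U \<Longrightarrow> \<kappa> * norm c \<le> norm (J z c)"
    and J: "uniform_Ck k U ((\<lambda>c z. J z c) ` {c. norm c \<le> 1})"
    and b: "uniform_Ck k U ((\<lambda>y z. J z (y z)) ` Y)"
  shows "uniform_Ck k U Y"
  using J b
proof (induction k arbitrary: Y)
  case 0
  note nh = eventually_add_mem[OF U]
  have "uniform_Ck 0 U ((\<lambda>y. y) ` Y)"
  proof (rule uniform_Ck_0_I)
    fix z assume z: "z \<in> U"
    obtain K where K: "K \<ge> 0" "\<And>y. y \<in> Y \<Longrightarrow> norm (J z (y z)) \<le> K"
      "\<And>e. e > 0 \<Longrightarrow> \<forall>\<^sub>F h in nhds 0. \<forall>y\<in>Y. norm (J (z + h) (y (z + h)) - J z (y z)) \<le> e"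
      using that by (rule uniform_Ck_0_D[OF 0(2) z])
    obtain L where L: "L \<ge> 0" "\<And>c. c \<in> {c. norm c \<le> 1} \<Longrightarrow> norm (J z c) \<le> L"
      "\<And>e. e > 0 \<Longrightarrow> \<forall>\<^sub>F h in nhds 0. \<forall>c\<in>{c. norm c \<le> 1}. norm (J (z + h) c - J z c) \<le> e"
      using that by (rule uniform_Ck_0_D[OF 0(1) z])
    define M where "M = K / \<kappa>"
    have M: "M \<ge> 0" using K(1) low(1) by (simp add: M_def)
    have Y: "norm (y z) \<le> M" if "y \<in> Y" for y
      using low(2)[OF z, of "y z"] K(2)[OF that] low(1) by (simp add: M_def field_simps)
    then show "\<exists>K. \<forall>y\<in>Y. norm (y z) \<le> K" by blast
    fix e :: real assume e: "e > 0"
    define d where "d = e * \<kappa> / (M + 1)"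
    have d: "d > 0" "d * (M + 1) = e * \<kappa>" using e M low(1) by (simp_all add: d_def)
    from K(3)[OF d(1)] L(3)[OF d(1)] nh[OF z]
    show "\<forall>\<^sub>F h in nhds 0. \<forall>y\<in>Y. norm (y (z + h) - y z) \<le> e"
    proof eventually_elim
      case (elim h)
      show ?case
      proof
        fix y assume y: "y \<in> Y"
        interpret J0: linear "J z" by (rule lin[OF z])
        interpret J1: linear "J (z + h)" by (rule lin[OF elim(3)])
        have op: "norm (J (z + h) c - J z c) \<le> d * norm c" for c
          by (rule norm_linear_le_of_unit_ball[where A = "\<lambda>c. J (z + h) c - J z c"])
            (use elim(2) linear_compose_sub[OF J1.linear_axioms J0.linear_axioms] in auto)
        have "\<kappa> * norm (y (z + h) - y z) \<le> norm (J (z + h) (y (z + h) - y z))"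
          by (rule low(2)[OF elim(3)])
        also have "J (z + h) (y (z + h) - y z) = (J (z + h) (y (z + h)) - J z (y z)) - (J (z + h) (y z) - J z (y z))"
          by (simp add: J1.diff)
        also have "norm \<dots> \<le> d + d * norm (y z)"
          by (rule order_trans[OF norm_triangle_ineq4 add_mono[OF bspec[OF elim(1) y] op]])
        also have "\<dots> \<le> d * (M + 1)" using mult_left_mono[OF Y[OF y], of d] d(1) by (simp add: algebra_simps)
        also have "\<dots> = \<kappa> * e" by (simp add: d(2))
        finally show "norm (y (z + h) - y z) \<le> e" using low(1) by simp
      qed
    qed
  qed
  then show ?case by simp
next
  case (Suc k)
  define n where "n = real DIM('e)"
  obtain E K1 where E: "\<And>z c. z \<in> U \<Longrightarrow> c \<in> {c. norm c \<le> 1} \<Longrightarrow> linear (E c z)"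
    "\<And>z e. z \<in> U \<Longrightarrow> e > 0 \<Longrightarrow>
      \<forall>\<^sub>F h in nhds 0. \<forall>c\<in>{c. norm c \<le> 1}. norm (J (z + h) c - J z c - E c z h) \<le> e * norm h"
    "uniform_Ck k U {\<lambda>z. E c z v | c v. c \<in> {c. norm c \<le> 1} \<and> norm v \<le> 1}"
    "\<And>z c h. z \<in> U \<Longrightarrow> c \<in> {c. norm c \<le> 1} \<Longrightarrow> norm (E c z h) \<le> K1 z * norm h" "\<And>z. K1 z \<ge> 0"
    using that by (rule uniform_Ck_Suc_E[OF Suc.prems(1)])
  obtain B K2 where B: "\<And>z y. z \<in> U \<Longrightarrow> y \<in> Y \<Longrightarrow> linear (B y z)"
    "\<And>z e. z \<in> U \<Longrightarrow> e > 0 \<Longrightarrow>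
      \<forall>\<^sub>F h in nhds 0. \<forall>y\<in>Y. norm (J (z + h) (y (z + h)) - J z (y z) - B y z h) \<le> e * norm h"
    "uniform_Ck k U {\<lambda>z. B y z v | y v. y \<in> Y \<and> norm v \<le> 1}"
    "\<And>z y h. z \<in> U \<Longrightarrow> y \<in> Y \<Longrightarrow> norm (B y z h) \<le> K2 z * norm h" "\<And>z. K2 z \<ge> 0"
    using that by (rule uniform_Ck_Suc_E[OF Suc.prems(2)])
  note Jk = uniform_Ck_SucD[OF Suc.prems(1)]
  have Yk: "uniform_Ck k U Y" by (rule Suc.IH[OF Jk uniform_Ck_SucD[OF Suc.prems(2)]])
  have Y0: "uniform_Ck 0 U ((\<lambda>y. y) ` Y)" using uniform_Ck_imp_0[OF Yk] by simp
  have unit: "b \<in> {c. norm c \<le> 1}" if "b \<in> Basis" for b :: 'e using that by simp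
  have inj: "inj (J z)" if "z \<in> U" for z
    unfolding linear_injective_0[OF lin[OF that]]
  proof (intro allI impI)
    fix c assume "J z c = 0"
    then have "\<kappa> * norm c \<le> 0" using low(2)[OF that, of c] by simp
    then show "c = 0" using low(1) by (simp add: mult_le_0_iff)
  qed
  have inv: "J z (inv (J z) w) = w" if "z \<in> U" for z w
    by (rule surj_f_inv_f[OF linear_injective_imp_surjective[OF lin[OF that] inj[OF that] refl]])
  \<comment> \<open>\<open>E c\<close> comes separately for each \<open>c\<close> in the unit ball,
    with no relation between different \<open>c\<close>. \<open>DJ\<close> is linear in
    \<open>c\<close> by construction, from the basis vectors.\<close>
  define DJ where "DJ z v c = (\<Sum>b\<in>Basis. (c \<bullet> b) *\<^sub>R E b z v)" for z v and c :: 'e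
  define DY where "DY y z v = inv (J z) (B y z v - DJ z v (y z))" for y z v
  have JDY: "J z (DY y z v) = B y z v - DJ z v (y z)" if "z \<in> U" for y z v
    unfolding DY_def by (rule inv[OF that])
  note nh = eventually_add_mem[OF U]
  have "uniform_Ck (Suc k) U ((\<lambda>y. y) ` Y)"
  proof (rule uniform_Ck_Suc_I[OF Y0])
    show "linear (DY y z)" if z: "z \<in> U" and y: "y \<in> Y" for z y
    proof -
      have "linear (\<lambda>v. DJ z v (y z))" unfolding DJ_def
        by (intro linear_compose_sum ballI linear_compose_scale_right E(1) z unit)
      then have "linear (\<lambda>v. B y z v - DJ z v (y z))" by (intro linear_compose_sub B(1) z y)
      from linear_compose[OF this inj_linear_imp_inv_linear[OF lin[OF z] inj[OF z]]]
      show ?thesis unfolding DY_def by (simp add: o_def)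
    qed
    let ?I = "Y \<times> {v :: 'z. norm v \<le> 1}"
    have 1: "uniform_Ck k U ((\<lambda>p z. B (fst p) z (snd p)) ` ?I)"
    proof (rule uniform_Ck_mono[OF B(3)], rule image_subsetI)
      fix p assume "p \<in> ?I"
      then show "(\<lambda>z. B (fst p) z (snd p)) \<in> {\<lambda>z. B y z v | y v. y \<in> Y \<and> norm v \<le> 1}"
        by - (rule CollectI, rule exI[of _ "fst p"], rule exI[of _ "snd p"], auto)
    qed
    have 2: "uniform_Ck k U ((\<lambda>p z. E b z (snd p)) ` ?I)" if "b \<in> Basis" for b
    proof (rule uniform_Ck_mono[OF E(3)], rule image_subsetI)
      fix p assume "p \<in> ?I"
      then show "(\<lambda>z. E b z (snd p)) \<in> {\<lambda>z. E c z v | c v. c \<in> {c. norm c \<le> 1} \<and> norm v \<le> 1}"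
        using unit[OF that] by - (rule CollectI, rule exI[of _ b], rule exI[of _ "snd p"], auto)
    qed
    have 3: "uniform_Ck k U ((\<lambda>p z. fst p z) ` ?I)"
      by (rule uniform_Ck_mono[OF Yk]) auto
    have 4: "uniform_Ck k U ((\<lambda>p z. fst p z \<bullet> b) ` ?I)" for b
      by (rule uniform_Ck_bounded_linear_image[OF bounded_linear_inner_left 3])
    have 5: "uniform_Ck k U ((\<lambda>p z. DJ z (snd p) (fst p z)) ` ?I)"
      unfolding DJ_def
      by (intro uniform_Ck_sum_image uniform_Ck_bilinear_image[OF bounded_bilinear_scaleR] 4 2) auto
    have "uniform_Ck k U ((\<lambda>p z. B (fst p) z (snd p) + - DJ z (snd p) (fst p z)) ` ?I)"
      by (intro uniform_Ck_add_image uniform_Ck_minus_image 1 5)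
    then have 6: "uniform_Ck k U ((\<lambda>p z. J z (DY (fst p) z (snd p))) ` ?I)"
      by (rule uniform_Ck_cong[OF U, rotated]) (simp add: JDY)
    show "uniform_Ck k U {\<lambda>z. DY y z v |y v. y \<in> Y \<and> norm v \<le> 1}"
    proof (rule Suc.IH[OF Jk uniform_Ck_mono[OF 6]], rule image_subsetI, clarify)
      fix y and v :: 'z assume "y \<in> Y" "norm v \<le> 1"
      then show "(\<lambda>z. J z (DY y z v)) \<in> (\<lambda>p z. J z (DY (fst p) z (snd p))) ` ?I"
        by (intro image_eqI[where x = "(y, v)"]) auto
    qed
    fix z and e :: real assume z: "z \<in> U" and e: "e > 0"
    obtain M where M: "M \<ge> 0" "\<And>y. y \<in> Y \<Longrightarrow> norm (y z) \<le> M"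
      "\<And>e. e > 0 \<Longrightarrow> \<forall>\<^sub>F h in nhds 0. \<forall>y\<in>Y. norm (y (z + h) - y z) \<le> e"
      using that by (rule uniform_Ck_0_D[OF Y0 z])
    obtain C1 where C1: "C1 > 0"
      "\<forall>\<^sub>F h in nhds 0. \<forall>y\<in>Y. norm (J (z + h) (y (z + h)) - J z (y z)) \<le> C1 * norm h"
      using that by (rule uniform_Ck_lipschitz_at[OF Suc.prems(2) z])
    obtain C2 where C2: "C2 > 0"
      "\<forall>\<^sub>F h in nhds 0. \<forall>c\<in>{c. norm c \<le> 1}. norm (J (z + h) c - J z c) \<le> C2 * norm h"
      using that by (rule uniform_Ck_lipschitz_at[OF Suc.prems(1) z])
    \<comment> \<open>Lipschitz constant of the solutions: \<kappa> times their increment is at most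
      the increment of the right-hand side plus that of \<open>J\<close> at the fixed vector
      \<open>y z\<close>.\<close>
    define C where "C = (C1 + C2 * M) / \<kappa>"
    have C: "C > 0" using C1(1) C2(1) M(1) low(1) by (simp add: C_def add_pos_nonneg)
    have n: "n \<ge> 0" by (simp add: n_def)
    define e1 where "e1 = \<kappa> * e / 2 / (1 + n * M)"
    define e2 where "e2 = \<kappa> * e / 2 / (C2 * C)"
    have e1: "e1 > 0" "e1 * (1 + n * M) = \<kappa> * e / 2"
    proof -
      have "1 + n * M > 0" using n M(1) by (simp add: add_pos_nonneg)
      then show "e1 > 0" "e1 * (1 + n * M) = \<kappa> * e / 2"
        using e low(1) by (simp add: e1_def, unfold e1_def, intro pos_divide_times_cancel)
    qed
    have e2: "e2 > 0" "e2 * (C2 * C) = \<kappa> * e / 2"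
      using e low(1) C C2(1) by (simp_all add: e2_def)
    have "\<forall>\<^sub>F h :: 'z in nhds 0. norm h < e2"
      using order_tendstoD(2)[OF tendsto_norm[OF filterlim_ident[of "nhds (0::'z)"]]] e2(1) by simp
    from this C1(2) C2(2) B(2)[OF z e1(1)] E(2)[OF z e1(1)] nh[OF z]
    show "\<forall>\<^sub>F h in nhds 0. \<forall>y\<in>Y. norm (y (z + h) - y z - DY y z h) \<le> e * norm h"
    proof eventually_elim
      case (elim h)
      interpret J0: linear "J z" by (rule lin[OF z])
      interpret J1: linear "J (z + h)" by (rule lin[OF elim(6)])
      have op: "norm (J (z + h) c - J z c) \<le> C2 * norm h * norm c" for c
        by (rule norm_linear_le_of_unit_ball[where A = "\<lambda>c. J (z + h) c - J z c"])
          (use elim(3) linear_compose_sub[OF J1.linear_axioms J0.linear_axioms] in auto)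
      have op': "norm (J (z + h) c - J z c - DJ z h c) \<le> n * (norm c * (e1 * norm h))" for c
      proof -
        have rep: "linear A \<Longrightarrow> A c = (\<Sum>b\<in>Basis. (c \<bullet> b) *\<^sub>R A b)" for A :: "'e \<Rightarrow> 'e"
          by (subst (1) euclidean_representation[of c, symmetric]) (simp only: linear_sum linear_scale)
        have "J (z + h) c - J z c - DJ z h c = (\<Sum>b\<in>Basis. (c \<bullet> b) *\<^sub>R (J (z + h) b - J z b - E b z h))"
          unfolding DJ_def rep[OF J0.linear_axioms] rep[OF J1.linear_axioms]
          by (simp add: sum_subtractf scaleR_diff_right)
        also have "norm \<dots> \<le> (\<Sum>b\<in>(Basis::'e set). norm c * (e1 * norm h))"
        proof (rule sum_norm_le)
          fix b :: 'e assume b: "b \<in> Basis"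
          have "\<bar>c \<bullet> b\<bar> * norm (J (z + h) b - J z b - E b z h) \<le> norm c * (e1 * norm h)"
            by (rule mult_mono[OF Basis_le_norm[OF b] bspec[OF elim(5) unit[OF b]]]) auto
          then show "norm ((c \<bullet> b) *\<^sub>R (J (z + h) b - J z b - E b z h)) \<le> norm c * (e1 * norm h)" by simp
        qed
        finally show ?thesis by (simp add: n_def)
      qed
      show ?case
      proof
        fix y assume y: "y \<in> Y"
        let ?dy = "y (z + h) - y z"
        let ?db = "J (z + h) (y (z + h)) - J z (y z)"
        have "\<kappa> * norm ?dy \<le> norm (J (z + h) ?dy)"
          by (rule low(2)[OF elim(6)])
        also have "J (z + h) ?dy = ?db - (J (z + h) (y z) - J z (y z))"
          by (simp add: J1.diff)
        also have "norm \<dots> \<le> C1 * norm h + C2 * norm h * norm (y z)"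
          by (rule order_trans[OF norm_triangle_ineq4 add_mono[OF bspec[OF elim(2) y] op]])
        also have "\<dots> \<le> C1 * norm h + C2 * norm h * M"
          using C2(1) M(2)[OF y] by (intro add_left_mono mult_left_mono) auto
        also have "\<dots> = \<kappa> * (C * norm h)" using low(1) by (simp add: C_def field_simps)
        finally have dy: "norm ?dy \<le> C * norm h" using low(1) by simp
        have "\<kappa> * norm (?dy - DY y z h) \<le> norm (J z (?dy - DY y z h))" by (rule low(2)[OF z])
        \<comment> \<open>Applying \<open>J z\<close> turns the error into the remainder of the
          right-hand side, the remainder of \<open>J\<close> at \<open>y z\<close>, and a second
          order term in which both \<open>J\<close> and the solution vary.\<close>
        also have "J z (?dy - DY y z h) = (?db - B y z h) - (J (z + h) (y z) - J z (y z) - DJ z h (y z))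
            - (J (z + h) ?dy - J z ?dy)"
          by (simp add: J0.diff J1.diff JDY[OF z])
        also have "norm \<dots> \<le> e1 * norm h + n * (norm (y z) * (e1 * norm h)) + C2 * norm h * norm ?dy"
          by (rule order_trans[OF norm_triangle_ineq4 add_mono[OF
                order_trans[OF norm_triangle_ineq4 add_mono[OF bspec[OF elim(4) y] op']] op]])
        also have "\<dots> \<le> e1 * norm h + n * (M * (e1 * norm h)) + C2 * e2 * (C * norm h)"
          using n M(2)[OF y] e1(1) elim(1) dy C2(1) C e2(1)
          by (intro add_mono mult_left_mono mult_right_mono mult_mono order_refl) auto
        also have "\<dots> = (e1 * (1 + n * M) + e2 * (C2 * C)) * norm h" by (simp add: algebra_simps)
        also have "\<dots> = \<kappa> * (e * norm h)" unfolding e1(2) e2(2) by simp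
        finally show "norm (?dy - DY y z h) \<le> e * norm h" using low(1) by simp
      qed
    qed
  qed
  then show ?case by simp
qed

section \<open>From uniform families to Frechet derivatives\<close>

text \<open>Uniqueness of the derivative replaces the chosen witness by
  \<open>frechet_derivative\<close>. With a canonical derivative the higher ones are defined by
  iteration instead of repeated choices.\<close>

lemma uniform_Ck_Suc_frechet:
  fixes f :: "'i \<Rightarrow> 'a::real_normed_vector \<Rightarrow> 'b::real_normed_vector"
  assumes U: "open U" and f: "uniform_Ck (Suc k) U (f ` I)"
  shows "\<And>z i. z \<in> U \<Longrightarrow> i \<in> I \<Longrightarrow> (f i has_derivative frechet_derivative (f i) (at z)) (at z)"
    and "\<And>z e. z \<in> U \<Longrightarrow> e > 0 \<Longrightarrow> \<forall>\<^sub>F h in nhds 0. \<forall>i\<in>I.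
        norm (f i (z + h) - f i z - frechet_derivative (f i) (at z) h) \<le> e * norm h"
    and "uniform_Ck k U {\<lambda>z. frechet_derivative (f i) (at z) v | i v. i \<in> I \<and> norm v \<le> 1}"
proof -
  obtain D K where D: "\<And>z i. z \<in> U \<Longrightarrow> i \<in> I \<Longrightarrow> linear (D i z)"
    "\<And>z e. z \<in> U \<Longrightarrow> e > 0 \<Longrightarrow>
      \<forall>\<^sub>F h in nhds 0. \<forall>i\<in>I. norm (f i (z + h) - f i z - D i z h) \<le> e * norm h"
    "uniform_Ck k U {\<lambda>z. D i z v | i v. i \<in> I \<and> norm v \<le> 1}"
    "\<And>z i h. z \<in> U \<Longrightarrow> i \<in> I \<Longrightarrow> norm (D i z h) \<le> K z * norm h" "\<And>z. K z \<ge> 0"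
    using that by (rule uniform_Ck_Suc_E[OF f])
  have der: "(f i has_derivative D i z) (at z)" if "z \<in> U" "i \<in> I" for z i
    unfolding has_derivative_within_alt
  proof (intro conjI allI impI)
    interpret linear "D i z" by (rule D(1)[OF that])
    show "bounded_linear (D i z)"
      by (rule bounded_linear_intro[where K = "K z"]) (use D(4)[OF that] in \<open>auto simp: add scale mult.commute\<close>)
    fix e :: real assume "e > 0"
    from D(2)[OF that(1) this] obtain d where d: "d > 0"
      "\<And>h. norm h < d \<Longrightarrow> \<forall>i\<in>I. norm (f i (z + h) - f i z - D i z h) \<le> e * norm h"
      unfolding eventually_nhds_metric by auto
    show "\<exists>d>0. \<forall>y\<in>UNIV. norm (y - z) < d \<longrightarrow> norm (f i y - f i z - D i z (y - z)) \<le> e * norm (y - z)"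
      using d(1) bspec[OF d(2) that(2)] by (intro exI[of _ d]) (metis add.commute diff_add_cancel)
  qed
  have eq: "frechet_derivative (f i) (at z) = D i z" if "z \<in> U" "i \<in> I" for z i
    by (rule frechet_derivative_at[OF der[OF that], symmetric])
  show "(f i has_derivative frechet_derivative (f i) (at z)) (at z)" if "z \<in> U" "i \<in> I" for z i
    using der[OF that] eq[OF that] by simp
  show "\<forall>\<^sub>F h in nhds 0. \<forall>i\<in>I. norm (f i (z + h) - f i z - frechet_derivative (f i) (at z) h) \<le> e * norm h"
    if "z \<in> U" "e > 0" for z e
    using D(2)[OF that] by (rule eventually_mono) (simp add: eq[OF that(1)])
  have "uniform_Ck k U ((\<lambda>p z. D (fst p) z (snd p)) ` (I \<times> {v. norm v \<le> 1}))"
  proof (rule uniform_Ck_mono[OF D(3)], rule image_subsetI)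
    fix p assume "p \<in> I \<times> {v :: 'a. norm v \<le> 1}"
    then show "(\<lambda>z. D (fst p) z (snd p)) \<in> {\<lambda>z. D i z v | i v. i \<in> I \<and> norm v \<le> 1}"
      by - (rule CollectI, rule exI[of _ "fst p"], rule exI[of _ "snd p"], auto)
  qed
  then have c: "uniform_Ck k U ((\<lambda>p z. frechet_derivative (f (fst p)) (at z) (snd p)) ` (I \<times> {v. norm v \<le> 1}))"
    by (rule uniform_Ck_cong[OF U, rotated]) (use eq in auto)
  show "uniform_Ck k U {\<lambda>z. frechet_derivative (f i) (at z) v | i v. i \<in> I \<and> norm v \<le> 1}"
  proof (rule uniform_Ck_mono[OF c], safe)
    fix i and v :: 'a assume "i \<in> I" "norm v \<le> 1"
    then show "(\<lambda>z. frechet_derivative (f i) (at z) v) \<in>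
        (\<lambda>p z. frechet_derivative (f (fst p)) (at z) (snd p)) ` (I \<times> {v. norm v \<le> 1})"
      by (intro image_eqI[where x = "(i, v)"]) auto
  qed
qed

text \<open>The latest differentiation stands at the head of the list, in agreement with the place
  of \<open>h\<close> in \<open>D (Suc j) z (h # vs)\<close> in \<open>Ck_on\<close>.\<close>

primrec iterated_derivative ::
    "('a::real_normed_vector \<Rightarrow> 'b::real_normed_vector) \<Rightarrow> 'a list \<Rightarrow> 'a \<Rightarrow> 'b" where
  "iterated_derivative f [] = f"
| "iterated_derivative f (v # vs) = (\<lambda>z. frechet_derivative (iterated_derivative f vs) (at z) v)"

text \<open>Each differentiation consumes one order. A general radius \<open>R\<close> is kept
  because single lists of arbitrary vectors are needed besides those from the unit ball.\<close>

lemma uniform_Ck_iterated_derivative: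
  fixes f :: "'a::real_normed_vector \<Rightarrow> 'b::real_normed_vector"
  assumes U: "open U" and f: "uniform_Ck (k + j) U {f}"
  shows "uniform_Ck k U (iterated_derivative f ` {vs. length vs = j \<and> (\<forall>v\<in>set vs. norm v \<le> R)})"
  using f
proof (induction j arbitrary: k)
  case 0
  have "{vs :: 'a list. length vs = 0 \<and> (\<forall>v\<in>set vs. norm v \<le> R)} = {[]}" by auto
  with 0 show ?case by simp
next
  case (Suc j)
  let ?V = "{vs :: 'a list. length vs = j \<and> (\<forall>v\<in>set vs. norm v \<le> R)}"
  have IH: "uniform_Ck (Suc k) U (iterated_derivative f ` ?V)"
    using Suc.IH[of "Suc k"] Suc.prems by simp
  note fr = uniform_Ck_Suc_frechet[OF U IH]
  have lin: "linear (frechet_derivative (iterated_derivative f vs) (at z))" if "z \<in> U" "vs \<in> ?V" for z vs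
    using fr(1)[OF that] by (rule has_derivative_linear)
  have resc: "uniform_Ck k U {\<lambda>z. frechet_derivative (iterated_derivative f vs) (at z) v |vs v. vs \<in> ?V \<and> norm v \<le> R}"
    by (rule uniform_Ck_rescale[OF U _ fr(3)]) (rule lin)
  show ?case
  proof (rule uniform_Ck_mono[OF resc], rule image_subsetI)
    fix vs assume vs: "vs \<in> {vs :: 'a list. length vs = Suc j \<and> (\<forall>v\<in>set vs. norm v \<le> R)}"
    then obtain w ws where w: "vs = w # ws" by (cases vs) auto
    with vs have "ws \<in> ?V" "norm w \<le> R" by auto
    then show "iterated_derivative f vs \<in>
        {\<lambda>z. frechet_derivative (iterated_derivative f i) (at z) v |i v. i \<in> ?V \<and> norm v \<le> R}"
      unfolding w iterated_derivative.simps by - (rule CollectI, rule exI[of _ ws], rule exI[of _ w], auto)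
  qed
qed

lemma iterated_derivative_has_derivative:
  fixes f :: "'a::real_normed_vector \<Rightarrow> 'b::real_normed_vector"
  assumes U: "open U" and f: "uniform_Ck k U {f}" and "length vs < k" "z \<in> U"
  shows "(iterated_derivative f vs has_derivative frechet_derivative (iterated_derivative f vs) (at z)) (at z)"
proof -
  obtain R where R: "\<forall>v\<in>set vs. norm v \<le> R"
    using finite_imageI[of "set vs" norm] by (metis List.finite_set Max_ge image_eqI)
  have "uniform_Ck (Suc (k - Suc (length vs)) + length vs) U {f}" using f assms(3) by simp
  from uniform_Ck_Suc_frechet(1)[OF U uniform_Ck_iterated_derivative[OF U this] assms(4)] R
  show ?thesis by simp
qed

text \<open>At the head of the list this is linearity of a derivative. In an inner slot the identity
  holds between functions on the open set \<open>U\<close> by induction, and differentiation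
  preserves it.\<close>

lemma iterated_derivative_linear:
  fixes f :: "'a::real_normed_vector \<Rightarrow> 'b::real_normed_vector"
  assumes U: "open U" and f: "uniform_Ck k U {f}"
  shows "length us + length vs < k \<Longrightarrow> z \<in> U \<Longrightarrow> linear (\<lambda>v. iterated_derivative f (us @ v # vs) z)"
proof (induction us arbitrary: z)
  case Nil
  have "linear (frechet_derivative (iterated_derivative f vs) (at z))"
    by (rule has_derivative_linear[OF iterated_derivative_has_derivative[OF U f]]) (use Nil in auto)
  then show ?case by simp
next
  case (Cons u us)
  have der: "(iterated_derivative f (us @ v # vs) has_derivative
      frechet_derivative (iterated_derivative f (us @ v # vs)) (at z)) (at z)" for v
    by (rule iterated_derivative_has_derivative[OF U f]) (use Cons.prems in auto)
  have lin: "linear (\<lambda>v. iterated_derivative f (us @ v # vs) y)" if "y \<in> U" for y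
    by (rule Cons.IH[OF _ that]) (use Cons.prems in auto)
  show ?case
  proof (rule linearI)
    fix v w :: 'a
    have "(iterated_derivative f (us @ (v + w) # vs) has_derivative (\<lambda>h.
        frechet_derivative (iterated_derivative f (us @ v # vs)) (at z) h +
        frechet_derivative (iterated_derivative f (us @ w # vs)) (at z) h)) (at z)"
      by (rule has_derivative_transform_within_open[OF has_derivative_add[OF der der] U Cons.prems(2)])
        (simp add: linear_add[OF lin])
    from fun_cong[OF frechet_derivative_at[OF this], of u]
    show "iterated_derivative f ((u # us) @ (v + w) # vs) z =
        iterated_derivative f ((u # us) @ v # vs) z + iterated_derivative f ((u # us) @ w # vs) z"
      by simp
  next
    fix c :: real and v :: 'a
    have "(iterated_derivative f (us @ (c *\<^sub>R v) # vs) has_derivative (\<lambda>h.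
        c *\<^sub>R frechet_derivative (iterated_derivative f (us @ v # vs)) (at z) h)) (at z)"
      by (rule has_derivative_transform_within_open[OF has_derivative_scaleR_right[OF der] U Cons.prems(2)])
        (simp add: linear_scale[OF lin])
    from fun_cong[OF frechet_derivative_at[OF this], of u]
    show "iterated_derivative f ((u # us) @ (c *\<^sub>R v) # vs) z = c *\<^sub>R iterated_derivative f ((u # us) @ v # vs) z"
      by simp
  qed
qed

text \<open>The entries are normalised one at a time, from left to right: \<open>us\<close> collects
  those already in the unit ball, and each step extracts one norm by linearity in that slot.\<close>

lemma multilinear_le_of_unit_ball:
  fixes T :: "'a::real_normed_vector list \<Rightarrow> 'b::real_normed_vector"
  assumes lin: "\<And>us vs. length us + length vs + 1 = j \<Longrightarrow> linear (\<lambda>v. T (us @ v # vs))"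
    and unit: "\<And>vs. length vs = j \<Longrightarrow> \<forall>v\<in>set vs. norm v \<le> 1 \<Longrightarrow> norm (T vs) \<le> K"
    and "length vs = j"
  shows "norm (T vs) \<le> K * prod_list (map norm vs)"
proof -
  have "norm (T (us @ ws)) \<le> K * prod_list (map norm ws)"
    if "length us + length ws = j" "\<forall>v\<in>set us. norm v \<le> 1" for us ws
    using that
  proof (induction ws arbitrary: us)
    case Nil
    then show ?case using unit[of us] by simp
  next
    case (Cons w ws)
    have l: "linear (\<lambda>v. T (us @ v # ws))" by (rule lin) (use Cons.prems in simp)
    show ?case
    proof (cases "w = 0")
      case True
      then show ?thesis using linear_0[OF l] by simp
    next
      case False
      have "norm (T ((us @ [w /\<^sub>R norm w]) @ ws)) \<le> K * prod_list (map norm ws)"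
        by (rule Cons.IH) (use Cons.prems False in auto)
      moreover have "T (us @ w # ws) = norm w *\<^sub>R T ((us @ [w /\<^sub>R norm w]) @ ws)"
        using linear_scale[OF l, of "norm w" "w /\<^sub>R norm w"] False by simp
      ultimately have "norm (T (us @ w # ws)) \<le> norm w * (K * prod_list (map norm ws))"
        by (simp only: norm_scaleR abs_norm_cancel mult_left_mono norm_ge_zero)
      then show ?thesis by (simp add: mult.left_commute)
    qed
  qed
  from this[of "[]" vs] assms(3) show ?thesis by simp
qed

text \<open>On lists from the unit ball the estimates required by \<open>Ck_on\<close> are the
  uniform estimates of the family of \<open>j\<close>-th derivatives, which has \<open>k - j\<close>
  orders left; multilinearity supplies the product of norms.\<close>

theorem uniform_Ck_imp_Ck_on:
  fixes f :: "'a::real_normed_vector \<Rightarrow> 'b::real_normed_vector"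
  assumes U: "open U" and f: "uniform_Ck k U {f}"
  shows "Ck_on k U f"
proof -
  let ?D = "\<lambda>(j::nat) z vs. iterated_derivative f vs z"
  let ?V = "\<lambda>j. {vs :: 'a list. length vs = j \<and> (\<forall>v\<in>set vs. norm v \<le> 1)}"
  have lin: "linear (\<lambda>v. iterated_derivative f (us @ v # vs) z)"
    if "length us + length vs + 1 = j" "j \<le> k" "z \<in> U" for us vs j z
    by (rule iterated_derivative_linear[OF U f]) (use that in auto)
  have fam: "uniform_Ck (k - j) U (iterated_derivative f ` ?V j)" if "j \<le> k" for j
    by (rule uniform_Ck_iterated_derivative[OF U]) (use f that in simp)
  have mult: "bounded_multilinear_form j (?D j z)" if jz: "j \<le> k" "z \<in> U" for j z
  proof -
    obtain K where K: "K \<ge> 0" "\<And>vs. vs \<in> ?V j \<Longrightarrow> norm (iterated_derivative f vs z) \<le> K"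
      "\<And>e. e > 0 \<Longrightarrow> \<forall>\<^sub>F h in nhds 0. \<forall>vs\<in>?V j.
          norm (iterated_derivative f vs (z + h) - iterated_derivative f vs z) \<le> e"
      using that by (rule uniform_Ck_0_D[OF fam[OF jz(1)] jz(2)])
    have "norm (iterated_derivative f vs z) \<le> K * prod_list (map norm vs)" if "length vs = j" for vs
      by (rule multilinear_le_of_unit_ball[where T = "\<lambda>vs. iterated_derivative f vs z", OF lin K(2) that])
        (use \<open>j \<le> k\<close> \<open>z \<in> U\<close> in auto)
    then show ?thesis unfolding bounded_multilinear_form_def using lin jz by blast
  qed
  have diff: "\<exists>d>0. \<forall>h. norm h < d \<longrightarrow> z + h \<in> U \<and> (\<forall>vs. length vs = j \<longrightarrow>
      norm (iterated_derivative f vs (z + h) - iterated_derivative f vs z - iterated_derivative f (h # vs) z)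
        \<le> e * norm h * prod_list (map norm vs))"
    if jz: "j < k" "z \<in> U" "e > 0" for j z e
  proof -
    have "uniform_Ck (Suc (k - Suc j)) U (iterated_derivative f ` ?V j)"
      using fam[of j] jz(1) by (simp add: Suc_diff_Suc)
    from uniform_Ck_Suc_frechet(2)[OF U this jz(2,3)]
    obtain d1 where d1: "d1 > 0" "\<And>h. norm h < d1 \<Longrightarrow> \<forall>vs\<in>?V j. norm (iterated_derivative f vs (z + h)
        - iterated_derivative f vs z - frechet_derivative (iterated_derivative f vs) (at z) h) \<le> e * norm h"
      unfolding eventually_nhds_metric by auto
    obtain d2 where d2: "d2 > 0" "\<And>h. norm h < d2 \<Longrightarrow> z + h \<in> U"
      using U jz(2) unfolding open_dist by (metis add_diff_cancel_left' dist_norm)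
    show ?thesis
    proof (intro exI[of _ "min d1 d2"] conjI allI impI)
      show "min d1 d2 > 0" using d1 d2 by simp
      fix h :: 'a assume h: "norm h < min d1 d2"
      then show zh: "z + h \<in> U" using d2 by simp
      fix vs :: "'a list" assume vs: "length vs = j"
      show "norm (iterated_derivative f vs (z + h) - iterated_derivative f vs z - iterated_derivative f (h # vs) z)
        \<le> e * norm h * prod_list (map norm vs)"
      proof (rule multilinear_le_of_unit_ball[where T = "\<lambda>vs. iterated_derivative f vs (z + h)
          - iterated_derivative f vs z - iterated_derivative f (h # vs) z", OF _ _ vs])
        fix us vs :: "'a list" assume l: "length us + length vs + 1 = j"
        show "linear (\<lambda>v. iterated_derivative f (us @ v # vs) (z + h) - iterated_derivative f (us @ v # vs) z
            - iterated_derivative f (h # us @ v # vs) z)"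
          using lin[of us vs j "z + h"] lin[of us vs j z] lin[of "h # us" vs "Suc j" z] l jz(1,2) zh
          by (intro linear_compose_sub) auto
      next
        fix vs :: "'a list" assume "length vs = j" "\<forall>v\<in>set vs. norm v \<le> 1"
        then show "norm (iterated_derivative f vs (z + h) - iterated_derivative f vs z - iterated_derivative f (h # vs) z)
            \<le> e * norm h" using d1(2)[of h] h by simp
      qed
    qed
  qed
  have cont: "\<exists>d>0. \<forall>z'\<in>U. dist z' z < d \<longrightarrow> (\<forall>vs. length vs = k \<longrightarrow>
      norm (iterated_derivative f vs z' - iterated_derivative f vs z) \<le> e * prod_list (map norm vs))"
    if ze: "z \<in> U" "e > 0" for z e
  proof -
    obtain K where K: "K \<ge> 0" "\<And>vs. vs \<in> ?V k \<Longrightarrow> norm (iterated_derivative f vs z) \<le> K"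
      "\<And>e. e > 0 \<Longrightarrow> \<forall>\<^sub>F h in nhds 0. \<forall>vs\<in>?V k.
          norm (iterated_derivative f vs (z + h) - iterated_derivative f vs z) \<le> e"
      using that by (rule uniform_Ck_0_D[OF fam[OF order_refl] ze(1)])
    from K(3)[OF ze(2)] obtain d where d: "d > 0" "\<And>h. norm h < d \<Longrightarrow> \<forall>vs\<in>?V k.
          norm (iterated_derivative f vs (z + h) - iterated_derivative f vs z) \<le> e"
      unfolding eventually_nhds_metric by auto
    show ?thesis
    proof (intro exI[of _ d] conjI ballI impI allI)
      fix z' :: 'a and vs :: "'a list" assume z': "z' \<in> U" "dist z' z < d" and vs: "length vs = k"
      show "norm (iterated_derivative f vs z' - iterated_derivative f vs z) \<le> e * prod_list (map norm vs)"
      proof (rule multilinear_le_of_unit_ball[where T = "\<lambda>vs. iterated_derivative f vs z' - iterated_derivative f vs z",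
            OF _ _ vs])
        fix us vs :: "'a list" assume l: "length us + length vs + 1 = k"
        show "linear (\<lambda>v. iterated_derivative f (us @ v # vs) z' - iterated_derivative f (us @ v # vs) z)"
          by (intro linear_compose_sub lin[OF l order_refl] z' ze)
      next
        fix vs :: "'a list" assume "length vs = k" "\<forall>v\<in>set vs. norm v \<le> 1"
        then show "norm (iterated_derivative f vs z' - iterated_derivative f vs z) \<le> e"
          using d(2)[of "z' - z"] z'(2) by (simp add: dist_norm)
      qed
    qed (use d in simp)
  qed
  show ?thesis unfolding Ck_on_def
    by (intro conjI U exI[of _ ?D]) (use mult diff cont in auto)
qed

section \<open>Implicit functions with a parameter in a normed space\<close>

lemma uniform_Ck_frechet_single:
  fixes f :: "'a::real_normed_vector \<Rightarrow> 'b::real_normed_vector"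
  assumes U: "open U" and f: "uniform_Ck (Suc k) U {f}"
  shows "\<And>z. z \<in> U \<Longrightarrow> (f has_derivative frechet_derivative f (at z)) (at z)"
    and "\<And>z e. z \<in> U \<Longrightarrow> e > 0 \<Longrightarrow> \<forall>\<^sub>F h in nhds 0.
        norm (f (z + h) - f z - frechet_derivative f (at z) h) \<le> e * norm h"
    and "uniform_Ck k U ((\<lambda>v z. frechet_derivative f (at z) v) ` {v. norm v \<le> 1})"
proof -
  have "uniform_Ck (Suc k) U ((\<lambda>_. f) ` {()})" using f by simp
  note fr = uniform_Ck_Suc_frechet[OF U this]
  show "\<And>z. z \<in> U \<Longrightarrow> (f has_derivative frechet_derivative f (at z)) (at z)"
    and "\<And>z e. z \<in> U \<Longrightarrow> e > 0 \<Longrightarrow> \<forall>\<^sub>F h in nhds 0.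
        norm (f (z + h) - f z - frechet_derivative f (at z) h) \<le> e * norm h"
    using fr(1,2) by simp_all
  show "uniform_Ck k U ((\<lambda>v z. frechet_derivative f (at z) v) ` {v. norm v \<le> 1})"
  proof (rule uniform_Ck_mono[OF fr(3)], rule image_subsetI)
    fix v :: 'a assume "v \<in> {v. norm v \<le> 1}"
    then show "(\<lambda>z. frechet_derivative f (at z) v) \<in> {\<lambda>z. frechet_derivative f (at z) v |i v. i \<in> {()} \<and> norm v \<le> 1}"
      by - (rule CollectI, rule exI[of _ "()"], rule exI[of _ v], auto)
  qed
qed

text \<open>The mean value inequality on a ball, applied to \<open>f\<close> minus its derivative at
  \<open>p0\<close>; operator-norm continuity of the derivative makes the derivative of this
  difference small.\<close>

lemma uniform_Ck_strict_derivative: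
  fixes f :: "'a::real_normed_vector \<Rightarrow> 'b::real_normed_vector"
  assumes f: "uniform_Ck (Suc 0) UNIV {f}" and e: "e > 0"
  obtains d where "d > 0"
    "\<And>p v. p \<in> ball p0 d \<Longrightarrow>
      norm (frechet_derivative f (at p) v - frechet_derivative f (at p0) v) \<le> e * norm v"
    "\<And>p q. p \<in> ball p0 d \<Longrightarrow> q \<in> ball p0 d \<Longrightarrow>
      norm (f p - f q - frechet_derivative f (at p0) (p - q)) \<le> e * norm (p - q)"
proof -
  let ?D = "\<lambda>p. frechet_derivative f (at p)"
  note fr = uniform_Ck_frechet_single[OF open_UNIV f]
  have lin: "linear (?D p)" for p by (rule has_derivative_linear[OF fr(1)]) simp
  obtain K where K: "K \<ge> 0" "\<And>v. v \<in> {v. norm v \<le> 1} \<Longrightarrow> norm (?D p0 v) \<le> K"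
    "\<And>e. e > 0 \<Longrightarrow> \<forall>\<^sub>F h in nhds 0. \<forall>v\<in>{v. norm v \<le> 1}. norm (?D (p0 + h) v - ?D p0 v) \<le> e"
    using that by (rule uniform_Ck_0_D[OF fr(3) UNIV_I])
  from K(3)[OF e] obtain d where d: "d > 0"
    "\<And>h. norm h < d \<Longrightarrow> \<forall>v\<in>{v. norm v \<le> 1}. norm (?D (p0 + h) v - ?D p0 v) \<le> e"
    unfolding eventually_nhds_metric by auto
  have 1: "norm (?D p v - ?D p0 v) \<le> e * norm v" if p: "p \<in> ball p0 d" for p v
  proof (rule norm_linear_le_of_unit_ball[where A = "\<lambda>v. ?D p v - ?D p0 v"])
    show "linear (\<lambda>v. ?D p v - ?D p0 v)" by (intro linear_compose_sub lin)
    show "norm (?D p v - ?D p0 v) \<le> e" if "norm v \<le> 1" for v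
      using d(2)[of "p - p0"] p that by (simp add: dist_norm norm_minus_commute)
  qed
  have 2: "norm (f p - f q - ?D p0 (p - q)) \<le> e * norm (p - q)"
    if "p \<in> ball p0 d" "q \<in> ball p0 d" for p q
  proof -
    have "norm ((f p - ?D p0 p) - (f q - ?D p0 q)) \<le> e * norm (p - q)"
    proof (rule differentiable_bound[where f' = "\<lambda>x v. ?D x v - ?D p0 v" and S = "ball p0 d"])
      fix x assume x: "x \<in> ball p0 d"
      have "bounded_linear (?D p0)" by (rule has_derivative_bounded_linear[OF fr(1)]) simp
      then have "((\<lambda>x. f x - ?D p0 x) has_derivative (\<lambda>v. ?D x v - ?D p0 v)) (at x)"
        by (intro has_derivative_diff fr(1) bounded_linear_imp_has_derivative) simp_all
      then show "((\<lambda>x. f x - ?D p0 x) has_derivative (\<lambda>v. ?D x v - ?D p0 v)) (at x within ball p0 d)"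
        by (rule has_derivative_at_withinI)
      show "onorm (\<lambda>v. ?D x v - ?D p0 v) \<le> e"
        by (rule onorm_bound) (use e 1[OF x] in auto)
    qed (use that in auto)
    then show ?thesis by (simp add: linear_diff[OF lin] algebra_simps)
  qed
  show ?thesis by (rule that[OF d(1) 1 2])
qed

text \<open>For fixed \<open>z\<close> the map sending \<open>u\<close> to
  \<open>u - M (F (z, u))\<close>, with \<open>M\<close> the inverse of the partial derivative at
  the base point, contracts a closed ball. Completeness is asked of the solution space only, so the
  parameter may come from any normed space. The radius depends on first order data, hence the last
  conclusion for all \<open>k\<close> on the same ball.\<close>

theorem uniform_Ck_implicit_function:
  fixes F :: "'z::real_normed_vector \<times> 'e::euclidean_space \<Rightarrow> 'e"
  assumes F1: "uniform_Ck (Suc 0) UNIV {F}" and F0: "F (z0, u0) = 0"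
    and nd: "\<forall>c. frechet_derivative F (at (z0, u0)) (0, c) = 0 \<longrightarrow> c = 0"
  obtains r L g where "r > 0" "L \<ge> 0" "g z0 = u0" "\<And>z. z \<in> ball z0 r \<Longrightarrow> F (z, g z) = 0"
    "\<And>z. z \<in> ball z0 r \<Longrightarrow> norm (g z - u0) \<le> L * norm (z - z0)"
    "\<And>k. uniform_Ck k UNIV {F} \<Longrightarrow> uniform_Ck k (ball z0 r) {g}"
proof -
  let ?DF = "\<lambda>p. frechet_derivative F (at p)"
  define p0 where "p0 = (z0, u0)"
  note fr = uniform_Ck_frechet_single[OF open_UNIV F1]
  have blin: "bounded_linear (?DF p)" for p by (rule has_derivative_bounded_linear[OF fr(1)]) simp
  note lin = bounded_linear.linear[OF blin]
  have linJ: "linear (\<lambda>c. ?DF p (0, c))" for p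
  proof (rule linearI)
    fix a b show "?DF p (0, a + b) = ?DF p (0, a) + ?DF p (0, b)"
      using linear_add[OF lin, of p "(0, a)" "(0, b)"] by simp
  next
    fix c a show "?DF p (0, c *\<^sub>R a) = c *\<^sub>R ?DF p (0, a)"
      using linear_scale[OF lin, of p c "(0, a)"] by simp
  qed
  have inj0: "inj (\<lambda>c. ?DF p0 (0, c))"
    unfolding linear_injective_0[OF linJ] using nd by (simp add: p0_def)
  define M where "M = inv (\<lambda>c. ?DF p0 (0, c))"
  have MJ: "M (?DF p0 (0, c)) = c" for c unfolding M_def by (rule inv_f_f[OF inj0])
  have JM: "?DF p0 (0, M x) = x" for x unfolding M_def
    by (rule surj_f_inv_f[OF linear_injective_imp_surjective[OF linJ inj0 refl]])
  have linM: "linear M" unfolding M_def by (rule inj_linear_imp_inv_linear[OF linJ inj0])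
  obtain m where m: "m > 0" "\<And>x. norm (M x) \<le> m * norm x"
    using linear_bounded_pos[OF linM] by blast
  obtain N where N: "N > 0" "\<And>x. norm (?DF p0 x) \<le> norm x * N"
    using bounded_linear.pos_bounded[OF blin] by blast
  \<comment> \<open>With this tolerance the Newton map with frozen derivative has contraction factor
    \<open>m * e = 1/2\<close>.\<close>
  define e where "e = 1 / (2 * m)"
  have e: "e > 0" "m * e = 1/2" using m(1) by (simp_all add: e_def)
  obtain d where d: "d > 0"
    "\<And>p v. p \<in> ball p0 d \<Longrightarrow> norm (?DF p v - ?DF p0 v) \<le> e * norm v"
    "\<And>p q. p \<in> ball p0 d \<Longrightarrow> q \<in> ball p0 d \<Longrightarrow> norm (F p - F q - ?DF p0 (p - q)) \<le> e * norm (p - q)"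
    using that by (rule uniform_Ck_strict_derivative[OF F1 e(1)])
  define C where "C = N + e"
  have C: "C > 0" using N(1) e(1) by (simp add: C_def)
  have Flip: "norm (F p - F q) \<le> C * norm (p - q)" if "p \<in> ball p0 d" "q \<in> ball p0 d" for p q
  proof -
    have "norm (F p - F q) \<le> norm (F p - F q - ?DF p0 (p - q)) + norm (?DF p0 (p - q))"
      using norm_triangle_sub by (metis add.commute)
    then show ?thesis using d(3)[OF that] N(2)[of "p - q"] by (simp add: C_def algebra_simps)
  qed
  define \<rho> where "\<rho> = d / 3"
  \<comment> \<open>A third of \<open>d\<close> for each component keeps pairs in the ball where the
    derivative is controlled; the second bound makes \<open>M (F (z, u0))\<close> at most
    \<open>\<rho> / 2\<close>, so that the contraction maps the closed ball into itself.\<close>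
  define r where "r = min (d / 3) (\<rho> / (2 * m * C))"
  have \<rho>: "\<rho> > 0" using d(1) by (simp add: \<rho>_def)
  have r: "r > 0" "r \<le> d / 3" "m * (C * r) \<le> \<rho> / 2"
  proof -
    show "r > 0" using d(1) \<rho> m(1) C by (simp add: r_def)
    show "r \<le> d / 3" by (simp add: r_def)
    have "r \<le> \<rho> / (2 * m * C)" by (simp add: r_def)
    then have "r * (2 * m * C) \<le> \<rho>" using m(1) C by (simp add: pos_le_divide_eq)
    then show "m * (C * r) \<le> \<rho> / 2" by (simp add: mult_ac)
  qed
  have inb: "(z, u) \<in> ball p0 d" if "z \<in> ball z0 r" "u \<in> cball u0 \<rho>" for z u
  proof -
    have "dist p0 (z, u) \<le> dist z0 z + dist u0 u"
      unfolding p0_def dist_Pair_Pair by (rule sqrt_sum_squares_le_sum) auto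
    also have "\<dots> < d" using that r(2) d(1) by (simp add: \<rho>_def)
    finally show ?thesis by simp
  qed
  have contr: "norm (u - u' - M (F (z, u) - F (z, u'))) \<le> norm (u - u') / 2"
    if "z \<in> ball z0 r" "u \<in> cball u0 \<rho>" "u' \<in> cball u0 \<rho>" for z u u'
  proof -
    have "u - u' - M (F (z, u) - F (z, u')) = - M (F (z, u) - F (z, u') - ?DF p0 ((z, u) - (z, u')))"
      using MJ[of "u - u'"] by (simp add: linear_diff[OF linM])
    then have "norm (u - u' - M (F (z, u) - F (z, u'))) \<le> m * norm (F (z, u) - F (z, u') - ?DF p0 ((z, u) - (z, u')))"
      using m(2) by (simp only: norm_minus_cancel)
    also have "\<dots> \<le> m * (e * norm ((z, u) - (z, u')))"
      using m(1) by (intro mult_left_mono d(3) inb that) auto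
    also have "\<dots> = norm (u - u') / 2" using e(2) by (simp add: norm_Pair mult.assoc[symmetric])
    finally show ?thesis .
  qed
  have low: "norm (u - u') \<le> 2 * m * norm (F (z, u) - F (z, u'))"
    if "z \<in> ball z0 r" "u \<in> cball u0 \<rho>" "u' \<in> cball u0 \<rho>" for z u u'
  proof -
    have "norm (u - u') \<le> norm (u - u' - M (F (z, u) - F (z, u'))) + norm (M (F (z, u) - F (z, u')))"
      using norm_triangle_sub by (metis add.commute)
    then show ?thesis using contr[OF that] m(2)[of "F (z, u) - F (z, u')"] by (simp add: mult.assoc)
  qed
  have u0: "u0 \<in> cball u0 \<rho>" using \<rho> by simp
  have z0: "z0 \<in> ball z0 r" using r(1) by simp
  have ex: "\<exists>u\<in>cball u0 \<rho>. F (z, u) = 0" if z: "z \<in> ball z0 r" for z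
  proof -
    have "\<exists>!u\<in>cball u0 \<rho>. u - M (F (z, u)) = u"
    proof (rule Banach_fix[where c = "1/2"])
      show "complete (cball u0 \<rho>)" by (simp add: complete_eq_closed)
      show "cball u0 \<rho> \<noteq> {}" using u0 by blast
      show "dist (u - M (F (z, u))) (v - M (F (z, v))) \<le> 1/2 * dist u v"
        if "u \<in> cball u0 \<rho>" "v \<in> cball u0 \<rho>" for u v
        using contr[OF z, of u v] that by (simp add: dist_norm linear_diff[OF linM] algebra_simps)
      show "(\<lambda>u. u - M (F (z, u))) ` cball u0 \<rho> \<subseteq> cball u0 \<rho>"
      proof (rule image_subsetI)
        fix u assume u: "u \<in> cball u0 \<rho>"
        have "norm (F (z, u0)) \<le> C * norm ((z, u0) - p0)"
          using Flip[OF inb[OF z u0] inb[OF z0 u0]] F0 by (simp add: p0_def)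
        also have "\<dots> \<le> C * r" using C z by (intro mult_left_mono) (auto simp: p0_def norm_Pair dist_norm norm_minus_commute)
        finally have "m * norm (F (z, u0)) \<le> m * (C * r)"
          by (rule mult_left_mono) (use m(1) in simp)
        then have "m * norm (F (z, u0)) \<le> \<rho> / 2" using r(3) by linarith
        then have 1: "norm (M (F (z, u0))) \<le> \<rho> / 2" using m(2)[of "F (z, u0)"] by linarith
        have eq: "u - M (F (z, u)) - u0 = (u - u0 - M (F (z, u) - F (z, u0))) - M (F (z, u0))"
          by (simp add: linear_diff[OF linM])
        have "norm (u - M (F (z, u)) - u0) \<le> norm (u - u0) / 2 + \<rho> / 2"
          unfolding eq by (rule order_trans[OF norm_triangle_ineq4 add_mono[OF contr[OF z u u0] 1]])
        also have "\<dots> \<le> \<rho>" using u by (simp add: dist_norm norm_minus_commute)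
        finally show "u - M (F (z, u)) \<in> cball u0 \<rho>" by (simp add: dist_norm norm_minus_commute)
      qed
    qed auto
    then obtain u where u: "u \<in> cball u0 \<rho>" "M (F (z, u)) = 0" by auto
    have "F (z, u) = ?DF p0 (0, M (F (z, u)))" by (simp only: JM)
    also have "\<dots> = 0" unfolding u(2) by (rule linear_0[OF linJ])
    finally show ?thesis using u(1) by blast
  qed
  define g where "g z = (SOME u. u \<in> cball u0 \<rho> \<and> F (z, u) = 0)" for z
  have g: "g z \<in> cball u0 \<rho>" "F (z, g z) = 0" if "z \<in> ball z0 r" for z
    using someI_ex[of "\<lambda>u. u \<in> cball u0 \<rho> \<and> F (z, u) = 0"] ex[OF that] unfolding g_def by blast+
  define L where "L = 2 * m * C"
  have L: "L > 0" using m(1) C by (simp add: L_def)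
  have glip: "norm (g z - g z') \<le> L * norm (z - z')" if "z \<in> ball z0 r" "z' \<in> ball z0 r" for z z'
  proof -
    have "norm (g z - g z') \<le> 2 * m * norm (F (z, g z) - F (z, g z'))"
      by (rule low[OF that(1) g(1)[OF that(1)] g(1)[OF that(2)]])
    also have "F (z, g z) - F (z, g z') = - (F (z, g z') - F (z', g z'))"
      using g(2) that by simp
    also have "norm \<dots> \<le> C * norm ((z, g z') - (z', g z'))"
      unfolding norm_minus_cancel by (intro Flip inb g(1) that)
    also have "\<dots> = C * norm (z - z')" by (simp add: norm_Pair)
    finally show ?thesis using m(1) by (simp add: L_def mult.assoc)
  qed
  \<comment> \<open>\<open>low\<close> makes zeros in the ball unique, so the choice made at
    \<open>z0\<close> is the given one.\<close>
  have g0: "g z0 = u0"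
    using low[OF z0 g(1)[OF z0] u0] g(2)[OF z0] F0 by simp
  let ?B = "ball z0 r"
  define J where "J z c = ?DF (z, g z) (0, c)" for z c
  have Jlin: "linear (J z)" for z unfolding J_def by (rule linJ)
  have Jlow: "1 / (2 * m) * norm c \<le> norm (J z c)" if z: "z \<in> ?B" for z c
  proof -
    have "norm (M (J z c - ?DF p0 (0, c))) \<le> m * (e * norm (0::'z, c))"
      unfolding J_def by (rule order_trans[OF m(2)]) (use m(1) in \<open>intro mult_left_mono d(2) inb z g(1), auto\<close>)
    then have "norm (M (J z c) - c) \<le> norm c / 2"
      using e(2) by (simp add: linear_diff[OF linM] MJ norm_Pair mult.assoc[symmetric])
    moreover have "norm c \<le> norm (M (J z c)) + norm (M (J z c) - c)"
      by (metis norm_minus_commute norm_triangle_sub)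
    ultimately have "norm c / 2 \<le> m * norm (J z c)" using m(2)[of "J z c"] by linarith
    then show ?thesis using m(1) by (simp add: field_simps)
  qed
  have Jinj: "inj (J z)" if "z \<in> ?B" for z
    unfolding linear_injective_0[OF Jlin]
  proof (intro allI impI)
    fix c assume "J z c = 0"
    then have "1 / (2 * m) * norm c \<le> 0" using Jlow[OF that, of c] by simp
    then show "c = 0" using m(1) by (simp add: mult_le_0_iff divide_le_0_iff)
  qed
  define Dg where "Dg z v = inv (J z) (- ?DF (z, g z) (v, 0))" for z v
  have JDg: "J z (Dg z v) = - ?DF (z, g z) (v, 0)" if "z \<in> ?B" for z v
    unfolding Dg_def by (rule surj_f_inv_f[OF linear_injective_imp_surjective[OF Jlin Jinj[OF that] refl]])
  note nh = eventually_add_mem[OF open_ball[of z0 r]]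
  have glip_ev: "\<forall>\<^sub>F h in nhds 0. norm (g (z + h) - g z) \<le> L * norm h" if "z \<in> ?B" for z
    using nh[OF that] by (rule eventually_mono) (use glip[OF _ that] in force)
  have small: "\<forall>\<^sub>F h :: 'z in nhds 0. L * norm h \<le> e" if "e > 0" for e
  proof -
    have "\<forall>\<^sub>F h :: 'z in nhds 0. norm h < e / L"
      using order_tendstoD(2)[OF tendsto_norm[OF filterlim_ident[of "nhds (0::'z)"]]] that L by simp
    then show ?thesis by (rule eventually_mono) (use L in \<open>simp add: field_simps\<close>)
  qed
  have gUC0: "uniform_Ck 0 ?B ((\<lambda>_. g) ` {()})"
  proof (rule uniform_Ck_0_I)
    fix z e assume "z \<in> ?B" "e > (0::real)"
    show "\<forall>\<^sub>F h in nhds 0. \<forall>i\<in>{()}. norm (g (z + h) - g z) \<le> e"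
      using glip_ev[OF \<open>z \<in> ?B\<close>] small[OF \<open>e > 0\<close>] by eventually_elim simp
  qed auto
  \<comment> \<open>Smoothness of order \<open>k\<close> of \<open>g\<close> passes to the
    coefficients of the linear system for its derivative \<open>Dg\<close>; its solution is again of
    order \<open>k\<close>, which raises the order of \<open>g\<close> by one.\<close>
  have gUC: "uniform_Ck k ?B {g}" if "uniform_Ck k UNIV {F}" for k
    using that
  proof (induction k)
    case 0
    then show ?case using gUC0 by simp
  next
    case (Suc k)
    have gk: "uniform_Ck k ?B {g}" by (rule Suc.IH[OF uniform_Ck_SucD[OF Suc.prems]])
    note frk = uniform_Ck_frechet_single[OF open_UNIV Suc.prems]
    have DFg: "uniform_Ck k ?B ((\<lambda>f z. f (z, g z)) ` (\<lambda>v p. ?DF p v) ` {v. norm v \<le> 1})"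
      by (rule uniform_Ck_comp_graph[OF frk(3) gk]) auto
    have Jk: "uniform_Ck k ?B ((\<lambda>c z. J z c) ` {c. norm c \<le> 1})"
      unfolding J_def
      by (rule uniform_Ck_mono[OF DFg], unfold image_image, rule image_subsetI)
        (rule_tac x = "(0, x)" in image_eqI, auto simp: norm_Pair)
    have "uniform_Ck k ?B ((\<lambda>v z. ?DF (z, g z) (v, 0)) ` {v. norm v \<le> 1})"
      by (rule uniform_Ck_mono[OF DFg], unfold image_image, rule image_subsetI)
        (rule_tac x = "(x, 0)" in image_eqI, auto simp: norm_Pair)
    from uniform_Ck_minus_image[OF this]
    have "uniform_Ck k ?B ((\<lambda>v z. J z (Dg z v)) ` {v. norm v \<le> 1})"
      by (rule uniform_Ck_cong[OF open_ball, rotated]) (simp add: JDg)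
    then have "uniform_Ck k ?B ((\<lambda>y z. J z (y z)) ` (\<lambda>v z. Dg z v) ` {v. norm v \<le> 1})"
      by (simp only: image_image)
    from uniform_Ck_linear_solve[OF open_ball Jlin _ Jlow Jk this] m(1)
    have Dgk: "uniform_Ck k ?B ((\<lambda>v z. Dg z v) ` {v. norm v \<le> 1})" by simp
    have "uniform_Ck (Suc k) ?B ((\<lambda>_. g) ` {()})"
    proof (rule uniform_Ck_Suc_I[OF gUC0])
      fix z assume z: "z \<in> ?B"
      show "linear (Dg z)"
      proof -
        have "linear (\<lambda>v. ?DF (z, g z) (v, 0))"
        proof (rule linearI)
          fix a b show "?DF (z, g z) (a + b, 0) = ?DF (z, g z) (a, 0) + ?DF (z, g z) (b, 0)"
            using linear_add[OF lin, of "(z, g z)" "(a, 0)" "(b, 0)"] by simp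
        next
          fix c a show "?DF (z, g z) (c *\<^sub>R a, 0) = c *\<^sub>R ?DF (z, g z) (a, 0)"
            using linear_scale[OF lin, of "(z, g z)" c "(a, 0)"] by simp
        qed
        then have "linear (\<lambda>v. - ?DF (z, g z) (v, 0))" by (rule linear_compose_neg)
        from linear_compose[OF this inj_linear_imp_inv_linear[OF Jlin Jinj[OF z]]]
        show ?thesis unfolding Dg_def by (simp add: o_def)
      qed
      fix e' :: real assume e': "e' > 0"
      define e1 where "e1 = 1 / (2 * m) * e' / (1 + L)"
      have e1: "e1 > 0" "e1 * (1 + L) = 1 / (2 * m) * e'" using e' m(1) L by (auto simp: e1_def)
      have "((\<lambda>h. g (z + h) - g z) \<longlongrightarrow> 0) (nhds 0)" by (rule uniform_Ck_filterlim[OF gk z])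
      then have lim: "filterlim (\<lambda>h. (h, g (z + h) - g z)) (nhds 0) (nhds 0)"
        using tendsto_Pair[OF filterlim_ident] by (fastforce simp: zero_prod_def)
      from eventually_compose_filterlim[OF fr(2)[OF UNIV_I e1(1), of "(z, g z)"] lim] glip_ev[OF z] nh[OF z]
      show "\<forall>\<^sub>F h in nhds 0. \<forall>i\<in>{()}. norm (g (z + h) - g z - Dg z h) \<le> e' * norm h"
      proof eventually_elim
        case (elim h)
        let ?H = "(h, g (z + h) - g z)"
        have "J z (g (z + h) - g z - Dg z h) = ?DF (z, g z) (0, g (z + h) - g z) + ?DF (z, g z) (h, 0)"
          unfolding linear_diff[OF Jlin, of z "g (z + h) - g z" "Dg z h"] JDg[OF z] by (simp add: J_def)
        also have "\<dots> = ?DF (z, g z) ?H" using linear_add[OF lin, of "(z, g z)" "(0, g (z + h) - g z)" "(h, 0)"] by simp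
        finally have "norm (J z (g (z + h) - g z - Dg z h)) \<le> e1 * norm ?H"
          using elim(1) g(2)[OF elim(3)] g(2)[OF z] by simp
        also have "\<dots> \<le> e1 * ((1 + L) * norm h)"
          using e1(1) elim(2) order_trans[OF norm_Pair_le[of h "g (z + h) - g z"]]
          by (intro mult_left_mono) (auto simp: algebra_simps)
        also have "\<dots> = 1 / (2 * m) * (e' * norm h)" using e1(2) by (simp only: mult.assoc[symmetric])
        finally have "1 / (2 * m) * norm (g (z + h) - g z - Dg z h) \<le> 1 / (2 * m) * (e' * norm h)"
          using Jlow[OF z, of "g (z + h) - g z - Dg z h"] by linarith
        then have "norm (g (z + h) - g z - Dg z h) \<le> e' * norm h"
          by (rule mult_left_le_imp_le) (use m(1) in simp)
        then show ?case by simp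
      qed
    next
      show "uniform_Ck k ?B {\<lambda>z. Dg z v |(i::unit) v. i \<in> {()} \<and> norm v \<le> 1}"
        by (rule uniform_Ck_mono[OF Dgk]) auto
    qed
    then show ?case by simp
  qed
  show ?thesis
    by (rule that[of r L g]) (use r(1) L g0 g(2) glip[OF _ z0] gUC in auto)
qed

section \<open>Translates in \<open>L\<^sup>2\<close> and duality\<close>

lemma space_torus_measure [simp]: "space torus_measure = UNIV"
  and sets_torus_measure [simp, measurable_cong]: "sets torus_measure = sets borel"
  by (simp_all add: torus_measure_def)

lemma to_torus_measurable [measurable]: "to_torus \<in> borel_measurable (restrict_space lborel A)"
  by (rule measurable_restrict_space1) (simp add: borel_measurable_continuous_onI continuous_to_torus)

lemma emeasure_torus_measure: "emeasure torus_measure UNIV = 1"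
  unfolding torus_measure_def
  by (subst emeasure_distr) (auto simp: space_restrict_space emeasure_restrict_space)

interpretation torus_measure: finite_measure torus_measure
  by standard (simp add: emeasure_torus_measure)

lemma measure_torus_measure: "measure torus_measure UNIV = 1"
  by (simp add: measure_def emeasure_torus_measure)

lemma continuous_torus_bounded:
  fixes f :: "torus \<Rightarrow> real"
  assumes "continuous_on UNIV f"
  obtains B where "B \<ge> 0" "\<And>t. \<bar>f t\<bar> \<le> B"
proof -
  have "bounded (range f)"
    by (rule compact_imp_bounded[OF compact_continuous_image[OF assms compact_torus]])
  then obtain B where "\<And>t. \<bar>f t\<bar> \<le> B" by (auto simp: bounded_iff)
  then show ?thesis using that[of "\<bar>B\<bar>"] by (metis abs_ge_self abs_ge_zero order_trans)
qed

lemma continuous_torus_bcontfun: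
  fixes f :: "torus \<Rightarrow> real"
  assumes "continuous_on UNIV f"
  shows "f \<in> bcontfun"
proof -
  obtain B where "B \<ge> 0" "\<And>t. \<bar>f t\<bar> \<le> B" using that by (rule continuous_torus_bounded[OF assms])
  then show ?thesis by (intro bcontfun_normI[OF assms]) auto
qed

lemma apply_Bcontfun_torus:
  fixes f :: "torus \<Rightarrow> real"
  assumes "continuous_on UNIV f"
  shows "apply_bcontfun (Bcontfun f) = f"
  using Bcontfun_inverse[OF continuous_torus_bcontfun[OF assms]] .

lemma dist_torus_add_right [simp]: "dist (a + c) (b + c) = dist a (b :: torus)"
  by transfer simp
lemma dist_torus_add_left [simp]: "dist (c + a) (c + b) = dist a (b :: torus)"
  by transfer simp
lemma dist_torus_diff_right [simp]: "dist (a - c) (b - c) = dist a (b :: torus)"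
  by transfer simp
lemma dist_torus_diff_left [simp]: "dist (c - a) (c - b) = dist a (b :: torus)"
proof -
  have "dist (c - a) (c - b) = dist b a" by transfer (simp add: algebra_simps)
  then show ?thesis by (simp add: dist_commute)
qed

lemma continuous_on_torus_diff_left:
  assumes "continuous_on UNIV f" shows "continuous_on UNIV (\<lambda>s. f (t - s :: torus))"
  by (rule continuous_on_compose2[OF assms]) (auto simp: continuous_on_iff)

lemma continuous_on_torus_diff_right:
  assumes "continuous_on UNIV f" shows "continuous_on UNIV (\<lambda>s. f (s - t :: torus))"
  by (rule continuous_on_compose2[OF assms]) (auto simp: continuous_on_iff)

lemma uniformly_continuous_torus:
  fixes f :: "torus \<Rightarrow> real"
  assumes "continuous_on UNIV f" "e > 0"
  obtains d where "d > 0" "\<And>x y. dist x y < d \<Longrightarrow> \<bar>f x - f y\<bar> < e"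
  using compact_uniformly_continuous[OF assms(1) compact_torus] assms(2)
  unfolding uniformly_continuous_on_def dist_real_def by (metis UNIV_I)

lemma to_torus_add: "to_torus (a + b) = to_torus a + to_torus b"
  by transfer simp
lemma to_torus_0 [simp]: "to_torus 0 = 0"
  by transfer simp

lemma l2_rel_refl: "l2_rel f f \<longleftrightarrow> square_integrable f"
  by (simp add: l2_rel_def)

lemma square_integrable_continuous:
  assumes "continuous_on UNIV f"
  shows "square_integrable f"
proof -
  obtain B where B: "B \<ge> 0" "\<And>t. \<bar>f t\<bar> \<le> B" using that by (rule continuous_torus_bounded[OF assms])
  have m: "f \<in> borel_measurable torus_measure"
    using borel_measurable_continuous_onI[OF assms] by (simp add: measurable_def)
  have "integrable torus_measure (\<lambda>t. (f t)\<^sup>2)"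
  proof (rule torus_measure.integrable_const_bound[where B = "B\<^sup>2"])
    show "AE t in torus_measure. norm ((f t)\<^sup>2) \<le> B\<^sup>2"
      using B by (intro AE_I2) (simp add: abs_le_square_iff[symmetric])
  qed (use m in simp)
  with m show ?thesis by (simp add: square_integrable_def)
qed

lemma square_integrable_rep_l2: "square_integrable (rep_l2 p)"
  using Quotient3_rep_reflp[OF Quotient3_l2, of p] by (simp add: l2_rel_refl)

lemma abs_rep_l2: "abs_l2 (rep_l2 p) = p"
  by (rule Quotient3_abs_rep[OF Quotient3_l2])

lemma inner_abs_l2:
  assumes "square_integrable f" "square_integrable g"
  shows "inner (abs_l2 f) (abs_l2 g) = (\<integral>t. f t * g t \<partial>torus_measure)"
  using assms by (simp add: inner_l2.abs_eq l2_rel_refl)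

text \<open>The torus has total mass 1, so a pointwise bound is an L2 bound with the same
  constant.\<close>

lemma norm_abs_l2_le:
  assumes "continuous_on UNIV f" "\<And>t. \<bar>f t\<bar> \<le> B"
  shows "norm (abs_l2 f) \<le> B"
proof -
  have B: "B \<ge> 0" using assms(2)[of 0] by linarith
  note sq = square_integrable_continuous[OF assms(1)]
  have "(norm (abs_l2 f))\<^sup>2 = (\<integral>t. f t * f t \<partial>torus_measure)"
    by (simp add: power2_norm_eq_inner inner_abs_l2[OF sq sq])
  also have "\<dots> \<le> (\<integral>t. B\<^sup>2 \<partial>torus_measure)"
  proof (rule integral_mono)
    show "integrable torus_measure (\<lambda>t. f t * f t)" by (rule square_integrable_mult[OF sq sq])
    show "f t * f t \<le> B\<^sup>2" for t
      using assms(2)[of t] B by (simp add: power2_eq_square[symmetric] abs_le_square_iff[symmetric])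
  qed auto
  also have "\<dots> = B\<^sup>2" by (simp add: measure_torus_measure)
  finally show ?thesis using B by (rule power2_le_imp_le)
qed

text \<open>This is the vector Phi delta_t. Pairing it with \<open>p\<close> evaluates the dual
  function Phi^* p at \<open>t\<close>, so values and derivatives of certificates are read off from
  a curve in L2.\<close>

definition shift_l2 :: "(torus \<Rightarrow> real) \<Rightarrow> torus \<Rightarrow> l2" where
  "shift_l2 f t = abs_l2 (\<lambda>s. f (t - s))"

lemma square_integrable_shift: "continuous_on UNIV f \<Longrightarrow> square_integrable (\<lambda>s. f (t - s))"
  by (intro square_integrable_continuous continuous_on_torus_diff_left)

text \<open>One estimate for two uses: \<open>c = 0\<close> bounds increments of the curve of
  translates, \<open>c\<close> equal to the real step bounds its first order remainder.\<close>

lemma shift_l2_linear_combination_le: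
  assumes "continuous_on UNIV f" "continuous_on UNIV g"
    and "\<And>s. \<bar>f (t + h - s) - f (t - s) - c * g (t - s)\<bar> \<le> B"
  shows "norm (shift_l2 f (t + h) - shift_l2 f t - c *\<^sub>R shift_l2 g t) \<le> B"
proof -
  have "shift_l2 f (t + h) - shift_l2 f t - c *\<^sub>R shift_l2 g t =
      abs_l2 (\<lambda>s. f (t + h - s) - f (t - s) - c * g (t - s))"
    unfolding shift_l2_def using assms
    by (simp add: minus_l2.abs_eq scaleR_l2.abs_eq l2_rel_refl square_integrable_shift
        square_integrable_diff square_integrable_scale)
  also have "norm \<dots> \<le> B"
    by (rule norm_abs_l2_le)
      (intro continuous_intros continuous_on_torus_diff_left assms, rule assms(3))
  finally show ?thesis .
qed

lemma norm_shift_l2_le: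
  assumes "continuous_on UNIV f" "\<And>t. \<bar>f t\<bar> \<le> B"
  shows "norm (shift_l2 f t) \<le> B"
  unfolding shift_l2_def by (intro norm_abs_l2_le continuous_on_torus_diff_left assms)

lemma norm_shift_l2_diff_le:
  assumes "continuous_on UNIV f" "\<And>s. \<bar>f (t - s) - f (t' - s)\<bar> \<le> B"
  shows "norm (shift_l2 f t - shift_l2 f t') \<le> B"
proof -
  have "norm (shift_l2 f (t' + (t - t')) - shift_l2 f t' - 0 *\<^sub>R shift_l2 f t') \<le> B"
    by (rule shift_l2_linear_combination_le[OF assms(1) assms(1)]) (use assms(2) in simp)
  then show ?thesis by simp
qed

lemma continuous_on_shift_l2:
  assumes "continuous_on UNIV f"
  shows "continuous_on UNIV (shift_l2 f)"
  unfolding continuous_on_iff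
proof (intro ballI allI impI)
  fix t and e :: real assume e: "e > 0"
  then have "e/2 > 0" by simp
  then obtain d where d: "d > 0" "\<And>x y. dist x y < d \<Longrightarrow> \<bar>f x - f y\<bar> < e/2"
    using uniformly_continuous_torus[OF assms] by metis
  have "dist (shift_l2 f t') (shift_l2 f t) < e" if "dist t' t < d" for t'
  proof -
    have "norm (shift_l2 f t' - shift_l2 f t) \<le> e/2"
    proof (rule norm_shift_l2_diff_le[OF assms])
      fix s have "dist (t' - s) (t - s) < d" using that by simp
      then show "\<bar>f (t' - s) - f (t - s)\<bar> \<le> e/2" using d(2) less_imp_le by blast
    qed
    then show ?thesis using e by (simp add: dist_norm)
  qed
  then show "\<exists>d>0. \<forall>t'\<in>UNIV. dist t' t < d \<longrightarrow> dist (shift_l2 f t') (shift_l2 f t) < e"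
    using d(1) by blast
qed

lemma inner_shift_l2:
  assumes "continuous_on UNIV f"
  shows "inner (shift_l2 f t) p = (\<integral>s. f (t - s) * rep_l2 p s \<partial>torus_measure)"
  unfolding shift_l2_def
  by (subst (1) abs_rep_l2[of p, symmetric], rule inner_abs_l2)
    (intro square_integrable_shift assms square_integrable_rep_l2)+

lemma apply_adjoint_forward:
  assumes "continuous_on UNIV f"
  shows "apply_bcontfun (adjoint_forward f p) t = inner (shift_l2 f t) p"
proof -
  have "continuous_on UNIV (\<lambda>t. inner (shift_l2 f t) p)"
    by (intro continuous_intros continuous_on_shift_l2 assms)
  then show ?thesis unfolding adjoint_forward_def
    by (simp add: inner_shift_l2[OF assms, symmetric] apply_Bcontfun_torus)
qed

lemma abs_l2_sum:
  assumes "finite A" "\<And>i. i \<in> A \<Longrightarrow> square_integrable (f i)"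
  shows "(\<Sum>i\<in>A. c i *\<^sub>R abs_l2 (f i)) = abs_l2 (\<lambda>t. \<Sum>i\<in>A. c i * f i t) \<and>
    square_integrable (\<lambda>t. \<Sum>i\<in>A. c i * f i t)"
  using assms
proof (induction A)
  case empty
  then show ?case by (simp add: zero_l2_def square_integrable_zero)
next
  case (insert i A)
  then show ?case
    by (simp add: scaleR_l2.abs_eq plus_l2.abs_eq l2_rel_refl square_integrable_scale square_integrable_add)
qed

lemma spikes_apply: "blinfun_apply (spikes a x) \<psi> = (\<Sum>i\<in>UNIV. a $ i * apply_bcontfun \<psi> (x $ i))"
  by (simp add: spikes_def blinfun.sum_left blinfun.scaleR_left dirac_apply)

lemma forward_spikes:
  assumes "continuous_on UNIV f"
  shows "forward f (spikes a x) = (\<Sum>i\<in>UNIV. a $ i *\<^sub>R shift_l2 f (x $ i))"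
  unfolding forward_def spikes_apply shift_l2_def
  using abs_l2_sum[of UNIV "\<lambda>i s. f (x $ i - s)" "\<lambda>i. a $ i"]
  by (simp add: apply_Bcontfun_torus continuous_on_torus_diff_right square_integrable_shift assms)

lemma Gamma_map_shift_l2:
  "Gamma_map f x (u, v) = (\<Sum>i\<in>UNIV. u $ i *\<^sub>R shift_l2 f (x $ i)) + (\<Sum>i\<in>UNIV. v $ i *\<^sub>R shift_l2 (tderiv f) (x $ i))"
  by (simp add: Gamma_map_def shift_l2_def)


section \<open>Integrals over the torus and the duality of the forward operator with its
  adjoint\<close>

lemma integral_torus_measure:
  fixes f :: "torus \<Rightarrow> real"
  assumes "f \<in> borel_measurable torus_measure"
  shows "(\<integral>t. f t \<partial>torus_measure) = (\<integral>r. f (to_torus r) \<partial>restrict_space lborel {0..<1})"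
  unfolding torus_measure_def
  by (rule integral_distr) (use assms in \<open>simp_all cong: measurable_cong_sets add: torus_measure_def\<close>)

lemma integrable_torus_measure:
  fixes f :: "torus \<Rightarrow> real"
  assumes "f \<in> borel_measurable torus_measure"
  shows "integrable torus_measure f \<longleftrightarrow> integrable (restrict_space lborel {0..<1}) (\<lambda>r. f (to_torus r))"
  unfolding torus_measure_def
  by (rule integrable_distr_eq) (use assms in \<open>simp_all cong: measurable_cong_sets add: torus_measure_def\<close>)

text \<open>\<open>ind k\<close> cuts the unit interval into cells of length 1/n, and
  \<open>G\<close> is frozen at the left end of each. The weights, integrals of \<open>q\<close>
  over the cells, do not depend on \<open>G\<close>, so a single discretisation serves all
  translates of a kernel at once.\<close>

lemma integral_step_approx:
  fixes G :: "torus \<Rightarrow> real" and q :: "real \<Rightarrow> real" and n :: nat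
  defines "M \<equiv> restrict_space lborel {0..<1 :: real}"
  defines "ind \<equiv> \<lambda>k r. (indicator {r. \<lfloor>real n * r\<rfloor> = int k} r :: real)"
  assumes n: "n > 0" and q: "integrable M q" and G: "continuous_on UNIV G"
    and ap: "\<And>s t. dist s t \<le> 1 / n \<Longrightarrow> \<bar>G s - G t\<bar> \<le> e"
  shows "\<bar>(\<integral>r. G (to_torus r) * q r \<partial>M) - (\<Sum>k<n. G (to_torus (k / n)) * (\<integral>r. ind k r * q r \<partial>M))\<bar>
      \<le> e * (\<integral>r. \<bar>q r\<bar> \<partial>M)"
proof -
  have chi_meas [measurable]: "ind k \<in> borel_measurable M" for k
    unfolding ind_def M_def by (rule measurable_restrict_space1) measurable
  have qm [measurable]: "q \<in> borel_measurable M" using q by auto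
  have Gm: "(\<lambda>r. G (to_torus r)) \<in> borel_measurable M"
    unfolding M_def by (rule measurable_restrict_space1)
      (simp, intro borel_measurable_continuous_onI continuous_on_compose2[OF G continuous_to_torus], simp)
  obtain B where B: "B \<ge> 0" "\<And>t. \<bar>G t\<bar> \<le> B"
    using that by (rule continuous_torus_bounded[OF G])
  have iq: "integrable M (\<lambda>r. f r * q r)" if f: "f \<in> borel_measurable M" "\<And>r. \<bar>f r\<bar> \<le> C" for f C
  proof (rule Bochner_Integration.integrable_bound[of M "\<lambda>r. C * q r"])
    show "integrable M (\<lambda>r. C * q r)" using q by simp
    show "(\<lambda>r. f r * q r) \<in> borel_measurable M" using f(1) qm by simp
    have "C \<ge> 0" using f(2)[of 0] by linarith
    then show "AE r in M. norm (f r * q r) \<le> norm (C * q r)"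
      using f(2) by (intro AE_I2) (simp add: abs_mult mult_right_mono)
  qed
  have chi1: "\<bar>ind k r\<bar> \<le> 1" for k r by (simp add: ind_def indicator_def)
  have int_chi: "integrable M (\<lambda>r. ind k r * q r)" for k by (rule iq[OF chi_meas chi1])
  have int_G: "integrable M (\<lambda>r. G (to_torus r) * q r)" by (rule iq[OF Gm B(2)])
  have sum_chi: "(\<Sum>k<n. c k * ind k r) = c (nat \<lfloor>real n * r\<rfloor>)" if r: "0 \<le> r" "r < 1" for r and c :: "nat \<Rightarrow> real"
  proof -
    have "real n * r < real n" using n r by simp
    then have "\<lfloor>real n * r\<rfloor> < int n" by (simp add: floor_less_iff)
    moreover have fl: "0 \<le> \<lfloor>real n * r\<rfloor>" using r by simp
    ultimately have "nat \<lfloor>real n * r\<rfloor> < n" by linarith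
    moreover have "c k * ind k r = (if k = nat \<lfloor>real n * r\<rfloor> then c k else 0)" for k
      using fl by (auto simp: ind_def)
    ultimately show ?thesis by simp
  qed
  have near: "\<bar>G (to_torus r) - (\<Sum>k<n. G (to_torus (k / n)) * ind k r)\<bar> \<le> e" if r: "0 \<le> r" "r < 1" for r
  proof -
    let ?k = "\<lfloor>real n * r\<rfloor>"
    have fl: "0 \<le> ?k" using r by simp
    have "\<bar>real n * r - of_int ?k\<bar> \<le> 1" by linarith
    then have "\<bar>real n * r - of_int ?k\<bar> / n \<le> 1 / n" by (rule divide_right_mono) simp
    also have "\<bar>real n * r - of_int ?k\<bar> / n = \<bar>r - real (nat ?k) / n\<bar>"
    proof -
      have "r - real (nat ?k) / n = (real n * r - of_int ?k) / n" using fl n by (simp add: field_simps)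
      then show ?thesis by (simp only: abs_divide abs_of_nat)
    qed
    finally have "dist (to_torus r) (to_torus (real (nat ?k) / n)) \<le> 1 / n"
      using dist_to_torus_le order_trans by blast
    from ap[OF this] show ?thesis by (simp add: sum_chi[OF r, where c = "\<lambda>k. G (to_torus (k / n))"])
  qed
  have "(\<integral>r. G (to_torus r) * q r \<partial>M) - (\<Sum>k<n. G (to_torus (k / n)) * (\<integral>r. ind k r * q r \<partial>M)) =
      (\<integral>r. (G (to_torus r) - (\<Sum>k<n. G (to_torus (k / n)) * ind k r)) * q r \<partial>M)"
    using int_G int_chi by (simp add: left_diff_distrib sum_distrib_right mult.assoc
        Bochner_Integration.integral_diff Bochner_Integration.integral_sum)
  also have "\<bar>\<dots>\<bar> \<le> (\<integral>r. e * \<bar>q r\<bar> \<partial>M)"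
  proof (rule order_trans[OF integral_abs_bound integral_mono_AE])
    show "integrable M (\<lambda>r. \<bar>(G (to_torus r) - (\<Sum>k<n. G (to_torus (k / n)) * ind k r)) * q r\<bar>)"
      using int_G int_chi by (simp add: left_diff_distrib sum_distrib_right mult.assoc)
    show "AE r in M. \<bar>(G (to_torus r) - (\<Sum>k<n. G (to_torus (k / n)) * ind k r)) * q r\<bar> \<le> e * \<bar>q r\<bar>"
    proof (rule AE_I2)
      fix r assume "r \<in> space M"
      then have "0 \<le> r" "r < 1" by (auto simp: M_def space_restrict_space)
      from mult_right_mono[OF near[OF this], of "\<bar>q r\<bar>"]
      show "\<bar>(G (to_torus r) - (\<Sum>k<n. G (to_torus (k / n)) * ind k r)) * q r\<bar> \<le> e * \<bar>q r\<bar>"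
        by (simp add: abs_mult)
    qed
  qed (use q in simp)
  finally show ?thesis by simp
qed

lemma norm_bcontfun_le:
  fixes \<psi> :: "'a::topological_space \<Rightarrow>\<^sub>C real"
  assumes "\<And>x. \<bar>apply_bcontfun \<psi> x\<bar> \<le> B"
  shows "norm \<psi> \<le> B"
  by (rule norm_bound) (use assms in simp)

lemma abs_apply_bcontfun_le: "\<bar>apply_bcontfun \<psi> x\<bar> \<le> norm (\<psi> :: 'a::topological_space \<Rightarrow>\<^sub>C real)"
  using norm_bounded[of \<psi> x] by simp

lemma abs_blinfun_real_le: "\<bar>blinfun_apply m \<psi>\<bar> \<le> norm m * norm \<psi>" for m :: radon
  using norm_blinfun[of m \<psi>] by simp

text \<open>A translation moves the kernel by at most its modulus of continuity in the supremum
  norm, and \<open>m\<close> is bounded; the second part keeps this quantitative for the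
  discretisation error.\<close>

lemma continuous_forward_integrand:
  fixes m :: radon
  assumes f: "continuous_on UNIV f"
  shows "continuous_on UNIV (\<lambda>t. blinfun_apply m (Bcontfun (\<lambda>x. f (x - t))))"
    and "\<And>s t e. (\<And>x y. dist x y \<le> dist s t \<Longrightarrow> \<bar>f x - f y\<bar> \<le> e) \<Longrightarrow>
      \<bar>blinfun_apply m (Bcontfun (\<lambda>x. f (x - s))) - blinfun_apply m (Bcontfun (\<lambda>x. f (x - t)))\<bar> \<le> norm m * e"
proof -
  have *: "\<bar>blinfun_apply m (Bcontfun (\<lambda>x. f (x - s))) - blinfun_apply m (Bcontfun (\<lambda>x. f (x - t)))\<bar> \<le> norm m * e"
    if "\<And>x y. dist x y \<le> dist s t \<Longrightarrow> \<bar>f x - f y\<bar> \<le> e" for s t e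
  proof -
    have "norm (Bcontfun (\<lambda>x. f (x - s)) - Bcontfun (\<lambda>x. f (x - t))) \<le> e"
      using that by (intro norm_bcontfun_le)
        (simp add: minus_bcontfun.rep_eq apply_Bcontfun_torus continuous_on_torus_diff_right f)
    then have "norm m * norm (Bcontfun (\<lambda>x. f (x - s)) - Bcontfun (\<lambda>x. f (x - t))) \<le> norm m * e"
      by (rule mult_left_mono) simp
    then show ?thesis using abs_blinfun_real_le[of m "Bcontfun (\<lambda>x. f (x - s)) - Bcontfun (\<lambda>x. f (x - t))"]
      by (simp add: blinfun.diff_right)
  qed
  then show "\<And>s t e. (\<And>x y. dist x y \<le> dist s t \<Longrightarrow> \<bar>f x - f y\<bar> \<le> e) \<Longrightarrow>
      \<bar>blinfun_apply m (Bcontfun (\<lambda>x. f (x - s))) - blinfun_apply m (Bcontfun (\<lambda>x. f (x - t)))\<bar> \<le> norm m * e" .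
  show "continuous_on UNIV (\<lambda>t. blinfun_apply m (Bcontfun (\<lambda>x. f (x - t))))"
    unfolding continuous_on_iff
  proof (intro ballI allI impI)
    fix t and e :: real assume e: "e > 0"
    define e' where "e' = e / (norm m + 1)"
    have "norm m + 1 > 0" by (simp add: add_nonneg_pos)
    then have e': "e' > 0" "norm m * e' < e"
      using e by (simp_all add: e'_def pos_divide_less_eq distrib_left mult.commute)
    obtain d where d: "d > 0" "\<And>x y. dist x y < d \<Longrightarrow> \<bar>f x - f y\<bar> < e'"
      using that by (rule uniformly_continuous_torus[OF f e'(1)])
    have "dist (blinfun_apply m (Bcontfun (\<lambda>x. f (x - s)))) (blinfun_apply m (Bcontfun (\<lambda>x. f (x - t)))) < e"
      if "dist s t < d" for s
      using *[of s t e'] d(2) that e'(2) by (fastforce simp: dist_real_def intro: less_imp_le)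
    then show "\<exists>d>0. \<forall>s\<in>UNIV. dist s t < d \<longrightarrow>
        dist (blinfun_apply m (Bcontfun (\<lambda>x. f (x - s)))) (blinfun_apply m (Bcontfun (\<lambda>x. f (x - t)))) < e"
      using d(1) by blast
  qed
qed

text \<open>For a functional \<open>m\<close> this is an interchange with the integral over the torus; it is obtained from
  Riemann sums in the kernel, uniformly in its first variable.\<close>

lemma inner_forward:
  fixes m :: radon
  assumes f: "continuous_on UNIV f"
  shows "inner (forward f m) p = blinfun_apply m (adjoint_forward f p)"
proof -
  define M where "M = restrict_space lborel {0..<1 :: real}"
  define q where "q r = rep_l2 p (to_torus r)" for r
  define F where "F t = blinfun_apply m (Bcontfun (\<lambda>x. f (x - t)))" for t
  note contF = continuous_forward_integrand(1)[OF f, of m, folded F_def]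
  have sqp: "square_integrable (rep_l2 p)" by (rule square_integrable_rep_l2)
  have pm: "rep_l2 p \<in> borel_measurable torus_measure" using sqp by (simp add: square_integrable_def)
  have meas: "G \<in> borel_measurable torus_measure" if "continuous_on UNIV G" for G :: "torus \<Rightarrow> real"
    using square_integrable_continuous[OF that] by (simp add: square_integrable_def)
  have "integrable torus_measure (\<lambda>t. 1 * rep_l2 p t)"
    by (rule square_integrable_mult[OF square_integrable_continuous sqp]) simp
  then have qint: "integrable M q"
    using integrable_torus_measure[OF pm] by (simp add: M_def q_def[abs_def])
  define I where "I = (\<integral>r. \<bar>q r\<bar> \<partial>M)"
  have I: "I \<ge> 0" unfolding I_def by (rule Bochner_Integration.integral_nonneg) simp
  have inner_eq: "inner (forward f m) p = (\<integral>r. F (to_torus r) * q r \<partial>M)"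
  proof -
    have "inner (forward f m) p = (\<integral>t. F t * rep_l2 p t \<partial>torus_measure)"
      unfolding forward_def F_def[symmetric]
      by (subst (1) abs_rep_l2[of p, symmetric], rule inner_abs_l2)
        (rule square_integrable_continuous[OF contF], rule sqp)
    also have "\<dots> = (\<integral>r. F (to_torus r) * q r \<partial>M)"
      unfolding M_def q_def by (rule integral_torus_measure) (use meas[OF contF] pm in simp)
    finally show ?thesis .
  qed
  have adj_eq: "apply_bcontfun (adjoint_forward f p) x = (\<integral>r. f (x - to_torus r) * q r \<partial>M)" for x
    unfolding apply_adjoint_forward[OF f] inner_shift_l2[OF f] M_def q_def
    by (rule integral_torus_measure) (use meas[OF continuous_on_torus_diff_left[OF f]] pm in simp)
  have main: "\<bar>inner (forward f m) p - blinfun_apply m (adjoint_forward f p)\<bar> \<le> 2 * norm m * I * e" if e: "e > 0" for e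
  proof -
    obtain d where d: "d > 0" "\<And>x y. dist x y < d \<Longrightarrow> \<bar>f x - f y\<bar> < e"
      using that by (rule uniformly_continuous_torus[OF f e])
    obtain n where n: "n > 0" "1 / real n < d"
      using reals_Archimedean[OF d(1)] by (metis inverse_eq_divide zero_less_Suc)
    have fe: "\<bar>f x - f y\<bar> \<le> e" if "dist x y \<le> 1 / n" for x y
      using d(2)[of x y] that n(2) by simp
    \<comment> \<open>Both Riemann sums use these weights. Hence \<open>m\<close> applied to the
      discretised adjoint is the discretised pairing, and each of the two errors is at most
      \<open>norm m * e * I\<close>.\<close>
    define w where "w k = (\<integral>r. indicator {r. \<lfloor>real n * r\<rfloor> = int k} r * q r \<partial>M)" for k
    have 1: "\<bar>(\<integral>r. F (to_torus r) * q r \<partial>M) - (\<Sum>k<n. F (to_torus (k / n)) * w k)\<bar> \<le> norm m * e * I"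
      unfolding M_def I_def w_def
    proof (rule integral_step_approx[OF n(1) qint[unfolded M_def] contF])
      fix s t :: torus assume "dist s t \<le> 1 / n"
      then show "\<bar>F s - F t\<bar> \<le> norm m * e" unfolding F_def
        by (intro continuous_forward_integrand(2)[OF f] fe) simp
    qed
    have 2: "\<bar>apply_bcontfun (adjoint_forward f p) x - (\<Sum>k<n. f (x - to_torus (k / n)) * w k)\<bar> \<le> e * I" for x
      unfolding adj_eq M_def I_def w_def
      by (rule integral_step_approx[OF n(1) qint[unfolded M_def] continuous_on_torus_diff_left[OF f]])
        (rule fe, simp)
    let ?S = "\<Sum>k<n. w k *\<^sub>R Bcontfun (\<lambda>x. f (x - to_torus (k / n)))"
    have S: "apply_bcontfun ?S x = (\<Sum>k<n. f (x - to_torus (k / n)) * w k)" for x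
    proof -
      have "apply_bcontfun (\<Sum>k\<in>A. g k) x = (\<Sum>k\<in>A. apply_bcontfun (g k) x)" for A :: "nat set" and g :: "nat \<Rightarrow> torus \<Rightarrow>\<^sub>C real"
        by (induction A rule: infinite_finite_induct) (auto simp: plus_bcontfun.rep_eq zero_bcontfun.rep_eq)
      then show ?thesis
        by (simp add: scaleR_bcontfun.rep_eq apply_Bcontfun_torus continuous_on_torus_diff_right f mult.commute)
    qed
    have "norm (adjoint_forward f p - ?S) \<le> e * I"
      by (rule norm_bcontfun_le) (simp only: minus_bcontfun.rep_eq S 2)
    then have "norm m * norm (adjoint_forward f p - ?S) \<le> norm m * (e * I)" by (rule mult_left_mono) simp
    then have "\<bar>blinfun_apply m (adjoint_forward f p - ?S)\<bar> \<le> norm m * (e * I)"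
      using abs_blinfun_real_le order_trans by blast
    moreover have "blinfun_apply m ?S = (\<Sum>k<n. F (to_torus (k / n)) * w k)"
      by (simp add: blinfun.sum_right blinfun.scaleR_right F_def mult.commute)
    ultimately have 3: "\<bar>blinfun_apply m (adjoint_forward f p) - (\<Sum>k<n. F (to_torus (k / n)) * w k)\<bar> \<le> norm m * e * I"
      by (simp add: blinfun.diff_right mult.assoc)
    have "2 * norm m * I * e = norm m * e * I + norm m * e * I" by simp
    then show ?thesis using 1 3 unfolding inner_eq by linarith
  qed
  show ?thesis
  proof (rule ccontr)
    assume "\<not> ?thesis"
    then have pos: "\<bar>inner (forward f m) p - blinfun_apply m (adjoint_forward f p)\<bar> > 0" (is "?x > 0") by simp
    define e where "e = ?x / 2 / (2 * norm m * I + 1)"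
    have "2 * norm m * I + 1 > 0" using I by (simp add: add_nonneg_pos)
    then have e: "e > 0" "e * (2 * norm m * I + 1) = ?x / 2" 
      using pos by (simp add: e_def, unfold e_def, intro pos_divide_times_cancel)
    then have "2 * norm m * I * e < ?x" using pos by (simp add: algebra_simps)
    then show False using main[OF e(1)] by simp
  qed
qed

section \<open>Completeness of \<open>L\<^sup>2\<close> and minimal norm\<close>

text \<open>The Riesz-Fischer argument: along a subsequence with geometrically small steps the
  increments are summable almost everywhere, and Fatou's lemma identifies the pointwise limit as the
  limit in norm.\<close>

lemma l2_Cauchy_convergent:
  fixes X :: "nat \<Rightarrow> l2"
  assumes "Cauchy X"
  shows "convergent X"
proof -
  have "\<exists>M. \<forall>m\<ge>M. \<forall>n\<ge>M. dist (X m) (X n) < (1/2)^k" for k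
    using assms unfolding Cauchy_def by simp
  then obtain N where N: "\<And>k m n. m \<ge> N k \<Longrightarrow> n \<ge> N k \<Longrightarrow> dist (X m) (X n) < (1/2)^k"
    by metis
  \<comment> \<open>A sum instead of a further choice of indices: it dominates \<open>N j\<close>
    for every \<open>j\<close> up to \<open>k\<close>.\<close>
  define r where "r k = (\<Sum>i\<le>k. N i)" for k
  have r: "r k \<ge> N j" if "j \<le> k" for j k
    unfolding r_def by (rule member_le_sum) (use that in auto)
  define f where "f k = rep_l2 (X (r k))" for k
  have sq: "square_integrable (f k)" for k unfolding f_def by (rule square_integrable_rep_l2)
  have fm [measurable]: "f k \<in> borel_measurable torus_measure" for k
    using sq by (simp add: square_integrable_def)
  have absf: "abs_l2 (f k) = X (r k)" for k by (simp add: f_def abs_rep_l2)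
  have sqd: "square_integrable (\<lambda>t. f k t - f n t)" for k n
    by (rule square_integrable_diff[OF sq sq])
  have intd: "integrable torus_measure (\<lambda>t. (f k t - f n t)\<^sup>2)" for k n
    using sqd by (simp add: square_integrable_def)
  have norm_eq: "(norm (X (r k) - X (r n)))\<^sup>2 = (\<integral>t. (f k t - f n t)\<^sup>2 \<partial>torus_measure)" for k n
  proof -
    have "X (r k) - X (r n) = abs_l2 (\<lambda>t. f k t - f n t)"
      unfolding absf[symmetric] using sq by (simp add: minus_l2.abs_eq l2_rel_refl)
    then show ?thesis
      by (simp add: power2_norm_eq_inner inner_abs_l2[OF sqd sqd] power2_eq_square[symmetric])
  qed
  have close: "(\<integral>t. (f k t - f n t)\<^sup>2 \<partial>torus_measure) \<le> ((1/2)^n)\<^sup>2" if "n \<le> k" for k n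
  proof -
    have "norm (X (r k) - X (r n)) \<le> (1/2)^n"
      using N[OF r[OF that] r[OF order_refl]] by (simp add: dist_norm)
    then show ?thesis unfolding norm_eq[symmetric] by (rule power_mono) simp
  qed
  define d where "d k t = f (Suc k) t - f k t" for k t
  have dm [measurable]: "d k \<in> borel_measurable torus_measure" for k
    unfolding d_def[abs_def] by measurable
  have dint: "integrable torus_measure (\<lambda>t. \<bar>d k t\<bar>)" for k
    using square_integrable_mult[OF sqd square_integrable_continuous[of "\<lambda>_. 1"]]
    unfolding d_def by simp
  have d1: "(\<integral>t. \<bar>d k t\<bar> \<partial>torus_measure) \<le> (1/2)^k" for k
  proof -
    \<comment> \<open>The inequality of arithmetic and geometric means with weight 2^k bounds the L1
      norm of the increment by its squared L2 norm plus a summable constant.\<close>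
    have "(\<integral>t. \<bar>d k t\<bar> \<partial>torus_measure) \<le> (\<integral>t. (2^k * (d k t)\<^sup>2 + (1/2)^k) / 2 \<partial>torus_measure)"
    proof (rule integral_mono[OF dint])
      show "integrable torus_measure (\<lambda>t. (2^k * (d k t)\<^sup>2 + (1/2)^k) / 2)"
        using intd[of "Suc k" k] by (simp add: d_def)
      fix t
      have "0 \<le> (2^k * \<bar>d k t\<bar> - 1)\<^sup>2 / 2^k" by simp
      also have "\<dots> = 2^k * (d k t)\<^sup>2 + (1/2)^k - 2 * \<bar>d k t\<bar>"
        by (simp add: power2_diff field_simps power_one_over) (simp add: power2_eq_square)
      finally show "\<bar>d k t\<bar> \<le> (2^k * (d k t)\<^sup>2 + (1/2)^k) / 2" by simp
    qed
    also have "\<dots> = (2^k * (\<integral>t. (d k t)\<^sup>2 \<partial>torus_measure) + (1/2)^k) / 2"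
      using intd[of "Suc k" k] by (simp add: d_def measure_torus_measure)
    also have "\<dots> \<le> (2^k * ((1/2)^k)\<^sup>2 + (1/2)^k) / 2"
      using close[of k "Suc k"] by (simp add: d_def)
    also have "\<dots> = (1/2)^k" by (simp add: power2_eq_square power_one_over)
    finally show ?thesis .
  qed
  have "AE t in torus_measure. summable (\<lambda>k. \<bar>d k t\<bar>)"
  proof -
    have "(\<integral>\<^sup>+t. (\<Sum>k. ennreal \<bar>d k t\<bar>) \<partial>torus_measure) = (\<Sum>k. \<integral>\<^sup>+t. ennreal \<bar>d k t\<bar> \<partial>torus_measure)"
      by (rule nn_integral_suminf) measurable
    also have "\<dots> = (\<Sum>k. ennreal (\<integral>t. \<bar>d k t\<bar> \<partial>torus_measure))"
      by (intro suminf_cong nn_integral_eq_integral dint) simp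
    also have "\<dots> \<le> (\<Sum>k. ennreal ((1/2)^k))"
      by (intro suminf_le ennreal_leI d1) auto
    also have "\<dots> < \<infinity>"
      by (simp add: suminf_ennreal2 summable_geometric)
    finally have "(\<integral>\<^sup>+t. (\<Sum>k. ennreal \<bar>d k t\<bar>) \<partial>torus_measure) \<noteq> \<infinity>" by simp
    then have "AE t in torus_measure. (\<Sum>k. ennreal \<bar>d k t\<bar>) \<noteq> \<infinity>"
      by (intro nn_integral_PInf_AE) measurable
    then show ?thesis
      by eventually_elim (rule summable_suminf_not_top, auto)
  qed
  \<comment> \<open>\<open>lim\<close> is total, so \<open>g\<close> is defined and measurable
    everywhere; it is the limit of the sequence almost everywhere.\<close>
  define g where "g t = lim (\<lambda>k. f k t)" for t
  have gm [measurable]: "g \<in> borel_measurable torus_measure"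
    unfolding g_def[abs_def] by (rule borel_measurable_lim_metric) measurable
  have lim: "AE t in torus_measure. (\<lambda>k. f k t) \<longlonglongrightarrow> g t"
    using \<open>AE t in torus_measure. summable (\<lambda>k. \<bar>d k t\<bar>)\<close>
  proof eventually_elim
    case (elim t)
    then have "summable (\<lambda>k. f (Suc k) t - f k t)"
      unfolding d_def by (rule summable_rabs_cancel)
    then have "convergent (\<lambda>n. f 0 t + (\<Sum>k<n. f (Suc k) t - f k t))"
      unfolding summable_iff_convergent by (intro convergent_add convergent_const)
    moreover have "f 0 t + (\<Sum>k<n. f (Suc k) t - f k t) = f n t" for n
      using sum_lessThan_telescope[of "\<lambda>k. f k t" n] by simp
    ultimately have "convergent (\<lambda>k. f k t)" by (simp only:)
    then show ?case unfolding g_def convergent_LIMSEQ_iff .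
  qed
  \<comment> \<open>The distance from \<open>f n\<close> to later members of the subsequence passes
    to the limit; finiteness also gives square integrability of \<open>g\<close>.\<close>
  have fatou: "(\<integral>\<^sup>+t. ennreal ((g t - f n t)\<^sup>2) \<partial>torus_measure) \<le> ennreal (((1/2)^n)\<^sup>2)" for n
  proof -
    have "(\<integral>\<^sup>+t. ennreal ((g t - f n t)\<^sup>2) \<partial>torus_measure) =
        (\<integral>\<^sup>+t. liminf (\<lambda>k. ennreal ((f k t - f n t)\<^sup>2)) \<partial>torus_measure)"
    proof (rule nn_integral_cong_AE, use lim in eventually_elim)
      case (elim t)
      have "(\<lambda>k. ennreal ((f k t - f n t)\<^sup>2)) \<longlonglongrightarrow> ennreal ((g t - f n t)\<^sup>2)"
        by (intro tendsto_ennrealI tendsto_intros elim)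
      from lim_imp_Liminf[OF trivial_limit_sequentially this] show ?case by simp
    qed
    also have "\<dots> \<le> liminf (\<lambda>k. \<integral>\<^sup>+t. ennreal ((f k t - f n t)\<^sup>2) \<partial>torus_measure)"
      by (rule nn_integral_liminf) measurable
    also have "\<dots> \<le> ennreal (((1/2)^n)\<^sup>2)"
    proof (rule Liminf_le)
      show "\<forall>\<^sub>F k in sequentially. (\<integral>\<^sup>+t. ennreal ((f k t - f n t)\<^sup>2) \<partial>torus_measure) \<le> ennreal (((1/2)^n)\<^sup>2)"
        using eventually_ge_at_top[of n]
      proof eventually_elim
        case (elim k)
        show ?case
          by (subst nn_integral_eq_integral[OF intd]) (auto intro!: ennreal_leI close elim)
      qed
    qed simp
    finally show ?thesis .
  qed
  have sqg: "square_integrable (\<lambda>t. g t - f n t)" for n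
    unfolding square_integrable_def
  proof
    show "integrable torus_measure (\<lambda>t. (g t - f n t)\<^sup>2)"
      by (rule integrableI_bounded) (use le_less_trans[OF fatou[of n] ennreal_less_top] in \<open>simp_all\<close>)
  qed measurable
  have "square_integrable g" using square_integrable_add[OF sqg[of 0] sq[of 0]] by simp
  have conv: "norm (abs_l2 g - X (r n)) \<le> (1/2)^n" for n
  proof -
    have "abs_l2 g - X (r n) = abs_l2 (\<lambda>t. g t - f n t)"
      unfolding absf[symmetric] using sq \<open>square_integrable g\<close> by (simp add: minus_l2.abs_eq l2_rel_refl)
    then have "(norm (abs_l2 g - X (r n)))\<^sup>2 = (\<integral>t. (g t - f n t)\<^sup>2 \<partial>torus_measure)"
      by (simp add: power2_norm_eq_inner inner_abs_l2[OF sqg sqg] power2_eq_square[symmetric])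
    also have "\<dots> \<le> ((1/2)^n)\<^sup>2"
    proof -
      have "ennreal (\<integral>t. (g t - f n t)\<^sup>2 \<partial>torus_measure) \<le> ennreal (((1/2)^n)\<^sup>2)"
        using fatou[of n] by (subst nn_integral_eq_integral[symmetric]) (use sqg[of n] in \<open>auto simp: square_integrable_def\<close>)
      then show ?thesis by (subst (asm) ennreal_le_iff) auto
    qed
    finally show ?thesis by (rule power2_le_imp_le) simp
  qed
  have "X \<longlonglongrightarrow> abs_l2 g"
  proof (rule metric_LIMSEQ_I)
    fix e :: real assume "e > 0"
    then obtain k where k: "(1/2 :: real)^k < e / 2"
      using real_arch_pow_inv[of "e/2" "1/2"] by auto
    have "dist (X n) (abs_l2 g) < e" if "n \<ge> N k" for n
    proof -
      have "dist (X n) (X (r k)) < (1/2)^k" using N[OF that r[OF order_refl]] .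
      moreover have "dist (X (r k)) (abs_l2 g) \<le> (1/2)^k" using conv[of k] by (simp add: dist_norm norm_minus_commute)
      ultimately show ?thesis using dist_triangle[of "X n" "abs_l2 g" "X (r k)"] k by linarith
    qed
    then show "\<exists>no. \<forall>n\<ge>no. dist (X n) (abs_l2 g) < e" by blast
  qed
  then show ?thesis by (rule convergentI)
qed

instance l2 :: complete_space
  by standard (rule l2_Cauchy_convergent)

text \<open>By the parallelogram identity the midpoint of two nearly minimal points forces them
  together, which gives convergence of a minimising sequence as well as uniqueness. The description
  in \<open>min_norm_certificate\<close> thereby denotes.\<close>

lemma closed_convex_minimal_norm:
  fixes C :: "'a::{real_inner, complete_space} set"
  assumes "closed C" "convex C" "C \<noteq> {}"
  shows "\<exists>!p. p \<in> C \<and> (\<forall>q\<in>C. norm p \<le> norm q)"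
proof -
  define \<delta> where "\<delta> = (INF x\<in>C. (norm x)\<^sup>2)"
  have bdd: "bdd_below ((\<lambda>x. (norm x)\<^sup>2) ` C)" by (rule bdd_belowI[of _ 0]) auto
  have \<delta>: "\<delta> \<le> (norm x)\<^sup>2" if "x \<in> C" for x unfolding \<delta>_def by (rule cINF_lower[OF bdd that])
  have par: "(norm (x - y))\<^sup>2 \<le> 2 * (norm x)\<^sup>2 + 2 * (norm y)\<^sup>2 - 4 * \<delta>" if "x \<in> C" "y \<in> C" for x y
  proof -
    have "(1/2) *\<^sub>R x + (1/2) *\<^sub>R y \<in> C" by (rule convexD[OF assms(2) that]) auto
    from \<delta>[OF this] have "4 * \<delta> \<le> (norm (x + y))\<^sup>2"
      by (simp add: scaleR_add_right[symmetric] power_mult_distrib power2_eq_square)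
    then show ?thesis
      by (simp add: power2_norm_eq_inner inner_add_left inner_add_right inner_diff_left inner_diff_right inner_commute)
  qed
  have "\<exists>x\<in>C. (norm x)\<^sup>2 < \<delta> + 1 / real (Suc n)" for n
    using cINF_less_iff[OF assms(3) bdd, of "\<delta> + 1 / real (Suc n)"] unfolding \<delta>_def by simp
  then obtain x where x: "\<And>n. x n \<in> C" "\<And>n. (norm (x n))\<^sup>2 < \<delta> + 1 / real (Suc n)" by metis
  have "Cauchy x"
  proof (rule metric_CauchyI)
    fix e :: real assume e: "e > 0"
    obtain N where N: "1 / real (Suc N) < e\<^sup>2 / 4"
      using reals_Archimedean[of "e\<^sup>2 / 4"] e by (auto simp: inverse_eq_divide)
    have "dist (x m) (x n) < e" if "m \<ge> N" "n \<ge> N" for m n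
    proof -
      have *: "1 / real (Suc k) \<le> 1 / real (Suc N)" if "k \<ge> N" for k using that by (simp add: field_simps)
      have "(norm (x m - x n))\<^sup>2 < e\<^sup>2"
        using par[OF x(1) x(1), of m n] x(2)[of m] x(2)[of n] *[OF that(1)] *[OF that(2)] N by linarith
      then show ?thesis unfolding dist_norm by (rule power2_less_imp_less) (use e in simp)
    qed
    then show "\<exists>M. \<forall>m\<ge>M. \<forall>n\<ge>M. dist (x m) (x n) < e" by blast
  qed
  then obtain p where p: "x \<longlonglongrightarrow> p" using Cauchy_convergent convergent_def by blast
  have pC: "p \<in> C" using closed_sequentially[OF assms(1) x(1) p] .
  have "(norm p)\<^sup>2 \<le> \<delta>"
  proof (rule LIMSEQ_le)
    show "(\<lambda>n. (norm (x n))\<^sup>2) \<longlonglongrightarrow> (norm p)\<^sup>2" by (intro tendsto_intros p)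
    show "(\<lambda>n. \<delta> + 1 / real (Suc n)) \<longlonglongrightarrow> \<delta>"
      using tendsto_add[OF tendsto_const LIMSEQ_inverse_real_of_nat, of \<delta>] by (simp add: inverse_eq_divide)
  qed (use x(2) less_imp_le in blast)
  then have peq: "(norm p)\<^sup>2 = \<delta>" using \<delta>[OF pC] by simp
  show ?thesis
  proof (rule ex1I[of _ p], intro conjI ballI pC)
    show "norm p \<le> norm q" if "q \<in> C" for q
      using \<delta>[OF that] unfolding peq[symmetric] by (rule power2_le_imp_le) simp
    fix q assume q: "q \<in> C \<and> (\<forall>r\<in>C. norm q \<le> norm r)"
    then have "(norm q)\<^sup>2 \<le> (norm p)\<^sup>2" using pC by (intro power_mono) auto
    then have "(norm (q - p))\<^sup>2 \<le> 0" using par[of q p] q pC peq by linarith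
    then show "q = p" by simp
  qed
qed

section \<open>Stability of nondegenerate certificates\<close>

lemma torus_near:
  fixes s t :: torus
  obtains r where "\<bar>r\<bar> = dist s t" "s = t + to_torus r"
proof -
  have "\<exists>r. \<bar>r\<bar> = dist s t \<and> s = t + to_torus r"
  proof transfer
    fix s t :: real
    have "s - (t + ((s - t) - of_int (round (s - t)))) \<in> \<int>" by simp
    then show "\<exists>r. \<bar>r\<bar> = \<bar>s - t - of_int (round (s - t))\<bar> \<and> s - (t + r) \<in> \<int>" by blast
  qed
  then show ?thesis using that by blast
qed

text \<open>Differentiability is stated along translations; these reach every nearby point of the
  torus with a step equal to its distance.\<close>

lemma Ck_torus_continuous: "Ck_torus k f \<Longrightarrow> continuous_on UNIV f"
proof (cases k)
  case (Suc l)
  assume "Ck_torus k f"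
  then have diff: "(\<lambda>s. f (t + to_torus s)) differentiable at 0" for t using Suc by simp
  show ?thesis unfolding continuous_on_iff
  proof (intro ballI allI impI)
    fix t and e :: real assume e: "e > 0"
    have "isCont (\<lambda>s. f (t + to_torus s)) 0" by (rule differentiable_imp_continuous_within[OF diff])
    then obtain d where d: "d > 0" "\<And>r. \<bar>r\<bar> < d \<Longrightarrow> \<bar>f (t + to_torus r) - f t\<bar> < e"
      using e unfolding continuous_at_eps_delta by (auto simp: dist_real_def)
    have "dist (f s) (f t) < e" if "dist s t < d" for s
    proof -
      obtain r where "\<bar>r\<bar> = dist s t" "s = t + to_torus r" by (rule torus_near)
      with d(2)[of r] that show ?thesis by (simp add: dist_real_def)
    qed
    then show "\<exists>d>0. \<forall>s\<in>UNIV. dist s t < d \<longrightarrow> dist (f s) (f t) < e" using d(1) by blast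
  qed
qed simp

lemma Ck_torus_DERIV:
  assumes "Ck_torus (Suc k) f"
  shows "((\<lambda>r. f (t + to_torus r)) has_real_derivative tderiv f (t + to_torus r)) (at r)"
proof -
  have "(\<lambda>s. f ((t + to_torus r) + to_torus s)) differentiable at 0" using assms by simp
  then have "((\<lambda>s. f ((t + to_torus r) + to_torus s)) has_real_derivative tderiv f (t + to_torus r)) (at 0)"
    unfolding tderiv_def by (simp add: DERIV_deriv_iff_real_differentiable)
  then have "((\<lambda>s. f (t + to_torus (s + r))) has_real_derivative tderiv f (t + to_torus r)) (at 0)"
    by (simp add: to_torus_add ac_simps)
  then show ?thesis using DERIV_shift[of "\<lambda>r. f (t + to_torus r)" _ 0 r] by simp
qed

text \<open>The mean value inequality for f (t + r) - r f'(t) with uniform continuity of f' on the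
  compact torus. Uniformity in \<open>t\<close> is what yields differentiability of translates in
  L2.\<close>

lemma Ck_torus_uniform_derivative:
  assumes f: "Ck_torus (Suc k) f" and e: "e > 0"
  obtains d where "d > 0"
    "\<And>h t. \<bar>h\<bar> < d \<Longrightarrow> \<bar>f (t + to_torus h) - f t - h * tderiv f t\<bar> \<le> e * \<bar>h\<bar>"
proof -
  have c: "continuous_on UNIV (tderiv f)" using f by (auto intro: Ck_torus_continuous)
  obtain d where d: "d > 0" "\<And>x y. dist x y < d \<Longrightarrow> \<bar>tderiv f x - tderiv f y\<bar> < e"
    using that by (rule uniformly_continuous_torus[OF c e])
  show ?thesis
  proof (rule that[OF d(1)])
    fix h t assume h: "\<bar>h\<bar> < d"
    have "norm ((f (t + to_torus h) - h * tderiv f t) - (f (t + to_torus 0) - 0 * tderiv f t)) \<le> e * norm (h - 0)"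
    proof (rule field_differentiable_bound[where S = "ball 0 d" and f = "\<lambda>r. f (t + to_torus r) - r * tderiv f t"])
      fix r :: real assume r: "r \<in> ball 0 d"
      have "((\<lambda>r. f (t + to_torus r) - r * tderiv f t) has_real_derivative (tderiv f (t + to_torus r) - 1 * tderiv f t)) (at r)"
        by (rule DERIV_diff[OF Ck_torus_DERIV[OF f] DERIV_cmult_right[OF DERIV_ident]])
      then show "((\<lambda>r. f (t + to_torus r) - r * tderiv f t) has_field_derivative (tderiv f (t + to_torus r) - tderiv f t)) (at r within ball 0 d)"
        by (simp add: has_field_derivative_at_within)
      have "dist (t + to_torus r) t \<le> \<bar>r\<bar>"
        using dist_torus_add_left[of t "to_torus r" 0] dist_to_torus_le[of r 0] by simp
      then have "dist (t + to_torus r) t < d" using r by simp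
      from d(2)[OF this] show "norm (tderiv f (t + to_torus r) - tderiv f t) \<le> e" by simp
    qed (use h d(1) in auto)
    then show "\<bar>f (t + to_torus h) - f t - h * tderiv f t\<bar> \<le> e * \<bar>h\<bar>" by (simp add: algebra_simps)
  qed
qed

lemma shift_l2_uniform_derivative:
  assumes f: "Ck_torus (Suc k) f" and e: "e > 0"
  shows "\<forall>\<^sub>F h in nhds 0. norm (shift_l2 f (to_torus (r + h)) - shift_l2 f (to_torus r)
      - h *\<^sub>R shift_l2 (tderiv f) (to_torus r)) \<le> e * norm h"
proof -
  obtain d where d: "d > 0" "\<And>h t. \<bar>h\<bar> < d \<Longrightarrow> \<bar>f (t + to_torus h) - f t - h * tderiv f t\<bar> \<le> e * \<bar>h\<bar>"
    using that by (rule Ck_torus_uniform_derivative[OF f e])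
  have c: "continuous_on UNIV f" "continuous_on UNIV (tderiv f)"
    using Ck_torus_continuous[OF f] f by (auto intro: Ck_torus_continuous)
  show ?thesis unfolding eventually_nhds_metric
  proof (intro exI[of _ d] conjI allI impI d(1))
    fix h :: real assume h: "dist h 0 < d"
    show "norm (shift_l2 f (to_torus (r + h)) - shift_l2 f (to_torus r) - h *\<^sub>R shift_l2 (tderiv f) (to_torus r)) \<le> e * norm h"
      unfolding to_torus_add
    proof (rule shift_l2_linear_combination_le[OF c])
      fix s
      show "\<bar>f (to_torus r + to_torus h - s) - f (to_torus r - s) - h * tderiv f (to_torus r - s)\<bar> \<le> e * norm h"
        using d(2)[of h "to_torus r - s"] h by (simp add: diff_add_eq)
    qed
  qed
qed

lemma uniform_Ck_0_shift_l2:
  assumes f: "continuous_on UNIV f"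
  shows "uniform_Ck 0 UNIV ((\<lambda>_ r. shift_l2 f (to_torus r)) ` {()})"
proof (rule uniform_Ck_0_I)
  fix z and e :: real assume "e > 0"
  have "continuous_on UNIV (\<lambda>r. shift_l2 f (to_torus r))"
    by (intro continuous_on_compose2[OF continuous_on_shift_l2[OF f] continuous_to_torus]) auto
  then have "continuous (at z) (\<lambda>r. shift_l2 f (to_torus r))"
    by (simp add: continuous_on_eq_continuous_at)
  then obtain d where d: "d > 0" "\<And>r. dist r z < d \<Longrightarrow> dist (shift_l2 f (to_torus r)) (shift_l2 f (to_torus z)) < e"
    using \<open>e > 0\<close> unfolding continuous_at_eps_delta by blast
  show "\<forall>\<^sub>F h in nhds 0. \<forall>i\<in>{()}. norm (shift_l2 f (to_torus (z + h)) - shift_l2 f (to_torus z)) \<le> e"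
    unfolding eventually_nhds_metric
  proof (intro exI[of _ d] conjI allI impI ballI d(1))
    fix h :: real assume "dist h 0 < d"
    then show "norm (shift_l2 f (to_torus (z + h)) - shift_l2 f (to_torus z)) \<le> e"
      using d(2)[of "z + h"] by (simp add: dist_norm)
  qed
qed auto

text \<open>The derivative of the curve of translates is the curve of translates of the derivative,
  so orders of smoothness match one for one.\<close>

lemma uniform_Ck_shift_l2:
  "Ck_torus k f \<Longrightarrow> uniform_Ck k UNIV {\<lambda>r. shift_l2 f (to_torus r)}"
proof (induction k arbitrary: f)
  case 0
  then show ?case using uniform_Ck_0_shift_l2[of f] by simp
next
  case (Suc k)
  let ?c = "\<lambda>f r. shift_l2 f (to_torus r)"
  have c': "uniform_Ck k UNIV {?c (tderiv f)}" using Suc by simp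
  note c0 = uniform_Ck_0_shift_l2[OF Ck_torus_continuous[OF Suc.prems]]
  have "uniform_Ck (Suc k) UNIV ((\<lambda>_. ?c f) ` {()})"
  proof (rule uniform_Ck_Suc_I[OF c0, where D = "\<lambda>_ r v. v *\<^sub>R ?c (tderiv f) r"])
    show "linear (\<lambda>v. v *\<^sub>R shift_l2 (tderiv f) (to_torus r))" for r
      by (intro linearI) (auto simp: scaleR_add_left)
    show "\<forall>\<^sub>F h in nhds 0. \<forall>i\<in>{()}. norm (?c f (z + h) - ?c f z - h *\<^sub>R ?c (tderiv f) z) \<le> e * norm h"
      if "e > 0" for z e
      using shift_l2_uniform_derivative[OF Suc.prems that] by simp
    show "uniform_Ck k UNIV {\<lambda>z. v *\<^sub>R ?c (tderiv f) z |(i::unit) v. i \<in> {()} \<and> norm v \<le> 1}"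
      by (rule uniform_Ck_mono[OF uniform_Ck_scale[OF c', of 1]]) auto
  qed
  then show ?case by simp
qed

lemma shift_l2_has_vector_derivative:
  assumes f: "Ck_torus (Suc k) f"
  shows "((\<lambda>r. shift_l2 f (to_torus r)) has_vector_derivative shift_l2 (tderiv f) (to_torus r)) (at r)"
  unfolding has_vector_derivative_def has_derivative_within_alt
proof (intro conjI allI impI bounded_linear_scaleR_left)
  fix e :: real assume e: "e > 0"
  from shift_l2_uniform_derivative[OF f e, of r] obtain d where d: "d > 0"
    "\<And>h. \<bar>h\<bar> < d \<Longrightarrow> norm (shift_l2 f (to_torus (r + h)) - shift_l2 f (to_torus r)
      - h *\<^sub>R shift_l2 (tderiv f) (to_torus r)) \<le> e * norm h"
    unfolding eventually_nhds_metric by auto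
  show "\<exists>d>0. \<forall>y\<in>UNIV. norm (y - r) < d \<longrightarrow> norm (shift_l2 f (to_torus y) - shift_l2 f (to_torus r)
      - (y - r) *\<^sub>R shift_l2 (tderiv f) (to_torus r)) \<le> e * norm (y - r)"
  proof (intro exI[of _ d] conjI ballI impI d(1))
    fix y :: real assume "norm (y - r) < d"
    then show "norm (shift_l2 f (to_torus y) - shift_l2 f (to_torus r)
      - (y - r) *\<^sub>R shift_l2 (tderiv f) (to_torus r)) \<le> e * norm (y - r)"
      using d(2)[of "y - r"] by simp
  qed
qed

lemma inner_shift_l2_DERIV:
  assumes f: "Ck_torus (Suc k) f"
  shows "((\<lambda>r. inner (shift_l2 f (to_torus r)) p) has_real_derivative inner (shift_l2 (tderiv f) (to_torus r)) p) (at r)"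
proof -
  have "((\<lambda>r. inner (shift_l2 f (to_torus r)) p) has_vector_derivative inner (shift_l2 (tderiv f) (to_torus r)) p) (at r)"
    by (rule bounded_linear.has_vector_derivative[OF bounded_linear_inner_left shift_l2_has_vector_derivative[OF f]])
  then show ?thesis by (simp add: has_real_derivative_iff_has_vector_derivative)
qed

text \<open>Derivatives of a certificate become pairings with translates of derivatives of the
  kernel; the curvature condition of \<open>ndsc\<close> is used in this form.\<close>

lemma tderiv_inner_shift_l2:
  assumes f: "Ck_torus (Suc k) f"
  shows "tderiv (\<lambda>t. inner (shift_l2 f t) p) = (\<lambda>t. inner (shift_l2 (tderiv f) t) p)"
proof
  fix t
  obtain a where a: "t = to_torus a" using surj_to_torus by blast
  have "((\<lambda>r. inner (shift_l2 f (to_torus (r + a))) p) has_real_derivative inner (shift_l2 (tderiv f) (to_torus a)) p) (at 0)"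
    using DERIV_shift[of "\<lambda>r. inner (shift_l2 f (to_torus r)) p" _ 0 a] inner_shift_l2_DERIV[OF f, of p a] by simp
  then have "((\<lambda>r. inner (shift_l2 f (t + to_torus r)) p) has_real_derivative inner (shift_l2 (tderiv f) t) p) (at 0)"
    by (simp add: a to_torus_add add.commute)
  then show "tderiv (\<lambda>t. inner (shift_l2 f t) p) t = inner (shift_l2 (tderiv f) t) p"
    unfolding tderiv_def by (rule DERIV_imp_deriv)
qed

text \<open>Concavity is centred at \<open>c\<close>, while the critical point \<open>x\<close> may
  lie elsewhere in the interval, because perturbed spikes move. Two mean values, for
  \<open>h\<close> and then for \<open>h'\<close>, give the sign.\<close>

lemma strict_max_of_negative_second_derivative:
  fixes h :: "real \<Rightarrow> real"
  assumes "\<And>r. (h has_real_derivative h' r) (at r)" "\<And>r. (h' has_real_derivative h'' r) (at r)"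
    and neg: "\<And>r. \<bar>r - c\<bar> < \<rho> \<Longrightarrow> h'' r < 0"
    and x: "\<bar>x - c\<bar> < \<rho>" "h' x = 0" and r: "\<bar>r - c\<bar> < \<rho>" "r \<noteq> x"
  shows "h r < h x"
proof (cases "x < r")
  case True
  obtain y where y: "x < y" "y < r" "h r - h x = (r - x) * h' y"
    using MVT2[OF True, of h h'] assms(1) by blast
  obtain w where w: "x < w" "w < y" "h' y - h' x = (y - x) * h'' w"
    using MVT2[OF y(1), of h' h''] assms(2) by blast
  have "h'' w < 0" by (rule neg) (use w y x r in auto)
  then have "h' y < 0" using w x(2) y(1) by (simp add: mult_pos_neg)
  then have "(r - x) * h' y < 0" using True by (intro mult_pos_neg) auto
  then show ?thesis using y(3) by linarith
next
  case False
  then have lt: "r < x" using r(2) by simp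
  obtain y where y: "r < y" "y < x" "h x - h r = (x - r) * h' y"
    using MVT2[OF lt, of h h'] assms(1) by blast
  obtain w where w: "y < w" "w < x" "h' x - h' y = (x - y) * h'' w"
    using MVT2[OF y(2), of h' h''] assms(2) by blast
  have "h'' w < 0" by (rule neg) (use w y x r in auto)
  then have "(x - y) * h'' w < 0" using y(2) by (intro mult_pos_neg) auto
  then have "h' y > 0" using w x(2) by linarith
  then have "(x - r) * h' y > 0" using lt by simp
  then show ?thesis using y(3) by linarith
qed

lemma abs_inner_shift_l2_le:
  assumes "continuous_on UNIV f" "\<And>t. \<bar>f t\<bar> \<le> B"
  shows "\<bar>inner (shift_l2 f t) p\<bar> \<le> B * norm p"
  using Cauchy_Schwarz_ineq2[of "shift_l2 f t" p]
    mult_right_mono[OF norm_shift_l2_le[OF assms], of "norm p" t] by simp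

text \<open>Away from the spikes compactness leaves a gap below 1. Near a spike the perturbed
  function times its sign is still strictly concave, so the prescribed critical point is its only
  maximum there: value and slope at the moved point are hypotheses, and the curvature is stable. For
  \<open>p0\<close> the slopes vanish because the spikes are extrema.\<close>

lemma certificate_stable:
  fixes f :: "torus \<Rightarrow> real" and \<xi>0 s :: "'n::finite \<Rightarrow> real"
  assumes f: "Ck_torus 2 f"
    and s: "\<And>i. \<bar>s i\<bar> = 1" and at: "\<And>i. inner (shift_l2 f (to_torus (\<xi>0 i))) p0 = s i"
    and off: "\<And>t. t \<notin> range (\<lambda>i. to_torus (\<xi>0 i)) \<Longrightarrow> \<bar>inner (shift_l2 f t) p0\<bar> < 1"
    and nd: "\<And>i. inner (shift_l2 (tderiv (tderiv f)) (to_torus (\<xi>0 i))) p0 \<noteq> 0"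
  obtains \<epsilon> \<rho> where "\<epsilon> > 0" "\<rho> > 0"
    "\<And>p \<xi> t. norm (p - p0) \<le> \<epsilon> \<Longrightarrow> (\<And>i. \<bar>\<xi> i - \<xi>0 i\<bar> < \<rho>) \<Longrightarrow>
      (\<And>i. inner (shift_l2 f (to_torus (\<xi> i))) p = s i) \<Longrightarrow>
      (\<And>i. inner (shift_l2 (tderiv f) (to_torus (\<xi> i))) p = 0) \<Longrightarrow>
      t \<notin> range (\<lambda>i. to_torus (\<xi> i)) \<Longrightarrow> \<bar>inner (shift_l2 f t) p\<bar> < 1"
    and "\<And>i. inner (shift_l2 (tderiv f) (to_torus (\<xi>0 i))) p0 = 0"
proof -
  have f1: "Ck_torus (Suc 1) f" and f2: "Ck_torus (Suc 0) (tderiv f)" and f3: "Ck_torus 0 (tderiv (tderiv f))"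
    using f by (simp_all add: numeral_2_eq_2)
  note c = Ck_torus_continuous[OF f1] Ck_torus_continuous[OF f2] Ck_torus_continuous[OF f3]
  obtain B0 where B0: "B0 \<ge> 0" "\<And>t. \<bar>f t\<bar> \<le> B0" using that by (rule continuous_torus_bounded[OF c(1)])
  obtain B2 where B2: "B2 \<ge> 0" "\<And>t. \<bar>tderiv (tderiv f) t\<bar> \<le> B2"
    using that by (rule continuous_torus_bounded[OF c(3)])
  define \<eta> where "\<eta> p r = inner (shift_l2 f (to_torus r)) p" for p r
  define \<eta>' where "\<eta>' p r = inner (shift_l2 (tderiv f) (to_torus r)) p" for p r
  define \<eta>'' where "\<eta>'' p r = inner (shift_l2 (tderiv (tderiv f)) (to_torus r)) p" for p r
  have der: "((\<lambda>r. a * \<eta> p r) has_real_derivative a * \<eta>' p r) (at r)"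
    "((\<lambda>r. a * \<eta>' p r) has_real_derivative a * \<eta>'' p r) (at r)" for a p r
    unfolding \<eta>_def \<eta>'_def \<eta>''_def
    by (intro DERIV_cmult inner_shift_l2_DERIV[OF f1] inner_shift_l2_DERIV[OF f2])+
  have s2: "s i * s i = 1" for i using s[of i] by (metis abs_mult_self_eq mult_1)
  have le1: "s i * \<eta> p0 r \<le> 1" for i r
  proof -
    have "\<bar>\<eta> p0 r\<bar> \<le> 1" unfolding \<eta>_def
      using off[of "to_torus r"] at s by (metis less_imp_le order_refl rangeE)
    then have "\<bar>s i * \<eta> p0 r\<bar> \<le> 1" by (simp add: abs_mult s)
    then show ?thesis by linarith
  qed
  have at': "s i * \<eta> p0 (\<xi>0 i) = 1" for i using at s2 by (simp add: \<eta>_def)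
  have crit: "\<eta>' p0 (\<xi>0 i) = 0" for i
  proof -
    have "s i * \<eta>' p0 (\<xi>0 i) = 0"
      by (rule DERIV_local_max[OF der(1), of 1]) (use le1 at' in auto)
    then show ?thesis using s[of i] by auto
  qed
  have c2: "continuous_on UNIV (\<lambda>r. s i * \<eta>'' p0 r)" for i
    unfolding \<eta>''_def
    by (intro continuous_intros continuous_on_compose2[OF continuous_on_shift_l2[OF c(3)] continuous_to_torus]) auto
  have nbhd: "\<exists>\<rho>>0. \<forall>r. \<bar>r - x\<bar> < \<rho> \<longrightarrow> g r < a"
    if "continuous_on UNIV g" "g x < a" for g :: "real \<Rightarrow> real" and x a
  proof -
    have "isCont g x" using that(1) by (simp add: continuous_on_eq_continuous_at)
    then have "\<forall>\<^sub>F r in nhds x. g r < a"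
      using that(2) order_tendstoD(2)[of g "g x" "nhds x" a] by (simp add: isCont_def tendsto_at_iff_tendsto_nhds)
    then show ?thesis unfolding eventually_nhds_metric dist_real_def by blast
  qed
  \<comment> \<open>A positive sign would make the spike a strict local minimum, against the bound
    \<open>le1\<close>.\<close>
  have neg: "s i * \<eta>'' p0 (\<xi>0 i) < 0" for i
  proof (rule ccontr)
    assume "\<not> ?thesis"
    moreover have "s i * \<eta>'' p0 (\<xi>0 i) \<noteq> 0" using nd[of i] s[of i] by (auto simp: \<eta>''_def)
    ultimately have "- (s i * \<eta>'' p0 (\<xi>0 i)) < 0" by linarith
    then obtain \<rho> where \<rho>: "\<rho> > 0" "\<And>r. \<bar>r - \<xi>0 i\<bar> < \<rho> \<Longrightarrow> - (s i * \<eta>'' p0 r) < 0"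
      using nbhd[of "\<lambda>r. - (s i * \<eta>'' p0 r)" "\<xi>0 i" 0] c2[of i] continuous_on_minus by blast
    have "(- s i) * \<eta> p0 (\<xi>0 i + \<rho> / 2) < (- s i) * \<eta> p0 (\<xi>0 i)"
      by (rule strict_max_of_negative_second_derivative[OF der(1) der(2), where c = "\<xi>0 i" and \<rho> = \<rho>])
        (use \<rho> crit in auto)
    then show False using le1[of i "\<xi>0 i + \<rho> / 2"] at'[of i] by simp
  qed
  define a where "a = Max (range (\<lambda>i. s i * \<eta>'' p0 (\<xi>0 i)))"
  have a: "a < 0" "\<And>i. s i * \<eta>'' p0 (\<xi>0 i) \<le> a"
    unfolding a_def using neg by (auto intro: Max_ge)
  have ea: "\<exists>\<rho>>0. \<forall>r. \<bar>r - \<xi>0 i\<bar> < \<rho> \<longrightarrow> s i * \<eta>'' p0 r < a / 2" for i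
    by (rule nbhd[OF c2]) (use a(1) a(2)[of i] in linarith)
  \<comment> \<open>Concavity bounds the signed function from above only; its positivity near the
    spike will keep it away from -1.\<close>
  have eb: "\<exists>\<rho>>0. \<forall>r. \<bar>r - \<xi>0 i\<bar> < \<rho> \<longrightarrow> - (s i * \<eta> p0 r) < 0" for i
  proof (rule nbhd)
    show "continuous_on UNIV (\<lambda>r. - (s i * \<eta> p0 r))" unfolding \<eta>_def
      by (intro continuous_intros continuous_on_compose2[OF continuous_on_shift_l2[OF c(1)] continuous_to_torus]) auto
  qed (use at' in simp)
  obtain \<rho>1 where \<rho>1: "\<And>i. \<rho>1 i > 0" "\<And>i r. \<bar>r - \<xi>0 i\<bar> < \<rho>1 i \<Longrightarrow> s i * \<eta>'' p0 r < a / 2"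
    using ea by metis
  obtain \<rho>2 where \<rho>2: "\<And>i. \<rho>2 i > 0" "\<And>i r. \<bar>r - \<xi>0 i\<bar> < \<rho>2 i \<Longrightarrow> - (s i * \<eta> p0 r) < 0"
    using eb by metis
  define \<rho> where "\<rho> = Min (range (\<lambda>i. min (\<rho>1 i) (\<rho>2 i)))"
  have \<rho>: "\<rho> > 0" unfolding \<rho>_def using \<rho>1(1) \<rho>2(1) by auto
  have \<rho>le: "\<rho> \<le> \<rho>1 i" "\<rho> \<le> \<rho>2 i" for i
    using Min_le[of "range (\<lambda>i. min (\<rho>1 i) (\<rho>2 i))" "min (\<rho>1 i) (\<rho>2 i)"] by (auto simp: \<rho>_def)
  define K where "K = {t. \<forall>i. dist t (to_torus (\<xi>0 i)) \<ge> \<rho>}"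
  have "closed K" unfolding K_def
    by (intro closed_Collect_all closed_Collect_le continuous_intros)
  then have "compact K" using compact_torus closed_Int_compact[of K UNIV] by simp
  have "\<exists>q<1. q \<ge> 0 \<and> (\<forall>t\<in>K. \<bar>inner (shift_l2 f t) p0\<bar> \<le> q)"
  proof (cases "K = {}")
    case False
    have "continuous_on K (\<lambda>t. \<bar>inner (shift_l2 f t) p0\<bar>)"
      by (intro continuous_intros continuous_on_subset[OF continuous_on_shift_l2[OF c(1)]]) auto
    from continuous_attains_sup[OF \<open>compact K\<close> False this]
    obtain t0 where t0: "t0 \<in> K" "\<And>t. t \<in> K \<Longrightarrow> \<bar>inner (shift_l2 f t) p0\<bar> \<le> \<bar>inner (shift_l2 f t0) p0\<bar>" by blast
    have "t0 \<notin> range (\<lambda>i. to_torus (\<xi>0 i))" 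
    proof
      assume "t0 \<in> range (\<lambda>i. to_torus (\<xi>0 i))"
      then obtain i where "t0 = to_torus (\<xi>0 i)" by blast
      moreover have "dist t0 (to_torus (\<xi>0 i)) \<ge> \<rho>" using t0(1) by (simp add: K_def)
      ultimately show False using \<rho> by simp
    qed
    from off[OF this] t0(2) show ?thesis by (intro exI[of _ "\<bar>inner (shift_l2 f t0) p0\<bar>"]) auto
  qed (auto intro: exI[of _ 0])
  then obtain q where q: "q < 1" "q \<ge> 0" "\<And>t. t \<in> K \<Longrightarrow> \<bar>inner (shift_l2 f t) p0\<bar> \<le> q" by blast
  \<comment> \<open>The first bound preserves at least half of the gap \<open>1 - q\<close> away
    from the spikes; the second keeps the signed second derivative, below \<open>a / 2\<close> near
    a spike, negative after a perturbation of size \<open>B2 * \<epsilon>\<close>.\<close>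
  define \<epsilon> where "\<epsilon> = min ((1 - q) / (2 * (B0 + 1))) (- a / (2 * (B2 + 1)))"
  have \<epsilon>: "\<epsilon> > 0"
  proof -
    have pos: "0 < 1 - q" "0 < 2 * (B0 + 1)" "0 < - a" "0 < 2 * (B2 + 1)"
      using q(1) a(1) B0(1) B2(1) by simp_all
    have "(1 - q) / (2 * (B0 + 1)) > 0" "- a / (2 * (B2 + 1)) > 0"
      by (rule divide_pos_pos[OF pos(1,2)], rule divide_pos_pos[OF pos(3,4)])
    then show ?thesis unfolding \<epsilon>_def by simp
  qed
  have \<epsilon>0: "B0 * \<epsilon> < 1 - q"
  proof -
    have "\<epsilon> \<le> (1 - q) / (2 * (B0 + 1))" by (simp add: \<epsilon>_def)
    then have "\<epsilon> * (2 * (B0 + 1)) \<le> 1 - q" using B0(1) by (simp add: pos_le_divide_eq)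
    then have "2 * (B0 * \<epsilon>) + 2 * \<epsilon> \<le> 1 - q" by (simp add: algebra_simps)
    moreover have "B0 * \<epsilon> \<ge> 0" using B0(1) \<epsilon> by simp
    ultimately show ?thesis using \<epsilon> by linarith
  qed
  have \<epsilon>2: "B2 * \<epsilon> < - a / 2"
  proof -
    have "\<epsilon> \<le> - a / (2 * (B2 + 1))" by (simp add: \<epsilon>_def)
    then have "\<epsilon> * (2 * (B2 + 1)) \<le> - a"
      by (rule pos_le_divide_eq[THEN iffD1, rotated]) (use B2(1) in simp)
    then have "2 * (B2 * \<epsilon>) + 2 * \<epsilon> \<le> - a" by (simp add: algebra_simps)
    then show ?thesis using \<epsilon> by linarith
  qed
  show ?thesis
  proof (rule that[OF \<epsilon> \<rho>])
    show "inner (shift_l2 (tderiv f) (to_torus (\<xi>0 i))) p0 = 0" for i using crit by (simp add: \<eta>'_def)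
    fix p \<xi> t
    assume p: "norm (p - p0) \<le> \<epsilon>" and \<xi>: "\<And>i. \<bar>\<xi> i - \<xi>0 i\<bar> < \<rho>"
      and v: "\<And>i. inner (shift_l2 f (to_torus (\<xi> i))) p = s i"
      and d: "\<And>i. inner (shift_l2 (tderiv f) (to_torus (\<xi> i))) p = 0"
      and t: "t \<notin> range (\<lambda>i. to_torus (\<xi> i))"
    have cl0: "\<bar>inner (shift_l2 f t) p - inner (shift_l2 f t) p0\<bar> \<le> B0 * \<epsilon>" for t
      using abs_inner_shift_l2_le[OF c(1) B0(2), of t "p - p0"] mult_left_mono[OF p B0(1)]
      by (simp add: inner_diff_right)
    have cl2: "\<bar>\<eta>'' p r - \<eta>'' p0 r\<bar> \<le> B2 * \<epsilon>" for r
      using abs_inner_shift_l2_le[OF c(3) B2(2), of "to_torus r" "p - p0"] mult_left_mono[OF p B2(1)]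
      by (simp add: inner_diff_right \<eta>''_def)
    show "\<bar>inner (shift_l2 f t) p\<bar> < 1"
    proof (cases "t \<in> K")
      case True
      then show ?thesis using q(3)[OF True] cl0[of t] \<epsilon>0 by linarith
    next
      case False
      then obtain i where "dist t (to_torus (\<xi>0 i)) < \<rho>" by (auto simp: K_def not_le)
      moreover obtain h where "\<bar>h\<bar> = dist t (to_torus (\<xi>0 i))" "t = to_torus (\<xi>0 i) + to_torus h"
        by (rule torus_near)
      ultimately obtain r where r: "t = to_torus r" "\<bar>r - \<xi>0 i\<bar> < \<rho>"
        by (metis add_diff_cancel_left' to_torus_add)
      have neg': "s i * \<eta>'' p r' < 0" if "\<bar>r' - \<xi>0 i\<bar> < \<rho>" for r'
      proof -
        have "s i * \<eta>'' p0 r' < a / 2" using \<rho>1(2)[of r' i] that \<rho>le(1)[of i] by linarith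
        moreover have "\<bar>s i * (\<eta>'' p r' - \<eta>'' p0 r')\<bar> \<le> B2 * \<epsilon>" using cl2[of r'] by (simp add: abs_mult s)
        ultimately show ?thesis using \<epsilon>2 by (simp add: right_diff_distrib abs_le_iff)
      qed
      have "s i * \<eta> p r < s i * \<eta> p (\<xi> i)"
      proof (rule strict_max_of_negative_second_derivative[OF der(1) der(2) neg' \<xi> _ r(2)])
        show "s i * \<eta>' p (\<xi> i) = 0" using d by (simp add: \<eta>'_def)
        show "r \<noteq> \<xi> i" using t r(1) by blast
      qed
      then have up: "s i * inner (shift_l2 f t) p < 1" using v s2 r(1) by (simp add: \<eta>_def)
      have "- (s i * \<eta> p0 r) < 0" using \<rho>2(2)[of r i] r(2) \<rho>le(2)[of i] by linarith
      moreover have "\<bar>s i * (inner (shift_l2 f t) p - inner (shift_l2 f t) p0)\<bar> \<le> B0 * \<epsilon>"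
        using cl0[of t] by (simp add: abs_mult s)
      ultimately have "s i * inner (shift_l2 f t) p > -1"
        using \<epsilon>0 q(2) r(1) by (simp add: \<eta>_def right_diff_distrib abs_le_iff)
      with up have "\<bar>s i * inner (shift_l2 f t) p\<bar> < 1" by (simp add: abs_less_iff)
      then show ?thesis by (simp add: abs_mult s)
    qed
  qed
qed

section \<open>Total variation and optimality\<close>

lemma tv_norm_bdd_above: "bdd_above {blinfun_apply m \<psi> | \<psi>. norm \<psi> \<le> 1}" for m :: radon
proof (rule bdd_aboveI[of _ "norm m"], safe)
  fix \<psi> :: "torus \<Rightarrow>\<^sub>C real" assume "norm \<psi> \<le> 1"
  then have "norm m * norm \<psi> \<le> norm m" by (simp add: mult_left_le)
  then show "blinfun_apply m \<psi> \<le> norm m" using abs_blinfun_real_le[of m \<psi>] by linarith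
qed

lemma le_tv_norm: "norm \<psi> \<le> 1 \<Longrightarrow> blinfun_apply m \<psi> \<le> tv_norm m"
  unfolding tv_norm_def by (rule cSup_upper[OF _ tv_norm_bdd_above]) blast

lemma tv_norm_le:
  assumes "\<And>\<psi>. norm \<psi> \<le> 1 \<Longrightarrow> blinfun_apply m \<psi> \<le> B"
  shows "tv_norm m \<le> B"
  unfolding tv_norm_def
  by (rule cSup_least) (use assms in \<open>auto intro!: exI[of _ 0]\<close>)

lemma tv_norm_spikes_le: "tv_norm (spikes a x) \<le> (\<Sum>i\<in>UNIV. \<bar>a $ i\<bar>)"
proof (rule tv_norm_le)
  fix \<psi> :: "torus \<Rightarrow>\<^sub>C real" assume \<psi>: "norm \<psi> \<le> 1"
  have "a $ i * apply_bcontfun \<psi> (x $ i) \<le> \<bar>a $ i\<bar>" for i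
  proof -
    have "\<bar>a $ i * apply_bcontfun \<psi> (x $ i)\<bar> \<le> \<bar>a $ i\<bar> * 1"
      unfolding abs_mult using \<psi> abs_apply_bcontfun_le[of \<psi> "x $ i"] by (intro mult_left_mono) auto
    then show ?thesis by linarith
  qed
  then show "blinfun_apply (spikes a x) \<psi> \<le> (\<Sum>i\<in>UNIV. \<bar>a $ i\<bar>)"
    unfolding spikes_apply by (rule sum_mono)
qed

section \<open>Measures carried by finitely many points\<close>

lemma torus_interpolation:
  fixes x :: "'n::finite \<Rightarrow> torus"
  assumes "inj x"
  shows "\<exists>c :: 'n \<Rightarrow> torus \<Rightarrow> real. (\<forall>i. continuous_on UNIV (c i)) \<and>
    (\<forall>i j. c i (x j) = (if i = j then 1 else 0))"
proof (intro exI conjI allI)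
  let ?c = "\<lambda>i t. \<Prod>j\<in>UNIV - {i}. dist t (x j) / dist (x i) (x j)"
  show "continuous_on UNIV (?c i)" for i
    by (intro continuous_on_prod continuous_intros) (use assms in \<open>auto dest: injD\<close>)
  show "?c i (x j) = (if i = j then 1 else 0)" for i j
  proof (cases "i = j")
    case True
    have "?c i (x j) = (\<Prod>k\<in>UNIV - {i}. 1)"
      by (rule prod.cong) (use True assms in \<open>auto dest: injD\<close>)
    then show ?thesis using True by simp
  next
    case False
    then show ?thesis by (auto intro!: prod_zero bexI[of _ j])
  qed
qed

lemma apply_bcontfun_sum: "apply_bcontfun (\<Sum>k\<in>A. g k) t = (\<Sum>k\<in>A. apply_bcontfun (g k) t)"
  for g :: "'i \<Rightarrow> 'a::topological_space \<Rightarrow>\<^sub>C real"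
  by (induction A rule: infinite_finite_induct) (auto simp: plus_bcontfun.rep_eq zero_bcontfun.rep_eq)

lemma tv_norm_spikes:
  assumes "inj (\<lambda>i. x $ i)"
  shows "tv_norm (spikes a x) = (\<Sum>i\<in>UNIV. \<bar>a $ i\<bar>)"
proof (rule antisym[OF tv_norm_spikes_le])
  obtain c where "(\<forall>i. continuous_on UNIV (c i)) \<and> (\<forall>i j. c i (x $ j) = (if i = j then 1 else 0 :: real))"
    using torus_interpolation[OF assms] ..
  then have c: "\<And>i. continuous_on UNIV (c i)" "\<And>i j. c i (x $ j) = (if i = j then 1 else 0)"
    by auto
  \<comment> \<open>Clamping keeps the interpolant of the signs in the unit ball without altering
    its values at the spikes.\<close>
  define \<psi> where "\<psi> t = max (- 1) (min 1 (\<Sum>i\<in>UNIV. sgn (a $ i) * c i t))" for t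
  have cont: "continuous_on UNIV \<psi>" unfolding \<psi>_def by (intro continuous_intros c)
  have \<psi>x: "\<psi> (x $ j) = sgn (a $ j)" for j
  proof -
    have "(\<Sum>i\<in>UNIV. sgn (a $ i) * c i (x $ j)) = sgn (a $ j)" by (simp add: c(2) if_distrib cong: if_cong)
    then show ?thesis by (simp add: \<psi>_def sgn_if)
  qed
  have "norm (Bcontfun \<psi>) \<le> 1"
    by (rule norm_bcontfun_le) (simp add: apply_Bcontfun_torus[OF cont] \<psi>_def abs_le_iff)
  moreover have "blinfun_apply (spikes a x) (Bcontfun \<psi>) = (\<Sum>i\<in>UNIV. \<bar>a $ i\<bar>)"
    by (simp only: spikes_apply apply_Bcontfun_torus[OF cont] \<psi>x abs_sgn)
  ultimately show "(\<Sum>i\<in>UNIV. \<bar>a $ i\<bar>) \<le> tv_norm (spikes a x)"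
    using le_tv_norm[of "Bcontfun \<psi>" "spikes a x"] by simp
qed

lemma spikes_apply_certificate:
  assumes "\<And>i. apply_bcontfun \<eta> (x $ i) = sgn (a $ i)"
  shows "blinfun_apply (spikes a x) \<eta> = (\<Sum>i\<in>UNIV. \<bar>a $ i\<bar>)"
  by (simp add: spikes_apply assms abs_sgn)

lemma tv_norm_spikes_certificate:
  assumes "norm \<eta> \<le> 1" "\<And>i. apply_bcontfun \<eta> (x $ i) = sgn (a $ i)"
  shows "tv_norm (spikes a x) = blinfun_apply (spikes a x) \<eta>"
  using tv_norm_spikes_le[of a x] le_tv_norm[OF assms(1), of "spikes a x"]
  by (simp add: spikes_apply_certificate[OF assms(2)])

text \<open>Each amplitude in modulus bounds its share of the pairing, so equality of the sums
  forces equality termwise; dividing by the nonzero amplitude gives the sign.\<close>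

lemma spikes_certificate_values:
  assumes "inj (\<lambda>i. x $ i)" "\<And>i. a $ i \<noteq> 0"
    and "norm \<eta> \<le> 1" "blinfun_apply (spikes a x) \<eta> = tv_norm (spikes a x)"
  shows "apply_bcontfun \<eta> (x $ i) = sgn (a $ i)"
proof -
  have le: "a $ i * apply_bcontfun \<eta> (x $ i) \<le> \<bar>a $ i\<bar>" for i
  proof -
    have "\<bar>a $ i * apply_bcontfun \<eta> (x $ i)\<bar> \<le> \<bar>a $ i\<bar> * 1"
      unfolding abs_mult using assms(3) abs_apply_bcontfun_le[of \<eta> "x $ i"] by (intro mult_left_mono) auto
    then show ?thesis by linarith
  qed
  have "(\<Sum>i\<in>UNIV. \<bar>a $ i\<bar> - a $ i * apply_bcontfun \<eta> (x $ i)) = 0"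
    using assms(4) unfolding tv_norm_spikes[OF assms(1)] spikes_apply by (simp add: sum_subtractf)
  then have "\<forall>i\<in>UNIV. \<bar>a $ i\<bar> - a $ i * apply_bcontfun \<eta> (x $ i) = 0"
    using le by (subst (asm) sum_nonneg_eq_0_iff) auto
  then have "\<bar>a $ i\<bar> - a $ i * apply_bcontfun \<eta> (x $ i) = 0" by blast
  then have "a $ i * apply_bcontfun \<eta> (x $ i) = a $ i * sgn (a $ i)"
    using abs_sgn[of "a $ i"] by linarith
  then show ?thesis by (rule mult_left_cancel[THEN iffD1, OF assms(2)])
qed

text \<open>Without representing \<open>m\<close> by a measure: if \<open>\<psi>\<close> vanishes where \<open>\<bar>\<eta>\<bar>\<close> is close to \<open>1\<close>, then
  \<open>\<eta> \<plusminus> \<epsilon> \<psi>\<close> is still admissible in the definition of the total variation, so \<open>m \<psi> = 0\<close>.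
  Truncating small values reduces every \<open>\<psi>\<close> that vanishes on the spikes to this case.\<close>

lemma functional_vanishes_off_contact_set:
  fixes m :: radon
  assumes \<eta>: "norm \<eta> \<le> 1" "blinfun_apply m \<eta> = tv_norm m"
    and off: "\<And>t. t \<notin> X \<Longrightarrow> \<bar>apply_bcontfun \<eta> t\<bar> < 1"
    and \<psi>: "continuous_on UNIV \<psi>" "\<And>t. t \<in> X \<Longrightarrow> \<psi> t = 0"
  shows "blinfun_apply m (Bcontfun \<psi>) = 0"
proof -
  have small: "\<bar>blinfun_apply m (Bcontfun \<psi>)\<bar> \<le> norm m * d" if d: "d > 0" for d
  proof -
    \<comment> \<open>Soft thresholding: \<open>\<psi>1\<close> is within \<open>d\<close> of \<psi>
      and vanishes where \<psi> is below \<open>d\<close> in modulus.\<close>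
    define \<psi>1 where "\<psi>1 t = \<psi> t - max (- d) (min d (\<psi> t))" for t
    have c1: "continuous_on UNIV \<psi>1" unfolding \<psi>1_def by (intro continuous_intros \<psi>)
    obtain B where B: "B \<ge> 0" "\<And>t. \<bar>\<psi>1 t\<bar> \<le> B" using that by (rule continuous_torus_bounded[OF c1])
    define K where "K = {t. \<bar>\<psi> t\<bar> \<ge> d}"
    have "closed K" unfolding K_def by (intro closed_Collect_le continuous_intros \<psi>)
    then have "compact K" using compact_torus closed_Int_compact[of K UNIV] by simp
    have "\<exists>q<1. \<forall>t\<in>K. \<bar>apply_bcontfun \<eta> t\<bar> \<le> q"
    proof (cases "K = {}")
      case False
      have "continuous_on K (\<lambda>t. \<bar>apply_bcontfun \<eta> t\<bar>)"
        by (intro continuous_on_rabs continuous_on_apply_bcontfun)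
      from continuous_attains_sup[OF \<open>compact K\<close> False this]
      obtain t0 where t0: "t0 \<in> K" "\<And>t. t \<in> K \<Longrightarrow> \<bar>apply_bcontfun \<eta> t\<bar> \<le> \<bar>apply_bcontfun \<eta> t0\<bar>" by blast
      have "t0 \<notin> X" using t0(1) d \<psi>(2) by (auto simp: K_def)
      from off[OF this] t0(2) show ?thesis by blast
    qed (auto intro: exI[of _ 0])
    then obtain q where q: "q < 1" "\<And>t. t \<in> K \<Longrightarrow> \<bar>apply_bcontfun \<eta> t\<bar> \<le> q" by blast
    \<comment> \<open>On \<open>K\<close>, where the certificate is at most \<open>q\<close>, a
      perturbation of this size fits into the gap \<open>1 - q\<close>; off \<open>K\<close> it is
      zero. Both signs are therefore admissible.\<close>
    define e where "e = (1 - q) / (B + 1)"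
    have e: "e > 0" "e * B \<le> 1 - q"
    proof -
      show "e > 0" using q B(1) by (simp add: e_def)
      have "e * (B + 1) = 1 - q" using B(1) by (simp add: e_def)
      then show "e * B \<le> 1 - q" using \<open>e > 0\<close> by (simp add: algebra_simps)
    qed
    have adm: "norm (\<eta> + s *\<^sub>R Bcontfun \<psi>1) \<le> 1" if s: "\<bar>s\<bar> = e" for s
    proof (rule norm_bcontfun_le)
      fix t
      show "\<bar>apply_bcontfun (\<eta> + s *\<^sub>R Bcontfun \<psi>1) t\<bar> \<le> 1"
      proof (cases "t \<in> K")
        case True
        have "\<bar>s * \<psi>1 t\<bar> \<le> e * B" unfolding abs_mult s using B(2) e(1) by (intro mult_left_mono) auto
        then show ?thesis using q(2)[OF True] e(2)
          by (simp add: plus_bcontfun.rep_eq scaleR_bcontfun.rep_eq apply_Bcontfun_torus[OF c1] abs_le_iff)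
      next
        case False
        then have "\<psi>1 t = 0" by (auto simp: \<psi>1_def K_def abs_if split: if_splits)
        then show ?thesis using abs_apply_bcontfun_le[of \<eta> t] \<eta>(1)
          by (simp add: plus_bcontfun.rep_eq scaleR_bcontfun.rep_eq apply_Bcontfun_torus[OF c1])
      qed
    qed
    have "blinfun_apply m \<eta> + s * blinfun_apply m (Bcontfun \<psi>1) \<le> blinfun_apply m \<eta>" if "\<bar>s\<bar> = e" for s
      using le_tv_norm[OF adm[OF that], of m] \<eta>(2) by (simp add: blinfun.add_right blinfun.scaleR_right)
    from this[of e] this[of "- e"] have "blinfun_apply m (Bcontfun \<psi>1) = 0"
      using e(1) by (simp add: mult_le_0_iff zero_le_mult_iff)
    moreover have "norm (Bcontfun \<psi> - Bcontfun \<psi>1) \<le> d"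
      by (rule norm_bcontfun_le)
        (use d in \<open>simp add: minus_bcontfun.rep_eq apply_Bcontfun_torus[OF c1] apply_Bcontfun_torus[OF \<psi>(1)] \<psi>1_def abs_le_iff\<close>)
    then have "norm m * norm (Bcontfun \<psi> - Bcontfun \<psi>1) \<le> norm m * d" by (rule mult_left_mono) simp
    ultimately show ?thesis
      using abs_blinfun_real_le[of m "Bcontfun \<psi> - Bcontfun \<psi>1"] by (simp add: blinfun.diff_right)
  qed
  show ?thesis
  proof (rule ccontr)
    assume "\<not> ?thesis"
    then have pos: "\<bar>blinfun_apply m (Bcontfun \<psi>)\<bar> > 0" (is "?x > 0") by simp
    define d where "d = ?x / 2 / (norm m + 1)"
    have Q: "norm m + 1 > 0" by (simp add: add_nonneg_pos)
    then have d: "d > 0" using pos by (simp add: d_def)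
    have "d * (norm m + 1) = ?x / 2" unfolding d_def by (rule pos_divide_times_cancel[OF Q])
    then have "norm m * d < ?x" using pos d by (simp add: algebra_simps)
    then show False using small[OF d] by simp
  qed
qed

text \<open>Subtracting the interpolant of a test function at the spikes leaves one that vanishes on
  the contact set, hence is annihilated by \<open>m\<close>; the values of \<open>m\<close> on the
  interpolation functions are the amplitudes.\<close>

lemma functional_eq_spikes:
  fixes m :: radon and x :: "torus ^ 'n"
  assumes \<eta>: "norm \<eta> \<le> 1" "blinfun_apply m \<eta> = tv_norm m"
    and off: "\<And>t. t \<notin> range (\<lambda>i. x $ i) \<Longrightarrow> \<bar>apply_bcontfun \<eta> t\<bar> < 1"
    and inj: "inj (\<lambda>i. x $ i)"
  shows "\<exists>b. m = spikes b x"
proof -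
  obtain c where "(\<forall>i. continuous_on UNIV (c i)) \<and> (\<forall>i j. c i (x $ j) = (if i = j then 1 else 0 :: real))"
    using torus_interpolation[OF inj] ..
  then have c: "\<And>i. continuous_on UNIV (c i)" "\<And>i j. c i (x $ j) = (if i = j then 1 else 0)"
    by auto
  have "m = spikes (\<chi> i. blinfun_apply m (Bcontfun (c i))) x"
  proof (rule blinfun_eqI)
    fix \<psi> :: "torus \<Rightarrow>\<^sub>C real"
    define g where "g t = apply_bcontfun \<psi> t - (\<Sum>i\<in>UNIV. apply_bcontfun \<psi> (x $ i) * c i t)" for t
    have cg: "continuous_on UNIV g" unfolding g_def by (intro continuous_intros continuous_on_apply_bcontfun c)
    have "g t = 0" if "t \<in> range (\<lambda>i. x $ i)" for t
      using that by (auto simp: g_def c(2) if_distrib cong: if_cong)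
    then have "blinfun_apply m (Bcontfun g) = 0"
      using functional_vanishes_off_contact_set[OF \<eta> off cg] by blast
    moreover have "Bcontfun g = \<psi> - (\<Sum>i\<in>UNIV. apply_bcontfun \<psi> (x $ i) *\<^sub>R Bcontfun (c i))"
      by (rule bcontfun_eqI) (simp add: apply_Bcontfun_torus[OF cg] minus_bcontfun.rep_eq apply_bcontfun_sum
          scaleR_bcontfun.rep_eq apply_Bcontfun_torus[OF c(1)] g_def)
    ultimately show "blinfun_apply m \<psi> = blinfun_apply (spikes (\<chi> i. blinfun_apply m (Bcontfun (c i))) x) \<psi>"
      by (simp add: spikes_apply blinfun.diff_right blinfun.sum_right blinfun.scaleR_right mult.commute)
  qed
  then show ?thesis ..
qed

text \<open>Sufficiency of the optimality condition \<open>\<Phi>\<^sup>* p \<in> \<partial>\<parallel>m\<parallel>\<close> with \<open>\<lambda> p = y - \<Phi> m\<close>; for \<open>\<lambda> = 0\<close> the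
  certificate \<open>p\<close> is unrelated to the data. Strictness off the spikes gives uniqueness.\<close>

lemma solves_P_unique_of_certificate:
  fixes x :: "torus ^ 'n"
  assumes f: "continuous_on UNIV f" and l: "l \<ge> 0"
    and res: "y - forward f (spikes a x) = l *\<^sub>R p"
    and at: "\<And>i. inner (shift_l2 f (x $ i)) p = sgn (a $ i)"
    and off: "\<And>t. t \<notin> range (\<lambda>i. x $ i) \<Longrightarrow> \<bar>inner (shift_l2 f t) p\<bar> < 1"
    and inj: "inj (\<lambda>i. x $ i)"
    and indep: "\<And>b. (\<Sum>i\<in>UNIV. b $ i *\<^sub>R shift_l2 f (x $ i)) = 0 \<Longrightarrow> b = 0"
  shows "solves_P f l y (spikes a x)" "\<exists>!m. solves_P f l y m"
proof -
  define m where "m = spikes a x"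
  define \<eta> where "\<eta> = adjoint_forward f p"
  have app: "apply_bcontfun \<eta> t = inner (shift_l2 f t) p" for t
    unfolding \<eta>_def by (rule apply_adjoint_forward[OF f])
  have le1: "\<bar>inner (shift_l2 f t) p\<bar> \<le> 1" for t
  proof (cases "t \<in> range (\<lambda>i. x $ i)")
    case True
    then show ?thesis using at by (auto simp: sgn_if)
  qed (use off less_imp_le in blast)
  have n\<eta>: "norm \<eta> \<le> 1" by (rule norm_bcontfun_le) (simp add: app le1)
  have tvm: "tv_norm m = blinfun_apply m \<eta>"
    unfolding m_def by (rule tv_norm_spikes_certificate[OF n\<eta>]) (simp add: app at)
  have dual: "inner (forward f m') p = blinfun_apply m' \<eta>" for m'
    unfolding \<eta>_def by (rule inner_forward[OF f])
  \<comment> \<open>The first condition confines \<open>m'\<close> to the spikes; equality of the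
    data then fixes its amplitudes by independence.\<close>
  have uniq: "m' = m" if m': "blinfun_apply m' \<eta> = tv_norm m'" "forward f m' = forward f m" for m'
  proof -
    have "\<exists>b. m' = spikes b x"
      by (rule functional_eq_spikes[OF n\<eta> m'(1) _ inj]) (simp add: app off)
    then obtain b where b: "m' = spikes b x" ..
    have "(\<Sum>i\<in>UNIV. (b - a) $ i *\<^sub>R shift_l2 f (x $ i)) = 0"
      using m'(2) unfolding b m_def forward_spikes[OF f] by (simp add: scaleR_diff_left sum_subtractf)
    from indep[OF this] show ?thesis unfolding b m_def by simp
  qed
  have "solves_P f l y m \<and> (\<forall>m'. solves_P f l y m' \<longrightarrow> m' = m)"
  proof (cases "l = 0")
    case True
    then have y: "forward f m = y" using res by (simp add: m_def)
    \<comment> \<open>Pairing the constraint with \<open>p\<close> shows that \<eta> has the same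
      integral, \<open>tv_norm m\<close>, against every admissible measure.\<close>
    have lower: "tv_norm m \<le> blinfun_apply m' \<eta>" if "forward f m' = y" for m'
      using dual[of m'] dual[of m] that y tvm by simp
    have opt: "tv_norm m \<le> tv_norm m'" if "forward f m' = y" for m'
      using lower[OF that] le_tv_norm[OF n\<eta>, of m'] by linarith
    have "m' = m" if "forward f m' = y" "tv_norm m' \<le> tv_norm m" for m'
    proof (rule uniq)
      show "blinfun_apply m' \<eta> = tv_norm m'"
        using lower[OF that(1)] le_tv_norm[OF n\<eta>, of m'] that(2) by linarith
      show "forward f m' = forward f m" using that(1) y by simp
    qed
    then show ?thesis using True y opt by (auto simp: solves_P_def)
  next
    case False
    then have lpos: "l > 0" using l by simp
    let ?J = "\<lambda>m'. 1/2 * (norm (forward f m' - y))\<^sup>2 + l * tv_norm m'"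
    \<comment> \<open>An exact identity: completing the square leaves the squared distance of the
      data and \<open>l\<close> times a Bregman distance of the total variation. Both are
      nonnegative, and both vanish at any other minimiser.\<close>
    have gap: "?J m' - ?J m = 1/2 * (norm (forward f m' - forward f m))\<^sup>2 + l * (tv_norm m' - blinfun_apply m' \<eta>)" for m'
    proof -
      have sq: "(norm (u - l *\<^sub>R p))\<^sup>2 = (norm u)\<^sup>2 - 2 * l * inner u p + (norm (l *\<^sub>R p))\<^sup>2" for u
        unfolding power2_norm_eq_inner
        by (simp add: inner_diff_left inner_diff_right inner_commute algebra_simps power2_eq_square)
      have "forward f m' - y = (forward f m' - forward f m) - l *\<^sub>R p" using res by (simp add: m_def algebra_simps)
      then have "(norm (forward f m' - y))\<^sup>2 = (norm (forward f m' - forward f m))\<^sup>2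
          - 2 * l * inner (forward f m' - forward f m) p + (norm (l *\<^sub>R p))\<^sup>2"
        by (simp only: sq)
      moreover have "norm (forward f m - y) = norm (l *\<^sub>R p)"
        unfolding res[symmetric] m_def by (rule norm_minus_commute)
      ultimately show ?thesis
        by (simp add: inner_diff_left dual tvm algebra_simps)
    qed
    have nonneg: "l * (tv_norm m' - blinfun_apply m' \<eta>) \<ge> 0" for m'
      using le_tv_norm[OF n\<eta>, of m'] lpos by simp
    have opt: "?J m \<le> ?J m'" for m' 
      using gap[of m'] nonneg[of m'] zero_le_power2[of "norm (forward f m' - forward f m)"] by linarith
    have "m' = m" if "?J m' \<le> ?J m" for m'
    proof (rule uniq)
      have *: "1/2 * (norm (forward f m' - forward f m))\<^sup>2 + l * (tv_norm m' - blinfun_apply m' \<eta>) \<le> 0"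
        using gap[of m'] that by linarith
      have "(norm (forward f m' - forward f m))\<^sup>2 = 0" "l * (tv_norm m' - blinfun_apply m' \<eta>) = 0"
        using * nonneg[of m'] zero_le_power2[of "norm (forward f m' - forward f m)"] by linarith+
      then show "forward f m' = forward f m" "blinfun_apply m' \<eta> = tv_norm m'" using lpos by auto
    qed
    then show ?thesis using False opt by (auto simp: solves_P_def)
  qed
  then show "solves_P f l y (spikes a x)" "\<exists>!m. solves_P f l y m" unfolding m_def by blast+
qed

section \<open>The minimal norm certificate\<close>

text \<open>The adjoint of \<open>Gamma_map\<close> in coordinates: it lists the values and the
  slopes of the dual function Phi^* p at the positions.\<close>

definition Gamma_adjoint :: "(torus \<Rightarrow> real) \<Rightarrow> torus ^ 'n \<Rightarrow> l2 \<Rightarrow> (real ^ 'n) \<times> (real ^ 'n)" where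
  "Gamma_adjoint f x p =
    (\<chi> i. inner (shift_l2 f (x $ i)) p, \<chi> i. inner (shift_l2 (tderiv f) (x $ i)) p)"

lemma linear_Gamma_adjoint: "linear (Gamma_adjoint f x)"
  by (rule linearI) (auto simp: Gamma_adjoint_def vec_eq_iff inner_add_right)

lemma linear_Gamma_map:
  fixes x :: "torus ^ 'n"
  shows "linear (Gamma_map f x)"
proof (rule linearI)
  fix u v :: "(real ^ 'n) \<times> (real ^ 'n)" and c :: real
  obtain u1 u2 v1 v2 where [simp]: "u = (u1, u2)" "v = (v1, v2)" by (cases u, cases v)
  show "Gamma_map f x (u + v) = Gamma_map f x u + Gamma_map f x v"
    by (simp add: Gamma_map_shift_l2 scaleR_add_left sum.distrib)
  show "Gamma_map f x (c *\<^sub>R u) = c *\<^sub>R Gamma_map f x u"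
    by (simp add: Gamma_map_shift_l2 scaleR_sum_right scaleR_add_right)
qed

lemma inner_Gamma_adjoint: "inner (Gamma_adjoint f x p) u = inner p (Gamma_map f x u)"
proof -
  obtain u1 u2 where [simp]: "u = (u1, u2)" by (cases u)
  show ?thesis
    by (simp add: Gamma_adjoint_def Gamma_map_shift_l2 inner_prod_def inner_vec_def inner_add_right
        inner_sum_right inner_commute mult.commute)
qed

lemma norm_Gamma_adjoint_le:
  fixes x :: "torus ^ 'n"
  assumes "continuous_on UNIV f" "continuous_on UNIV (tderiv f)"
  obtains N where "N > 0" "\<And>(x :: torus ^ 'n) p. norm (Gamma_adjoint f x p) \<le> N * norm p"
proof -
  obtain B0 where B0: "B0 \<ge> 0" "\<And>t. \<bar>f t\<bar> \<le> B0" using that by (rule continuous_torus_bounded[OF assms(1)])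
  obtain B1 where B1: "B1 \<ge> 0" "\<And>t. \<bar>tderiv f t\<bar> \<le> B1" using that by (rule continuous_torus_bounded[OF assms(2)])
  have "norm (Gamma_adjoint f x p) \<le> (real CARD('n) * (B0 + B1) + 1) * norm p" for x :: "torus ^ 'n" and p
  proof -
    have "norm (Gamma_adjoint f x p) \<le> (\<Sum>i\<in>UNIV. norm (inner (shift_l2 f (x $ i)) p)) + (\<Sum>i\<in>UNIV. norm (inner (shift_l2 (tderiv f) (x $ i)) p))"
      unfolding Gamma_adjoint_def
      by (rule order_trans[OF norm_Pair_le add_mono]) (rule order_trans[OF norm_le_l1_cart], simp)+
    also have "\<dots> \<le> (\<Sum>i\<in>(UNIV::'n set). B0 * norm p) + (\<Sum>i\<in>(UNIV::'n set). B1 * norm p)"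
      using abs_inner_shift_l2_le[OF assms(1) B0(2)] abs_inner_shift_l2_le[OF assms(2) B1(2)]
      by (intro add_mono sum_mono) auto
    also have "\<dots> \<le> (real CARD('n) * (B0 + B1) + 1) * norm p" by (simp add: algebra_simps)
    finally show ?thesis .
  qed
  moreover have "real CARD('n) * (B0 + B1) + 1 > 0" using B0(1) B1(1) by (simp add: add_nonneg_pos)
  ultimately show ?thesis using that by blast
qed

text \<open>Pairing with \<open>u\<close> turns the composition into the squared norm of
  \<open>Gamma_map f x u\<close>. It maps a finite-dimensional space to itself, so injectivity makes
  it invertible although \<open>Gamma_map\<close> lands in L2.\<close>

lemma inj_Gamma_adjoint_Gamma_map:
  assumes "inj (Gamma_map f x)"
  shows "linear (\<lambda>u. Gamma_adjoint f x (Gamma_map f x u))" "inj (\<lambda>u. Gamma_adjoint f x (Gamma_map f x u))"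
proof -
  show lin: "linear (\<lambda>u. Gamma_adjoint f x (Gamma_map f x u))"
    using linear_compose[OF linear_Gamma_map linear_Gamma_adjoint] by (simp add: o_def)
  show "inj (\<lambda>u. Gamma_adjoint f x (Gamma_map f x u))"
    unfolding linear_injective_0[OF lin]
  proof (intro allI impI)
    fix u assume "Gamma_adjoint f x (Gamma_map f x u) = 0"
    then have "inner (Gamma_map f x u) (Gamma_map f x u) = 0"
      using inner_Gamma_adjoint[of f x "Gamma_map f x u" u] by simp
    then show "u = 0" using assms unfolding linear_injective_0[OF linear_Gamma_map] by (cases u) simp
  qed
qed

text \<open>The dual value of \<open>p\<close> is \<open>m\<close> applied to its dual function, at
  most \<open>tv_norm m\<close>; as \<open>p1\<close> attains this bound, the dual solutions are
  exactly the certificates.\<close>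

lemma solves_D0_iff_of_certificate:
  fixes m :: radon
  assumes f: "continuous_on UNIV f" and p1: "norm (adjoint_forward f p1) \<le> 1"
    "blinfun_apply m (adjoint_forward f p1) = tv_norm m"
  shows "solves_D0 f (forward f m) p \<longleftrightarrow>
    norm (adjoint_forward f p) \<le> 1 \<and> blinfun_apply m (adjoint_forward f p) = tv_norm m"
  unfolding solves_D0_def inner_forward[OF f]
  using le_tv_norm[of _ m] p1 by (metis antisym)

lemma norm_adjoint_le_1_iff:
  assumes "continuous_on UNIV f"
  shows "norm (adjoint_forward f p) \<le> 1 \<longleftrightarrow> (\<forall>t. \<bar>inner (shift_l2 f t) p\<bar> \<le> 1)"
  using norm_bcontfun_le[of "adjoint_forward f p" 1] abs_apply_bcontfun_le[of "adjoint_forward f p"]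
  unfolding apply_adjoint_forward[OF assms] by (meson order_trans)

text \<open>Turns the definite description into a vector with its minimality property. The
  constraints are bounds on continuous linear functionals and one linear equation, so the
  certificates form a closed convex set.\<close>

lemma minimal_norm_certificate:
  fixes m :: radon
  assumes f: "continuous_on UNIV f" and \<eta>: "\<eta> \<in> range (adjoint_forward f)" "\<eta> \<in> subdiff_tv m"
  obtains p0 where "min_norm_certificate f (forward f m) = adjoint_forward f p0"
    "norm (adjoint_forward f p0) \<le> 1" "blinfun_apply m (adjoint_forward f p0) = tv_norm m"
    "\<And>p. norm (adjoint_forward f p) \<le> 1 \<Longrightarrow> blinfun_apply m (adjoint_forward f p) = tv_norm m \<Longrightarrow> norm p0 \<le> norm p"
proof -
  obtain p1 where p1: "norm (adjoint_forward f p1) \<le> 1" "blinfun_apply m (adjoint_forward f p1) = tv_norm m"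
    using \<eta> by (auto simp: subdiff_tv_def)
  define C where "C = {p. (\<forall>t. \<bar>inner (shift_l2 f t) p\<bar> \<le> 1) \<and> inner (forward f m) p = tv_norm m}"
  have C: "p \<in> C \<longleftrightarrow> norm (adjoint_forward f p) \<le> 1 \<and> blinfun_apply m (adjoint_forward f p) = tv_norm m" for p
    by (simp add: C_def norm_adjoint_le_1_iff[OF f] inner_forward[OF f])
  have D0: "solves_D0 f (forward f m) p \<longleftrightarrow> p \<in> C" for p
    unfolding C by (rule solves_D0_iff_of_certificate[OF f p1])
  have "closed C" unfolding C_def
    by (intro closed_Collect_conj closed_Collect_all closed_Collect_le closed_Collect_eq continuous_intros)
  moreover have "convex C" unfolding convex_def
  proof (intro ballI allI impI)
    fix p q and u v :: real
    assume pq: "p \<in> C" "q \<in> C" and uv: "0 \<le> u" "0 \<le> v" "u + v = 1"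
    have "\<bar>inner (shift_l2 f t) (u *\<^sub>R p + v *\<^sub>R q)\<bar> \<le> 1" for t
    proof -
      have "\<bar>inner (shift_l2 f t) (u *\<^sub>R p + v *\<^sub>R q)\<bar> \<le> u * \<bar>inner (shift_l2 f t) p\<bar> + v * \<bar>inner (shift_l2 f t) q\<bar>"
        using abs_triangle_ineq[of "u * inner (shift_l2 f t) p" "v * inner (shift_l2 f t) q"] uv
        by (simp add: inner_add_right abs_mult)
      also have "\<dots> \<le> u * 1 + v * 1"
        using pq uv by (intro add_mono mult_left_mono) (auto simp: C_def)
      finally show ?thesis using uv by simp
    qed
    moreover have "u * tv_norm m + v * tv_norm m = tv_norm m" using uv(3) by (metis distrib_right mult_1)
    ultimately show "u *\<^sub>R p + v *\<^sub>R q \<in> C" using pq by (simp add: C_def inner_add_right)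
  qed
  moreover have "C \<noteq> {}" using C[of p1] p1 by blast
  ultimately have ex1: "\<exists>!p. p \<in> C \<and> (\<forall>q\<in>C. norm p \<le> norm q)" by (rule closed_convex_minimal_norm)
  define p0 where "p0 = (THE p. p \<in> C \<and> (\<forall>q\<in>C. norm p \<le> norm q))"
  have p0: "p0 \<in> C" "\<And>q. q \<in> C \<Longrightarrow> norm p0 \<le> norm q"
    using theI'[OF ex1] unfolding p0_def by blast+
  have "min_norm_certificate f (forward f m) = adjoint_forward f p0"
    unfolding min_norm_certificate_def D0 p0_def Ball_def ..
  then show ?thesis using p0 C that by blast
qed

text \<open>A lift \<open>\<xi>0\<close> of the positions is part of the data: the implicit function
  theorem needs unknowns from a vector space, which the torus is not.\<close>

locale nondegenerate_spikes =
  fixes f :: "torus \<Rightarrow> real" and a0 \<xi>0 :: "real ^ 'n" and x0 :: "torus ^ 'n"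
  assumes f: "Ck_torus 2 f" and a0: "\<And>i. a0 $ i \<noteq> 0"
    and x0: "x0 = (\<chi> i. to_torus (\<xi>0 $ i))" and inj_x0: "inj (\<lambda>i. x0 $ i)"
    and inj_Gamma: "inj (Gamma_map f x0)" and nd: "ndsc f a0 x0"
begin

abbreviation "T0 r \<equiv> shift_l2 f (to_torus r)"
abbreviation "T1 r \<equiv> shift_l2 (tderiv f) (to_torus r)"
abbreviation "T2 r \<equiv> shift_l2 (tderiv (tderiv f)) (to_torus r)"
abbreviation "y0 \<equiv> forward f (spikes a0 x0)"

lemma f1: "Ck_torus (Suc 1) f" and f2: "Ck_torus (Suc 0) (tderiv f)" and f3: "Ck_torus 0 (tderiv (tderiv f))"
  using f by (simp_all add: numeral_2_eq_2)

lemmas cont_f = Ck_torus_continuous[OF f1] Ck_torus_continuous[OF f2] Ck_torus_continuous[OF f3]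

lemma x0_nth: "x0 $ i = to_torus (\<xi>0 $ i)"
  by (simp add: x0)

definition stable_certificate :: "l2 \<Rightarrow> real \<Rightarrow> real \<Rightarrow> bool" where
  "stable_certificate p0 \<epsilon> \<rho> \<longleftrightarrow> (\<forall>p (\<xi> :: 'n \<Rightarrow> real) t. norm (p - p0) \<le> \<epsilon> \<longrightarrow>
    (\<forall>i. \<bar>\<xi> i - \<xi>0 $ i\<bar> < \<rho> \<and> inner (T0 (\<xi> i)) p = sgn (a0 $ i) \<and> inner (T1 (\<xi> i)) p = 0) \<longrightarrow>
    t \<notin> range (\<lambda>i. to_torus (\<xi> i)) \<longrightarrow> \<bar>inner (shift_l2 f t) p\<bar> < 1)"

text \<open>A perturbation orthogonal to the range of \<open>\<Gamma>\<close> keeps value \<open>\<plusminus> 1\<close> and zero slope at the spikes, so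
  by stability it stays admissible; minimality of the norm then puts the certificate in that range.\<close>

lemma certificate_in_range:
  obtains p0 c0 \<epsilon> \<rho> where "p0 = Gamma_map f x0 c0" "Gamma_adjoint f x0 p0 = (\<chi> i. sgn (a0 $ i), 0)"
    "\<epsilon> > 0" "\<rho> > 0" "stable_certificate p0 \<epsilon> \<rho>"
proof -
  obtain \<eta> where \<eta>: "\<eta> \<in> range (adjoint_forward f)" "\<eta> \<in> subdiff_tv (spikes a0 x0)"
    using nd by (auto simp: ndsc_def)
  obtain p0 where p0: "min_norm_certificate f y0 = adjoint_forward f p0"
    "norm (adjoint_forward f p0) \<le> 1" "blinfun_apply (spikes a0 x0) (adjoint_forward f p0) = tv_norm (spikes a0 x0)"
    "\<And>p. norm (adjoint_forward f p) \<le> 1 \<Longrightarrow>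
      blinfun_apply (spikes a0 x0) (adjoint_forward f p) = tv_norm (spikes a0 x0) \<Longrightarrow> norm p0 \<le> norm p"
    using that by (rule minimal_norm_certificate[OF cont_f(1) \<eta>])
  have app: "apply_bcontfun (adjoint_forward f p) = (\<lambda>t. inner (shift_l2 f t) p)" for p
    by (rule ext) (rule apply_adjoint_forward[OF cont_f(1)])
  have val: "inner (T0 (\<xi>0 $ i)) p0 = sgn (a0 $ i)" for i
    using spikes_certificate_values[OF inj_x0 a0 p0(2,3), of i] by (simp add: app x0_nth)
  have rng: "range (\<lambda>i. x0 $ i) = range (\<lambda>i. to_torus (\<xi>0 $ i))" by (simp add: x0_nth)
  have off: "\<bar>inner (shift_l2 f t) p0\<bar> < 1" if "t \<notin> range (\<lambda>i. to_torus (\<xi>0 $ i))" for t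
    using nd that unfolding ndsc_def p0(1) app Let_def rng by blast
  have curv: "inner (T2 (\<xi>0 $ i)) p0 \<noteq> 0" for i
    using nd unfolding ndsc_def p0(1) app Let_def tderiv_inner_shift_l2[OF f1] tderiv_inner_shift_l2[OF f2]
    by (simp add: x0_nth)
  have sg: "\<bar>sgn (a0 $ i)\<bar> = 1" for i using a0[of i] by (simp add: sgn_if)
  obtain \<epsilon> \<rho> where \<epsilon>: "\<epsilon> > 0" "\<rho> > 0"
    and stab: "\<And>p \<xi> t. norm (p - p0) \<le> \<epsilon> \<Longrightarrow> (\<And>i. \<bar>\<xi> i - \<xi>0 $ i\<bar> < \<rho>) \<Longrightarrow>
      (\<And>i. inner (T0 (\<xi> i)) p = sgn (a0 $ i)) \<Longrightarrow> (\<And>i. inner (T1 (\<xi> i)) p = 0) \<Longrightarrow>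
      t \<notin> range (\<lambda>i. to_torus (\<xi> i)) \<Longrightarrow> \<bar>inner (shift_l2 f t) p\<bar> < 1"
    and crit: "\<And>i. inner (T1 (\<xi>0 $ i)) p0 = 0"
    using certificate_stable[of f "\<lambda>i. sgn (a0 $ i)" "\<lambda>i. \<xi>0 $ i" p0, OF f sg val off curv] by blast
  have orth: "inner p0 h = 0" if h: "Gamma_adjoint f x0 h = 0" for h
  proof (rule ccontr)
    assume nz: "inner p0 h \<noteq> 0"
    have h0: "inner (T0 (\<xi>0 $ i)) h = 0" "inner (T1 (\<xi>0 $ i)) h = 0" for i
      using h by (auto simp: Gamma_adjoint_def vec_eq_iff x0_nth zero_prod_def)
    have min: "norm p0 \<le> norm (p0 + t *\<^sub>R h)" if t: "\<bar>t\<bar> * norm h \<le> \<epsilon>" for t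
    proof (rule p0(4))
      have v: "inner (T0 (\<xi>0 $ i)) (p0 + t *\<^sub>R h) = sgn (a0 $ i)" "inner (T1 (\<xi>0 $ i)) (p0 + t *\<^sub>R h) = 0" for i
        using val crit h0 by (simp_all add: inner_add_right)
      have "\<bar>inner (shift_l2 f s) (p0 + t *\<^sub>R h)\<bar> \<le> 1" for s
      proof (cases "s \<in> range (\<lambda>i. to_torus (\<xi>0 $ i))")
        case True
        then show ?thesis using v(1) sg by auto
      next
        case False
        have "\<bar>inner (shift_l2 f s) (p0 + t *\<^sub>R h)\<bar> < 1"
          by (rule stab[where \<xi> = "\<lambda>i. \<xi>0 $ i"]) (use t \<epsilon> v False in auto)
        then show ?thesis by simp
      qed
      then show n1: "norm (adjoint_forward f (p0 + t *\<^sub>R h)) \<le> 1"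
        by (simp add: norm_adjoint_le_1_iff[OF cont_f(1)])
      show "blinfun_apply (spikes a0 x0) (adjoint_forward f (p0 + t *\<^sub>R h)) = tv_norm (spikes a0 x0)"
        by (rule tv_norm_spikes_certificate[OF n1, symmetric]) (simp add: app v x0_nth)
    qed
    define c where "c = inner p0 h"
    \<comment> \<open>The competitor is p0 - s c h. The first bound keeps it within \<epsilon> of
      \<open>p0\<close>, hence admissible; the second keeps the quadratic term of its squared norm
      below the linear decrease, against minimality.\<close>
    define s where "s = min (\<epsilon> / (\<bar>c\<bar> * norm h + 1)) (1 / ((norm h)\<^sup>2 + 1))"
    have pos: "\<bar>c\<bar> * norm h + 1 > 0" "(norm h)\<^sup>2 + 1 > 0" by (simp_all add: add_nonneg_pos)
    have s: "s > 0" unfolding s_def using \<epsilon>(1) pos by simp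
    have "s \<le> \<epsilon> / (\<bar>c\<bar> * norm h + 1)" by (simp add: s_def)
    then have "s * (\<bar>c\<bar> * norm h + 1) \<le> \<epsilon>" using pos(1) by (simp only: pos_le_divide_eq)
    then have "\<bar>- (s * c)\<bar> * norm h \<le> \<epsilon>" using s by (simp add: abs_mult algebra_simps)
    from min[OF this] have "(norm p0)\<^sup>2 \<le> (norm (p0 + (- (s * c)) *\<^sub>R h))\<^sup>2" by (intro power_mono) auto
    also have "\<dots> = (norm p0)\<^sup>2 - 2 * s * c * c + (s * c)\<^sup>2 * (norm h)\<^sup>2"
      by (simp only: power2_norm_eq_inner) (simp add: inner_add_left inner_add_right inner_commute c_def power2_eq_square algebra_simps)
    finally have "s * c\<^sup>2 * 2 \<le> s * c\<^sup>2 * (s * (norm h)\<^sup>2)" by (simp add: power2_eq_square algebra_simps)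
    moreover have "s * c\<^sup>2 > 0" using s nz by (simp add: c_def)
    ultimately have "2 \<le> s * (norm h)\<^sup>2" by (simp only: mult_le_cancel_left_pos)
    moreover have "s * ((norm h)\<^sup>2 + 1) \<le> 1"
    proof -
      have "s \<le> 1 / ((norm h)\<^sup>2 + 1)" by (simp add: s_def)
      then show ?thesis using pos(2) by (simp only: pos_le_divide_eq)
    qed
    ultimately show False using s by (simp add: algebra_simps)
  qed
  note bij = inj_Gamma_adjoint_Gamma_map[OF inj_Gamma]
  \<comment> \<open>The composition is onto, so \<open>p0\<close> is a vector of the range plus a
    residual in the kernel of the adjoint. The residual is orthogonal to both \<open>p0\<close> and
    the range, hence zero.\<close>
  obtain c0 where c0: "Gamma_adjoint f x0 (Gamma_map f x0 c0) = Gamma_adjoint f x0 p0"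
    using linear_injective_imp_surjective[OF bij refl] by (metis surjD)
  define h where "h = p0 - Gamma_map f x0 c0"
  have Ah: "Gamma_adjoint f x0 h = 0" unfolding h_def by (simp add: linear_diff[OF linear_Gamma_adjoint] c0)
  have "inner h h = inner p0 h - inner h (Gamma_map f x0 c0)"
    by (simp add: h_def inner_diff_left inner_diff_right inner_commute)
  also have "\<dots> = 0" using orth[OF Ah] inner_Gamma_adjoint[of f x0 h c0] Ah by simp
  finally have "p0 = Gamma_map f x0 c0" by (simp add: h_def)
  moreover have "Gamma_adjoint f x0 p0 = (\<chi> i. sgn (a0 $ i), 0)"
    using val crit by (simp add: Gamma_adjoint_def x0_nth vec_eq_iff)
  moreover have "stable_certificate p0 \<epsilon> \<rho>" unfolding stable_certificate_def using stab by blast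
  ultimately show ?thesis using \<epsilon> that by blast
qed

end

section \<open>The optimality map\<close>

lemmas uniform_Ck_add_single =
  uniform_Ck_add_image[where I = "{()}" and f = "\<lambda>_. f" and g = "\<lambda>_. g" for f g, simplified]
lemmas uniform_Ck_bilinear_single =
  uniform_Ck_bilinear_image[where I = "{()}" and f = "\<lambda>_. f" and g = "\<lambda>_. g" for f g, simplified]
lemmas uniform_Ck_sum_single =
  uniform_Ck_sum_image[where I = "{()}" and f = "\<lambda>b _. f b" for f, simplified]
lemmas uniform_Ck_bounded_linear_single =
  uniform_Ck_bounded_linear_image[where I = "{()}" and f = "\<lambda>_. f" for f, simplified]
lemmas uniform_Ck_const_single =
  uniform_Ck_const[where I = "{()}" and c = "\<lambda>_. c" and K = "norm c" for c, simplified]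

lemma shift_l2_uniformly_continuous:
  assumes f: "continuous_on UNIV f" and e: "e > 0"
  obtains d where "d > 0"
    "\<And>r r'. \<bar>r - r'\<bar> < d \<Longrightarrow> norm (shift_l2 f (to_torus r) - shift_l2 f (to_torus r')) \<le> e"
proof -
  obtain d where d: "d > 0" "\<And>x y. dist x y < d \<Longrightarrow> \<bar>f x - f y\<bar> < e"
    using that by (rule uniformly_continuous_torus[OF f e])
  show ?thesis
  proof (rule that[OF d(1)])
    fix r r' assume r: "\<bar>r - r'\<bar> < d"
    show "norm (shift_l2 f (to_torus r) - shift_l2 f (to_torus r')) \<le> e"
    proof (rule norm_shift_l2_diff_le[OF f])
      fix s
      have "dist (to_torus r - s) (to_torus r' - s) < d" using r dist_to_torus_le[of r r'] by simp
      from d(2)[OF this] show "\<bar>f (to_torus r - s) - f (to_torus r' - s)\<bar> \<le> e" by simp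
    qed
  qed
qed

lemma sgn_near:
  assumes "\<bar>b - c\<bar> < \<bar>c\<bar>" shows "sgn b = sgn (c :: real)"
  using assms by (auto simp: sgn_if abs_if split: if_splits)

context nondegenerate_spikes
begin

definition tor :: "real ^ 'n \<Rightarrow> torus ^ 'n" where
  "tor \<xi> = (\<chi> i. to_torus (\<xi> $ i))"

definition synthesis :: "(real ^ 'n) \<times> (real ^ 'n) \<Rightarrow> l2" where
  "synthesis u = (\<Sum>i\<in>UNIV. fst u $ i *\<^sub>R T0 (snd u $ i))"

definition sgn0 :: "(real ^ 'n) \<times> (real ^ 'n)" where
  "sgn0 = (\<chi> i. sgn (a0 $ i), 0)"

text \<open>The equations \<open>\<Gamma>\<^sub>x\<^sup>* (\<Phi>\<^sub>x a - y\<^sub>0 - w) + \<lambda> (sgn a\<^sub>0, 0) = 0\<close>, i.e. the certificate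
  \<open>(y\<^sub>0 + w - \<Phi>\<^sub>x a) / \<lambda>\<close> takes the right values with zero slope at \<open>x\<close>. Positions are lifted to the reals.\<close>

definition optimality :: "(real \<times> l2) \<times> (real ^ 'n) \<times> (real ^ 'n) \<Rightarrow> (real ^ 'n) \<times> (real ^ 'n)" where
  "optimality z = Gamma_adjoint f (tor (snd (snd z))) (synthesis (snd z) - y0 - snd (fst z)) + fst (fst z) *\<^sub>R sgn0"

lemma tor_nth [simp]: "tor \<xi> $ i = to_torus (\<xi> $ i)"
  by (simp add: tor_def)

lemma tor_\<xi>0: "tor \<xi>0 = x0"
  by (simp add: tor_def x0)

lemma forward_spikes_tor: "forward f (spikes a (tor \<xi>)) = synthesis (a, \<xi>)"
  by (simp add: forward_spikes[OF cont_f(1)] synthesis_def)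

lemma synthesis_0: "synthesis (a0, \<xi>0) = y0"
  by (simp add: forward_spikes_tor[symmetric] tor_\<xi>0)

lemma optimality_0: "optimality ((0, 0), (a0, \<xi>0)) = 0"
  by (simp add: optimality_def synthesis_0 linear_0[OF linear_Gamma_adjoint])

text \<open>The equations contain translates of the kernel and of its first derivative, so one order
  is lost against the kernel. This is the origin of C^(k-1).\<close>

lemma uniform_Ck_optimality:
  assumes "Ck_torus (Suc j) f"
  shows "uniform_Ck j UNIV {optimality}"
proof -
  have lin2: "bounded_linear (\<lambda>z :: (real \<times> l2) \<times> (real ^ 'n) \<times> (real ^ 'n). snd (snd z) $ i)"
    and lin1: "bounded_linear (\<lambda>z :: (real \<times> l2) \<times> (real ^ 'n) \<times> (real ^ 'n). fst (snd z) $ i)" for i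
    by (intro bounded_linear_compose[OF bounded_linear_vec_nth] bounded_linear_compose[OF bounded_linear_snd]
        bounded_linear_compose[OF bounded_linear_fst] bounded_linear_snd)+
  have lin_w: "bounded_linear (\<lambda>z :: (real \<times> l2) \<times> (real ^ 'n) \<times> (real ^ 'n). - snd (fst z))"
    by (intro bounded_linear_minus bounded_linear_compose[OF bounded_linear_snd] bounded_linear_fst)
  have lin_l: "bounded_linear (\<lambda>z :: (real \<times> l2) \<times> (real ^ 'n) \<times> (real ^ 'n). fst (fst z) *\<^sub>R sgn0)"
    by (intro bounded_linear_scaleR_const bounded_linear_compose[OF bounded_linear_fst] bounded_linear_fst)
  have T0: "uniform_Ck j UNIV {\<lambda>z :: (real \<times> l2) \<times> (real ^ 'n) \<times> (real ^ 'n). T0 (snd (snd z) $ i)}" for i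
    using uniform_Ck_comp_linear[OF uniform_Ck_le[OF uniform_Ck_shift_l2[OF assms] le_SucI[OF order_refl]] open_UNIV lin2, of UNIV i]
    by simp
  have "Ck_torus j (tderiv f)" using assms by simp
  from uniform_Ck_comp_linear[OF uniform_Ck_shift_l2[OF this] open_UNIV lin2, of UNIV]
  have T1: "uniform_Ck j UNIV {\<lambda>z :: (real \<times> l2) \<times> (real ^ 'n) \<times> (real ^ 'n). T1 (snd (snd z) $ i)}" for i
    by simp
  have R: "uniform_Ck j UNIV {\<lambda>z :: (real \<times> l2) \<times> (real ^ 'n) \<times> (real ^ 'n). (\<Sum>i\<in>UNIV. fst (snd z) $ i *\<^sub>R T0 (snd (snd z) $ i)) + (- y0 + - snd (fst z))}"
    by (intro uniform_Ck_add_single uniform_Ck_sum_single uniform_Ck_bilinear_single[OF bounded_bilinear_scaleR]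
        uniform_Ck_const_single uniform_Ck_linear lin_w lin1 T0) simp
  have R': "(\<lambda>z. (\<Sum>i\<in>UNIV. fst (snd z) $ i *\<^sub>R T0 (snd (snd z) $ i)) + (- y0 + - snd (fst z))) =
      (\<lambda>z. synthesis (snd z) - y0 - snd (fst z))"
    by (simp add: synthesis_def fun_eq_iff)
  note R = R[unfolded R']
  have e: "uniform_Ck j UNIV {\<lambda>z. (\<Sum>i\<in>UNIV. inner (T0 (snd (snd z) $ i)) (synthesis (snd z) - y0 - snd (fst z)) *\<^sub>R (axis i 1, 0)) +
      ((\<Sum>i\<in>UNIV. inner (T1 (snd (snd z) $ i)) (synthesis (snd z) - y0 - snd (fst z)) *\<^sub>R (0, axis i 1)) + fst (fst z) *\<^sub>R sgn0)}"
    by (intro uniform_Ck_add_single uniform_Ck_sum_single uniform_Ck_bilinear_single[OF bounded_bilinear_inner]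
        uniform_Ck_bounded_linear_single[OF bounded_linear_scaleR_left] uniform_Ck_linear lin_l T0 T1 R) simp_all
  have ax: "(\<Sum>i\<in>UNIV. c i *\<^sub>R axis i 1) = (\<chi> i. c i)" for c :: "'n \<Rightarrow> real"
    by (simp add: vec_eq_iff axis_def if_distrib cong: if_cong)
  have "(\<lambda>z. (\<Sum>i\<in>UNIV. inner (T0 (snd (snd z) $ i)) (synthesis (snd z) - y0 - snd (fst z)) *\<^sub>R (axis i 1, 0)) +
      ((\<Sum>i\<in>UNIV. inner (T1 (snd (snd z) $ i)) (synthesis (snd z) - y0 - snd (fst z)) *\<^sub>R (0, axis i 1)) + fst (fst z) *\<^sub>R sgn0)) = optimality"
    by (rule ext) (simp add: optimality_def Gamma_adjoint_def prod_eq_iff fst_sum snd_sum ax)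
  then show ?thesis using e by simp
qed

text \<open>Moving a spike changes the data by its amplitude times a translate of the derivative of
  the kernel: this is the diagonal factor by which the derivative of the synthesis differs from
  \<open>Gamma_map\<close>.\<close>

definition amplitude_scale :: "(real ^ 'n) \<times> (real ^ 'n) \<Rightarrow> (real ^ 'n) \<times> (real ^ 'n)" where
  "amplitude_scale v = (fst v, \<chi> i. a0 $ i * snd v $ i)"

lemma linear_amplitude_scale: "linear amplitude_scale"
  by (rule linearI) (auto simp: amplitude_scale_def vec_eq_iff algebra_simps)

lemma amplitude_scale_eq_0: "amplitude_scale v = 0 \<Longrightarrow> v = 0"
  using a0 by (auto simp: amplitude_scale_def vec_eq_iff prod_eq_iff)

lemma synthesis_has_derivative:
  "(synthesis has_derivative (\<lambda>v. Gamma_map f x0 (amplitude_scale v))) (at (a0, \<xi>0))"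
proof -
  have l1: "((\<lambda>u :: (real ^ 'n) \<times> (real ^ 'n). fst u $ i) has_derivative (\<lambda>v. fst v $ i)) F"
    and l2: "((\<lambda>u :: (real ^ 'n) \<times> (real ^ 'n). snd u $ i) has_derivative (\<lambda>v. snd v $ i)) F" for i F
    by (intro bounded_linear_imp_has_derivative bounded_linear_compose[OF bounded_linear_vec_nth]
        bounded_linear_fst bounded_linear_snd)+
  have T: "((\<lambda>u :: (real ^ 'n) \<times> (real ^ 'n). T0 (snd u $ i)) has_derivative (\<lambda>v. (snd v $ i) *\<^sub>R T1 (\<xi>0 $ i))) (at (a0, \<xi>0))" for i
    using has_derivative_compose[OF l2[of i "at (a0, \<xi>0)"]
        shift_l2_has_vector_derivative[OF f1, unfolded has_vector_derivative_def]] by simp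
  have "((\<lambda>u. \<Sum>i\<in>UNIV. fst u $ i *\<^sub>R T0 (snd u $ i)) has_derivative
      (\<lambda>v. \<Sum>i\<in>UNIV. fst (a0, \<xi>0) $ i *\<^sub>R ((snd v $ i) *\<^sub>R T1 (\<xi>0 $ i)) + fst v $ i *\<^sub>R T0 (snd (a0, \<xi>0) $ i))) (at (a0, \<xi>0))"
    by (intro has_derivative_sum has_derivative_scaleR l1 T)
  moreover have "(\<lambda>v. \<Sum>i\<in>UNIV. fst (a0, \<xi>0) $ i *\<^sub>R ((snd v $ i) *\<^sub>R T1 (\<xi>0 $ i)) + fst v $ i *\<^sub>R T0 (snd (a0, \<xi>0) $ i)) =
      (\<lambda>v. Gamma_map f x0 (amplitude_scale v))"
    by (simp add: fun_eq_iff amplitude_scale_def Gamma_map_shift_l2 x0_nth sum.distrib add.commute)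
  ultimately show ?thesis unfolding synthesis_def[abs_def] by simp
qed

text \<open>The residual vanishes at the base point, so the dependence of the adjoint on the
  positions contributes nothing to the derivative; what remains is the adjoint at \<open>x0\<close>
  applied to the derivative of the synthesis.\<close>

lemma optimality_nondegenerate:
  assumes "frechet_derivative optimality (at ((0, 0), (a0, \<xi>0))) (0, v) = 0"
  shows "v = 0"
proof -
  let ?P = "((0, 0), (a0, \<xi>0)) :: (real \<times> l2) \<times> (real ^ 'n) \<times> (real ^ 'n)"
  let ?F' = "frechet_derivative optimality (at ?P)"
  have "uniform_Ck (Suc 0) UNIV {optimality}" using uniform_Ck_optimality[of 1] f1 by simp
  from uniform_Ck_frechet_single(1)[OF open_UNIV this UNIV_I]
  have F': "(optimality has_derivative ?F') (at ?P)" .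
  have emb: "((\<lambda>u. ((0, 0), u)) has_derivative (\<lambda>h. ((0, 0), h))) (at (a0, \<xi>0))"
    by (intro has_derivative_Pair has_derivative_const has_derivative_ident has_derivative_eq_rhs[OF has_derivative_Pair])
      (auto simp: zero_prod_def)
  have d: "((\<lambda>u. optimality ((0, 0), u)) has_derivative (\<lambda>h. ?F' ((0, 0), h))) (at (a0, \<xi>0))"
    using has_derivative_compose[OF emb F'] by simp
  have S: "((\<lambda>u. synthesis u - y0) has_derivative (\<lambda>v. Gamma_map f x0 (amplitude_scale v))) (at (a0, \<xi>0))"
    using has_derivative_diff[OF synthesis_has_derivative has_derivative_const[of y0]] by simp
  have l2: "((\<lambda>u :: (real ^ 'n) \<times> (real ^ 'n). snd u $ i) has_derivative (\<lambda>v. snd v $ i)) F" for i F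
    by (intro bounded_linear_imp_has_derivative bounded_linear_compose[OF bounded_linear_vec_nth] bounded_linear_snd)
  have comp: "((\<lambda>u. inner (shift_l2 g (to_torus (snd u $ i))) (synthesis u - y0)) has_derivative
      (\<lambda>v. inner (shift_l2 g (to_torus (\<xi>0 $ i))) (Gamma_map f x0 (amplitude_scale v)))) (at (a0, \<xi>0))"
    if g: "Ck_torus (Suc k) g" for g i k
  proof -
    have T: "((\<lambda>u :: (real ^ 'n) \<times> (real ^ 'n). shift_l2 g (to_torus (snd u $ i))) has_derivative
        (\<lambda>v. (snd v $ i) *\<^sub>R shift_l2 (tderiv g) (to_torus (\<xi>0 $ i)))) (at (a0, \<xi>0))"
      using has_derivative_compose[OF l2[of i "at (a0, \<xi>0)"]
        shift_l2_has_vector_derivative[OF g, unfolded has_vector_derivative_def]] by simp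
    from has_derivative_inner[OF T S] show ?thesis by (simp add: synthesis_0)
  qed
  have pr1: "bounded_linear (\<lambda>y :: (real ^ 'n) \<times> (real ^ 'n). fst y $ i)"
    and pr2: "bounded_linear (\<lambda>y :: (real ^ 'n) \<times> (real ^ 'n). snd y $ i)" for i
    by (intro bounded_linear_compose[OF bounded_linear_vec_nth] bounded_linear_fst bounded_linear_snd)+
  have 1: "inner (T0 (\<xi>0 $ i)) (Gamma_map f x0 (amplitude_scale v)) = 0" for i
  proof -
    have A: "((\<lambda>u. fst (optimality ((0, 0), u)) $ i) has_derivative (\<lambda>h. fst (?F' ((0, 0), h)) $ i)) (at (a0, \<xi>0))"
      by (rule bounded_linear.has_derivative[OF pr1 d])
    have B: "((\<lambda>u. fst (optimality ((0, 0), u)) $ i) has_derivative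
        (\<lambda>v. inner (T0 (\<xi>0 $ i)) (Gamma_map f x0 (amplitude_scale v)))) (at (a0, \<xi>0))"
      using comp[OF f1] by (simp add: optimality_def Gamma_adjoint_def)
    show ?thesis
      using fun_cong[OF has_derivative_unique[OF A B], of v] assms by (simp add: zero_prod_def)
  qed
  have 2: "inner (T1 (\<xi>0 $ i)) (Gamma_map f x0 (amplitude_scale v)) = 0" for i
  proof -
    have A: "((\<lambda>u. snd (optimality ((0, 0), u)) $ i) has_derivative (\<lambda>h. snd (?F' ((0, 0), h)) $ i)) (at (a0, \<xi>0))"
      by (rule bounded_linear.has_derivative[OF pr2 d])
    have B: "((\<lambda>u. snd (optimality ((0, 0), u)) $ i) has_derivative
        (\<lambda>v. inner (T1 (\<xi>0 $ i)) (Gamma_map f x0 (amplitude_scale v)))) (at (a0, \<xi>0))"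
      using comp[OF f2] by (simp add: optimality_def Gamma_adjoint_def)
    show ?thesis
      using fun_cong[OF has_derivative_unique[OF A B], of v] assms by (simp add: zero_prod_def)
  qed
  have "Gamma_adjoint f x0 (Gamma_map f x0 (amplitude_scale v)) = 0"
    using 1 2 by (simp add: Gamma_adjoint_def x0_nth vec_eq_iff zero_prod_def)
  then have "amplitude_scale v = 0"
    using inj_Gamma_adjoint_Gamma_map(2)[OF inj_Gamma] linear_injective_0[OF inj_Gamma_adjoint_Gamma_map(1)[OF inj_Gamma]] by blast
  then show ?thesis by (rule amplitude_scale_eq_0)
qed


section \<open>Estimates near the unperturbed spikes\<close>

lemma T_close:
  assumes "e > 0"
  obtains d where "d > 0" "\<And>\<xi> i. norm (\<xi> - \<xi>0) < d \<Longrightarrow>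
    norm (T0 (\<xi>0 $ i) - T0 (\<xi> $ i)) \<le> e \<and> norm (T1 (\<xi>0 $ i) - T1 (\<xi> $ i)) \<le> e"
proof -
  obtain d1 where d1: "d1 > 0" "\<And>r r'. \<bar>r - r'\<bar> < d1 \<Longrightarrow> norm (T0 r - T0 r') \<le> e"
    using that by (rule shift_l2_uniformly_continuous[OF cont_f(1) assms])
  obtain d2 where d2: "d2 > 0" "\<And>r r'. \<bar>r - r'\<bar> < d2 \<Longrightarrow> norm (T1 r - T1 r') \<le> e"
    using that by (rule shift_l2_uniformly_continuous[OF cont_f(2) assms])
  show ?thesis
  proof (rule that[of "min d1 d2"])
    fix \<xi> and i assume "norm (\<xi> - \<xi>0) < min d1 d2"
    moreover have "\<bar>\<xi>0 $ i - \<xi> $ i\<bar> \<le> norm (\<xi> - \<xi>0)"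
      using component_le_norm_cart[of "\<xi> - \<xi>0" i] by (simp add: abs_minus_commute)
    ultimately show "norm (T0 (\<xi>0 $ i) - T0 (\<xi> $ i)) \<le> e \<and> norm (T1 (\<xi>0 $ i) - T1 (\<xi> $ i)) \<le> e"
      using d1(2) d2(2) by simp
  qed (use d1 d2 in simp)
qed

text \<open>The lower bound \<open>B\<close> for the composition at \<open>x0\<close> tolerates a
  small displacement of the translates. Independence will also give distinct positions, since
  coinciding ones would be dependent.\<close>

lemma independent_near:
  obtains d where "d > 0"
    "\<And>\<xi> b. norm (\<xi> - \<xi>0) < d \<Longrightarrow> (\<Sum>i\<in>UNIV. b $ i *\<^sub>R shift_l2 f (tor \<xi> $ i)) = 0 \<Longrightarrow> b = 0"
proof -
  obtain B where B: "B > 0" "\<And>u. B * norm u \<le> norm (Gamma_adjoint f x0 (Gamma_map f x0 u))"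
    using linear_inj_bounded_below_pos[OF inj_Gamma_adjoint_Gamma_map[OF inj_Gamma]] by blast
  obtain N where N: "N > 0" "\<And>(x :: torus ^ 'n) p. norm (Gamma_adjoint f x p) \<le> N * norm p"
    using that by (rule norm_Gamma_adjoint_le[OF cont_f(1,2)])
  define n where "n = real CARD('n)"
  have n: "n > 0" by (simp add: n_def)
  define e where "e = B / (2 * (N * n))"
  have e: "e > 0" "N * (n * e) = B / 2" using B(1) N(1) n by (simp_all add: e_def)
  obtain d where d: "d > 0" "\<And>\<xi> i. norm (\<xi> - \<xi>0) < d \<Longrightarrow>
      norm (T0 (\<xi>0 $ i) - T0 (\<xi> $ i)) \<le> e \<and> norm (T1 (\<xi>0 $ i) - T1 (\<xi> $ i)) \<le> e"
    using that by (rule T_close[OF e(1)])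
  show ?thesis
  proof (rule that[OF d(1)])
    fix \<xi> b assume \<xi>: "norm (\<xi> - \<xi>0) < d" and b: "(\<Sum>i\<in>UNIV. b $ i *\<^sub>R shift_l2 f (tor \<xi> $ i)) = 0"
    have "Gamma_map f x0 (b, 0) = (\<Sum>i\<in>UNIV. b $ i *\<^sub>R (T0 (\<xi>0 $ i) - T0 (\<xi> $ i)))"
      using b by (simp add: Gamma_map_shift_l2 x0_nth scaleR_diff_right sum_subtractf)
    also have "norm \<dots> \<le> (\<Sum>i\<in>(UNIV::'n set). norm b * e)"
    proof (rule sum_norm_le)
      fix i
      have "\<bar>b $ i\<bar> * norm (T0 (\<xi>0 $ i) - T0 (\<xi> $ i)) \<le> norm b * e"
        using d(2)[OF \<xi>, of i] by (intro mult_mono component_le_norm_cart) auto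
      then show "norm (b $ i *\<^sub>R (T0 (\<xi>0 $ i) - T0 (\<xi> $ i))) \<le> norm b * e" by simp
    qed
    also have "\<dots> = n * e * norm b" by (simp add: n_def)
    finally have "N * norm (Gamma_map f x0 (b, 0)) \<le> N * (n * e * norm b)"
      using N(1) by (intro mult_left_mono) auto
    also have "\<dots> = B / 2 * norm b" using e(2) by (simp only: mult.assoc[symmetric])
    finally have "B * norm b \<le> B / 2 * norm b"
      using B(2)[of "(b, 0)"] N(2)[of x0 "Gamma_map f x0 (b, 0)"] by (simp add: norm_Pair)
    then show "b = 0" using B(1) by (simp add: mult_le_cancel_right)
  qed
qed

text \<open>The difference splits as \<open>p - p0 = Gamma_map f x0 c + v\<close> with
  \<open>c\<close> merely bounded and \<open>v\<close> small. This suffices because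
  \<open>Gamma_adjoint f x0 (p - p0)\<close> is small relative to \<open>norm p\<close>: both
  vectors have the same values and slopes, at nearby positions. Pairing the difference with itself
  combines the two facts. The factor 2 in \<open>L * (2 * l)\<close> anticipates the bound of
  \<open>norm (l, w)\<close> on the noise domain.\<close>

lemma certificate_close:
  assumes p0: "p0 = Gamma_map f x0 c0" "Gamma_adjoint f x0 p0 = sgn0" and \<epsilon>: "\<epsilon> > 0" and L: "L \<ge> 0"
  obtains \<alpha> d where "0 < \<alpha>" "\<alpha> \<le> 1" "d > 0"
    "\<And>l w a \<xi>. l > 0 \<Longrightarrow> norm w \<le> \<alpha> * l \<Longrightarrow> norm ((a, \<xi>) - (a0, \<xi>0)) < d \<Longrightarrow>
      norm ((a, \<xi>) - (a0, \<xi>0)) \<le> L * (2 * l) \<Longrightarrow>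
      Gamma_adjoint f (tor \<xi>) ((1 / l) *\<^sub>R (y0 + w - synthesis (a, \<xi>))) = sgn0 \<Longrightarrow>
      norm ((1 / l) *\<^sub>R (y0 + w - synthesis (a, \<xi>)) - p0) \<le> \<epsilon>"
proof -
  obtain S where S: "S > 0" "\<And>v. norm (amplitude_scale v) \<le> S * norm v"
    using linear_bounded_pos[OF linear_amplitude_scale] by blast
  define n where "n = real CARD('n)"
  have n: "n > 0" by (simp add: n_def)
  \<comment> \<open>Bound for \<open>c\<close>: the displacement divided by \<open>l\<close> is at
    most \<open>2 * L\<close>, and \<open>c0\<close> represents \<open>p0\<close>.\<close>
  define Q where "Q = S * (2 * L) + norm c0"
  have Q: "Q \<ge> 0" using S(1) L by (simp add: Q_def)
  \<comment> \<open>No a priori bound on \<open>p\<close> is at hand; if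
    \<open>norm (p - p0)\<close> exceeds \<epsilon>, then \<open>norm p\<close> is at most
    \<open>norm p0 / \<epsilon> + 1\<close> times it. The last summand 1 keeps \<open>W\<close>
    positive.\<close>
  define W where "W = 2 * n * Q * (norm p0 / \<epsilon> + 1) + 1"
  have W: "W > 0" using n Q \<epsilon> by (simp add: W_def add_nonneg_pos)
  define e2 where "e2 = \<epsilon> / 4 / W"
  have e2: "e2 > 0" "e2 * W = \<epsilon> / 4" using \<epsilon> W by (simp add: e2_def, unfold e2_def, intro pos_divide_times_cancel)
  define e1 where "e1 = \<epsilon> / 4 / (2 * L + 1)"
  have L1: "2 * L + 1 > 0" using L by simp
  have e1: "e1 > 0" "e1 * (2 * L + 1) = \<epsilon> / 4" using \<epsilon> L1 by (simp add: e1_def, unfold e1_def, intro pos_divide_times_cancel)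
  \<comment> \<open>\<open>w / l\<close> and the Taylor remainder over \<open>l\<close> receive a
    quarter of \<epsilon> each; the cap 1 gives \<open>norm w \<le> l\<close>.\<close>
  define \<alpha> where "\<alpha> = min 1 (\<epsilon> / 4)"
  obtain d1 where d1: "d1 > 0" "\<And>u. norm (u - (a0, \<xi>0)) < d1 \<Longrightarrow>
      norm (synthesis u - y0 - Gamma_map f x0 (amplitude_scale (u - (a0, \<xi>0)))) \<le> e1 * norm (u - (a0, \<xi>0))"
    using synthesis_has_derivative e1(1) unfolding has_derivative_at_alt synthesis_0 by meson
  obtain d2 where d2: "d2 > 0" "\<And>\<xi> i. norm (\<xi> - \<xi>0) < d2 \<Longrightarrow>
      norm (T0 (\<xi>0 $ i) - T0 (\<xi> $ i)) \<le> e2 \<and> norm (T1 (\<xi>0 $ i) - T1 (\<xi> $ i)) \<le> e2"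
    using that by (rule T_close[OF e2(1)])
  show ?thesis
  proof (rule that[of \<alpha> "min d1 d2"])
    show "0 < \<alpha>" "\<alpha> \<le> 1" "min d1 d2 > 0" using \<epsilon> d1(1) d2(1) by (simp_all add: \<alpha>_def)
    fix l w a \<xi>
    assume l: "l > 0" and w: "norm w \<le> \<alpha> * l" and near: "norm ((a, \<xi>) - (a0, \<xi>0)) < min d1 d2"
      and lip: "norm ((a, \<xi>) - (a0, \<xi>0)) \<le> L * (2 * l)"
      and opt: "Gamma_adjoint f (tor \<xi>) ((1 / l) *\<^sub>R (y0 + w - synthesis (a, \<xi>))) = sgn0"
    define u where "u = (a, \<xi>) - (a0, \<xi>0)"
    define p where "p = (1 / l) *\<^sub>R (y0 + w - synthesis (a, \<xi>))"
    define rem where "rem = synthesis (a, \<xi>) - y0 - Gamma_map f x0 (amplitude_scale u)"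
    define v where "v = (1 / l) *\<^sub>R (w - rem)"
    define c where "c = - amplitude_scale ((1 / l) *\<^sub>R u) - c0"
    have "norm rem \<le> e1 * norm ((a, \<xi>) - (a0, \<xi>0))"
      unfolding rem_def u_def by (rule d1(2)) (use near in simp)
    also have "\<dots> \<le> e1 * (L * (2 * l))"
      by (rule mult_left_mono[OF lip]) (use e1(1) in simp)
    finally have "norm rem \<le> e1 * (L * (2 * l))" .
    then have "norm (w - rem) \<le> \<alpha> * l + e1 * (L * (2 * l))"
      using w norm_triangle_ineq4[of w rem] by linarith
    also have "\<dots> = (\<alpha> + 2 * L * e1) * l" by (simp add: algebra_simps)
    also have "\<dots> \<le> (\<epsilon> / 2) * l"
    proof (rule mult_right_mono)
      have "\<alpha> \<le> \<epsilon> / 4" by (simp add: \<alpha>_def)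
      moreover have "2 * L * e1 \<le> \<epsilon> / 4" using e1 by (simp add: algebra_simps)
      ultimately show "\<alpha> + 2 * L * e1 \<le> \<epsilon> / 2" by linarith
    qed (use l in simp)
    finally have wr: "norm (w - rem) \<le> (\<epsilon> / 2) * l" .
    have div: "norm ((1 / l) *\<^sub>R z) \<le> b" if "norm z \<le> b * l" for b and z :: "'b::real_normed_vector"
      using that l by (simp add: pos_divide_le_eq)
    have v: "norm v \<le> \<epsilon> / 2" unfolding v_def by (rule div[OF wr])
    have "norm ((1 / l) *\<^sub>R u) \<le> 2 * L"
      using lip by (intro div) (simp add: u_def mult_ac)
    then have "norm (amplitude_scale ((1 / l) *\<^sub>R u)) \<le> S * (2 * L)"
      using S by (meson mult_left_mono less_imp_le order_trans)
    then have c: "norm c \<le> Q"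
      using norm_triangle_ineq4[of "- amplitude_scale ((1 / l) *\<^sub>R u)" c0] by (simp add: c_def Q_def)
    have pp: "p - p0 = Gamma_map f x0 c + v"
    proof -
      have eq: "Gamma_map f x0 c = - ((1 / l) *\<^sub>R Gamma_map f x0 (amplitude_scale u)) - p0"
        by (simp add: c_def p0(1) linear_diff[OF linear_Gamma_map] linear_neg[OF linear_Gamma_map]
            linear_scale[OF linear_amplitude_scale] linear_scale[OF linear_Gamma_map])
      show ?thesis unfolding eq p_def v_def rem_def by (simp add: algebra_simps)
    qed
    have \<xi>: "norm (\<xi> - \<xi>0) < d2"
    proof -
      have "norm (\<xi> - \<xi>0) \<le> norm ((a, \<xi>) - (a0, \<xi>0))" by (simp add: norm_Pair)
      then show ?thesis using near by simp
    qed
    have A: "norm (Gamma_adjoint f x0 (p - p0)) \<le> 2 * n * e2 * norm p"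
    proof -
      have "Gamma_adjoint f x0 (p - p0) = Gamma_adjoint f x0 p - Gamma_adjoint f (tor \<xi>) p"
        using opt by (simp add: linear_diff[OF linear_Gamma_adjoint] p0(2) p_def)
      also have "\<dots> = (\<chi> i. inner (T0 (\<xi>0 $ i) - T0 (\<xi> $ i)) p, \<chi> i. inner (T1 (\<xi>0 $ i) - T1 (\<xi> $ i)) p)"
        by (simp add: Gamma_adjoint_def x0_nth inner_diff_left vec_eq_iff)
      also have "norm \<dots> \<le> (\<Sum>i\<in>(UNIV::'n set). e2 * norm p) + (\<Sum>i\<in>(UNIV::'n set). e2 * norm p)"
      proof (rule order_trans[OF norm_Pair_le add_mono]; rule order_trans[OF norm_le_l1_cart sum_mono]; simp)
        fix i
        show "\<bar>inner (T0 (\<xi>0 $ i) - T0 (\<xi> $ i)) p\<bar> \<le> e2 * norm p"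
          using d2(2)[OF \<xi>, of i] by (intro order_trans[OF Cauchy_Schwarz_ineq2 mult_right_mono]) auto
        show "\<bar>inner (T1 (\<xi>0 $ i) - T1 (\<xi> $ i)) p\<bar> \<le> e2 * norm p"
          using d2(2)[OF \<xi>, of i] by (intro order_trans[OF Cauchy_Schwarz_ineq2 mult_right_mono]) auto
      qed
      finally show ?thesis by (simp add: n_def mult_ac)
    qed
    define X where "X = norm (p - p0)"
    have "X * X = inner (p - p0) (Gamma_map f x0 c + v)"
      by (simp add: X_def pp[symmetric] power2_norm_eq_inner[symmetric] power2_eq_square)
    also have "\<dots> = inner (Gamma_adjoint f x0 (p - p0)) c + inner (p - p0) v"
      by (simp add: inner_add_right inner_Gamma_adjoint)
    also have "\<dots> \<le> (2 * n * e2 * norm p) * Q + X * (\<epsilon> / 2)"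
    proof (rule add_mono)
      have "norm (Gamma_adjoint f x0 (p - p0)) * norm c \<le> (2 * n * e2 * norm p) * Q"
        using A c n e2(1) by (intro mult_mono) auto
      then show "inner (Gamma_adjoint f x0 (p - p0)) c \<le> (2 * n * e2 * norm p) * Q"
        using norm_cauchy_schwarz order_trans by blast
      have "norm (p - p0) * norm v \<le> X * (\<epsilon> / 2)" unfolding X_def using v by (intro mult_left_mono) auto
      then show "inner (p - p0) v \<le> X * (\<epsilon> / 2)" using norm_cauchy_schwarz order_trans by blast
    qed
    finally have XX: "X * X \<le> (2 * n * e2 * norm p) * Q + X * (\<epsilon> / 2)" .
    \<comment> \<open>Otherwise both terms are multiples of \<open>X\<close>, with factors
      \<epsilon>/4 and \<epsilon>/2 that add up to less than \<epsilon>.\<close>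
    have "X \<le> \<epsilon>"
    proof (rule ccontr)
      assume "\<not> X \<le> \<epsilon>"
      then have X: "X > \<epsilon>" "X > 0" using \<epsilon> by auto
      have "norm p \<le> norm p0 + X" unfolding X_def by (metis add.commute norm_triangle_sub)
      also have "norm p0 = norm p0 / \<epsilon> * \<epsilon>" using \<epsilon> by simp
      also have "norm p0 / \<epsilon> * \<epsilon> \<le> norm p0 / \<epsilon> * X" using X \<epsilon> by (intro mult_left_mono) auto
      finally have "norm p \<le> (norm p0 / \<epsilon> + 1) * X" by (simp add: algebra_simps)
      then have "(2 * n * e2 * Q) * norm p \<le> (2 * n * e2 * Q) * ((norm p0 / \<epsilon> + 1) * X)"
        using n e2(1) Q by (intro mult_left_mono) auto
      also have "\<dots> = (e2 * (W - 1)) * X" by (simp add: W_def)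
      also have "\<dots> \<le> (\<epsilon> / 4) * X" using e2 X(2) by (intro mult_right_mono) (auto simp: algebra_simps)
      finally have "X * X \<le> (\<epsilon> / 4 + \<epsilon> / 2) * X" using XX by (simp add: algebra_simps)
      then have "X \<le> \<epsilon> / 4 + \<epsilon> / 2" using X(2) by (simp only: mult_le_cancel_right_pos)
      then show False using X(1) \<epsilon> by simp
    qed
    then show "norm ((1 / l) *\<^sub>R (y0 + w - synthesis (a, \<xi>)) - p0) \<le> \<epsilon>" by (simp add: X_def p_def)
  qed
qed

section \<open>Support recovery\<close>

text \<open>The branch \<open>g\<close> of solutions of the first order conditions lives on a full
  ball, whereas optimality is claimed on the cone only, where the certificate is controlled. The
  cone is cut so short that the branch keeps signs, distinct positions and the dual bound.\<close>

lemma support_recovery: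
  obtains \<alpha> l0 r L g where "\<alpha> > 0" "l0 > 0" "r > 0" "L \<ge> 0" "g (0, 0) = (a0, \<xi>0)"
    "noise_domain \<alpha> l0 \<subseteq> ball 0 r"
    "\<And>z. z \<in> ball 0 r \<Longrightarrow> norm (g z - (a0, \<xi>0)) \<le> L * norm z"
    "\<And>k. Ck_torus (Suc k) f \<Longrightarrow> uniform_Ck k (ball 0 r) {g}"
    "\<And>l w. (l, w) \<in> noise_domain \<alpha> l0 \<Longrightarrow>
      solves_P f l (y0 + w) (spikes (fst (g (l, w))) (tor (snd (g (l, w))))) \<and>
      (\<exists>!m. solves_P f l (y0 + w) m) \<and> inj (\<lambda>i. tor (snd (g (l, w))) $ i) \<and>
      (\<forall>i. sgn (fst (g (l, w)) $ i) = sgn (a0 $ i))"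
proof -
  have F1: "uniform_Ck (Suc 0) UNIV {optimality}" using uniform_Ck_optimality[of 1] f1 by simp
  have nondegenerate: "\<forall>v. frechet_derivative optimality (at ((0, 0), (a0, \<xi>0))) (0, v) = 0 \<longrightarrow> v = 0"
    using optimality_nondegenerate by blast
  obtain r L g where g: "r > 0" "L \<ge> 0" "g (0, 0) = (a0, \<xi>0)"
    "\<And>z. z \<in> ball (0, 0) r \<Longrightarrow> optimality (z, g z) = 0"
    "\<And>z. z \<in> ball (0, 0) r \<Longrightarrow> norm (g z - (a0, \<xi>0)) \<le> L * norm (z - (0, 0))"
    "\<And>k. uniform_Ck k UNIV {optimality} \<Longrightarrow> uniform_Ck k (ball (0, 0) r) {g}"
    using that
    by (rule uniform_Ck_implicit_function[OF F1 optimality_0 nondegenerate])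
  note g = g[folded zero_prod_def]
  obtain p0 c0 \<epsilon> \<rho> where p0: "p0 = Gamma_map f x0 c0" "Gamma_adjoint f x0 p0 = (\<chi> i. sgn (a0 $ i), 0)"
    and \<epsilon>: "\<epsilon> > 0" "\<rho> > 0" and stab: "stable_certificate p0 \<epsilon> \<rho>"
    using certificate_in_range by blast
  have Ap0: "Gamma_adjoint f x0 p0 = sgn0" using p0(2) by (simp add: sgn0_def)
  obtain \<alpha> d1 where \<alpha>: "0 < \<alpha>" "\<alpha> \<le> 1" and d1: "d1 > 0"
    "\<And>l w a \<xi>. l > 0 \<Longrightarrow> norm w \<le> \<alpha> * l \<Longrightarrow> norm ((a, \<xi>) - (a0, \<xi>0)) < d1 \<Longrightarrow>
      norm ((a, \<xi>) - (a0, \<xi>0)) \<le> L * (2 * l) \<Longrightarrow>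
      Gamma_adjoint f (tor \<xi>) ((1 / l) *\<^sub>R (y0 + w - synthesis (a, \<xi>))) = sgn0 \<Longrightarrow>
      norm ((1 / l) *\<^sub>R (y0 + w - synthesis (a, \<xi>)) - p0) \<le> \<epsilon>"
    using that by (rule certificate_close[OF p0(1) Ap0 \<epsilon>(1) g(2)])
  obtain d2 where d2: "d2 > 0"
    "\<And>\<xi> b. norm (\<xi> - \<xi>0) < d2 \<Longrightarrow> (\<Sum>i\<in>UNIV. b $ i *\<^sub>R shift_l2 f (tor \<xi> $ i)) = 0 \<Longrightarrow> b = 0"
    using that by (rule independent_near)
  define d3 where "d3 = Min (range (\<lambda>i. \<bar>a0 $ i\<bar>))"
  have d3: "d3 > 0" "\<And>i. d3 \<le> \<bar>a0 $ i\<bar>" using a0 by (auto simp: d3_def)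
  \<comment> \<open>In this order: closeness of the certificate, independence of the translates,
    signs of the amplitudes, and the stability radius for the positions.\<close>
  define d where "d = min (min d1 d2) (min d3 \<rho>)"
  have d: "d > 0" "d \<le> d1" "d \<le> d2" "d \<le> d3" "d \<le> \<rho>" using d1(1) d2(1) d3(1) \<epsilon>(2) by (auto simp: d_def)
  \<comment> \<open>\<open>2 * l0\<close> bounds the norm of all points of the domain: it has to
    stay below the radius of the branch and, after the Lipschitz factor \<open>L\<close>, below
    \<open>d\<close>.\<close>
  define l0 where "l0 = min (r / 3) (d / (2 * L + 1) / 2)"
  have L1: "2 * L + 1 > 0" using g(2) by simp
  have l0: "l0 > 0" "2 * l0 < r" "L * (2 * l0) < d"
  proof -
    show "l0 > 0" using g(1) d(1) L1 by (simp add: l0_def)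
    have "l0 \<le> r / 3" unfolding l0_def by (rule min.cobounded1)
    then show "2 * l0 < r" using g(1) by linarith
    have "l0 \<le> d / (2 * L + 1) / 2" unfolding l0_def by (rule min.cobounded2)
    then have "l0 * 2 \<le> d / (2 * L + 1)"
      by (rule pos_le_divide_eq[THEN iffD1, rotated]) simp
    then have "l0 * 2 * (2 * L + 1) \<le> d" using L1 by (simp only: pos_le_divide_eq)
    then have "2 * (L * (2 * l0)) + 2 * l0 \<le> d" by (simp add: algebra_simps)
    moreover have "L * (2 * l0) \<ge> 0" using g(2) \<open>l0 > 0\<close> by simp
    ultimately show "L * (2 * l0) < d" using \<open>l0 > 0\<close> by linarith
  qed
  have dom: "0 \<le> l" "l \<le> l0" "norm w \<le> \<alpha> * l" "norm (l, w) \<le> 2 * l" "(l, w) \<in> ball 0 r"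
    if "(l, w) \<in> noise_domain \<alpha> l0" for l w
  proof -
    show l: "0 \<le> l" "l \<le> l0" "norm w \<le> \<alpha> * l" using that by (auto simp: noise_domain_def)
    have "norm w \<le> l" using l(3) mult_right_mono[OF \<alpha>(2) l(1)] by simp
    then show n: "norm (l, w) \<le> 2 * l" using norm_Pair_le[of l w] l(1) by simp
    then show "(l, w) \<in> ball 0 r" using l(2) l0(2) by simp
  qed
  have main: "solves_P f l (y0 + w) (spikes (fst (g (l, w))) (tor (snd (g (l, w))))) \<and>
      (\<exists>!m. solves_P f l (y0 + w) m) \<and> inj (\<lambda>i. tor (snd (g (l, w))) $ i) \<and>
      (\<forall>i. sgn (fst (g (l, w)) $ i) = sgn (a0 $ i))"
    if z: "(l, w) \<in> noise_domain \<alpha> l0" for l w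
  proof -
    note D = dom[OF z]
    obtain a \<xi> where u: "g (l, w) = (a, \<xi>)" by (cases "g (l, w)")
    have lip: "norm ((a, \<xi>) - (a0, \<xi>0)) \<le> L * (2 * l)"
      using g(5)[OF D(5)] mult_left_mono[OF D(4) g(2)] by (simp add: u)
    also have "\<dots> \<le> L * (2 * l0)" using D(2) g(2) by (intro mult_left_mono) auto
    also have "\<dots> < d" by (rule l0(3))
    finally have near: "norm ((a, \<xi>) - (a0, \<xi>0)) < d" .
    have comps: "norm (a - a0) < d" "norm (\<xi> - \<xi>0) < d"
      using near norm_fst_le[of "a - a0" "\<xi> - \<xi>0"] norm_snd_le[of "\<xi> - \<xi>0" "a - a0"] by simp_all
    have sgn: "sgn (a $ i) = sgn (a0 $ i)" for i
    proof (rule sgn_near)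
      have "\<bar>a $ i - a0 $ i\<bar> \<le> norm (a - a0)" using component_le_norm_cart[of "a - a0" i] by simp
      then show "\<bar>a $ i - a0 $ i\<bar> < \<bar>a0 $ i\<bar>" using comps(1) d(4) d3(2)[of i] by linarith
    qed
    have \<xi>\<rho>: "\<bar>\<xi> $ i - \<xi>0 $ i\<bar> < \<rho>" for i
      using component_le_norm_cart[of "\<xi> - \<xi>0" i] comps(2) d(5) by simp
    have indep: "b = 0" if "(\<Sum>i\<in>UNIV. b $ i *\<^sub>R shift_l2 f (tor \<xi> $ i)) = 0" for b
      by (rule d2(2)[OF _ that]) (use comps(2) d(3) in simp)
    have injx: "inj (\<lambda>i. tor \<xi> $ i)"
    proof (rule injI, rule ccontr)
      fix i j assume ij: "tor \<xi> $ i = tor \<xi> $ j" "i \<noteq> j"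
      have "(\<Sum>k\<in>UNIV. (axis i 1 - axis j 1) $ k *\<^sub>R shift_l2 f (tor \<xi> $ k)) =
          shift_l2 f (tor \<xi> $ i) - shift_l2 f (tor \<xi> $ j)"
        by (simp add: scaleR_diff_left sum_subtractf axis_def if_distrib[of "\<lambda>c. c *\<^sub>R _"] cong: if_cong)
      also have "\<dots> = 0" using ij(1) by simp
      finally have "axis i 1 - axis j 1 = (0 :: real ^ 'n)" by (rule indep)
      then have "(axis i 1 - axis j 1 :: real ^ 'n) $ i = 0" by simp
      then show False using ij(2) by (simp add: axis_def)
    qed
    \<comment> \<open>For \<open>l > 0\<close> the certificate is the residual divided by
      \<open>l\<close>. At \<open>l = 0\<close> the noise is zero and the branch is at its base
      point, where \<open>p0\<close> itself serves.\<close>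
    have "\<exists>p. y0 + w - synthesis (a, \<xi>) = l *\<^sub>R p \<and> norm (p - p0) \<le> \<epsilon> \<and> Gamma_adjoint f (tor \<xi>) p = sgn0"
    proof (cases "l = 0")
      case True
      then have "w = 0" using D(3) by simp
      then have "(a, \<xi>) = (a0, \<xi>0)" using u g(3) True by (simp add: zero_prod_def)
      then show ?thesis using True \<open>w = 0\<close> \<epsilon>(1) Ap0 synthesis_0
        by (intro exI[of _ p0]) (simp add: tor_\<xi>0)
    next
      case False
      then have l: "l > 0" using D(1) by simp
      define p where "p = (1 / l) *\<^sub>R (y0 + w - synthesis (a, \<xi>))"
      have lp: "y0 + w - synthesis (a, \<xi>) = l *\<^sub>R p" using l by (simp add: p_def)
      have "Gamma_adjoint f (tor \<xi>) (synthesis (a, \<xi>) - y0 - w) + l *\<^sub>R sgn0 = 0"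
        using g(4)[OF D(5)] by (simp add: u optimality_def)
      moreover have "synthesis (a, \<xi>) - y0 - w = - (l *\<^sub>R p)" unfolding lp[symmetric] by simp
      ultimately have "l *\<^sub>R (sgn0 - Gamma_adjoint f (tor \<xi>) p) = 0"
        by (simp add: linear_neg[OF linear_Gamma_adjoint] linear_scale[OF linear_Gamma_adjoint] scaleR_diff_right)
      then have A: "Gamma_adjoint f (tor \<xi>) p = sgn0" using l by simp
      have "norm (p - p0) \<le> \<epsilon>" unfolding p_def
        by (rule d1(2)[OF l D(3) _ lip]) (use near d(2) A in \<open>auto simp: p_def\<close>)
      then show ?thesis using lp A by blast
    qed
    then obtain p where p: "y0 + w - synthesis (a, \<xi>) = l *\<^sub>R p" "norm (p - p0) \<le> \<epsilon>" "Gamma_adjoint f (tor \<xi>) p = sgn0"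
      by blast
    have v: "inner (T0 (\<xi> $ i)) p = sgn (a0 $ i)" "inner (T1 (\<xi> $ i)) p = 0" for i
      using p(3) by (auto simp: Gamma_adjoint_def sgn0_def vec_eq_iff)
    have off: "\<bar>inner (shift_l2 f t) p\<bar> < 1" if "t \<notin> range (\<lambda>i. tor \<xi> $ i)" for t
      by (rule stab[unfolded stable_certificate_def, rule_format, where \<xi> = "\<lambda>i. \<xi> $ i"])
        (use p(2) \<xi>\<rho> v that in auto)
    have res: "y0 + w - forward f (spikes a (tor \<xi>)) = l *\<^sub>R p" using p(1) by (simp add: forward_spikes_tor)
    have at: "inner (shift_l2 f (tor \<xi> $ i)) p = sgn (a $ i)" for i by (simp add: v sgn)
    from solves_P_unique_of_certificate[OF cont_f(1) D(1) res at off injx indep]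
    show ?thesis using injx sgn by (simp add: u)
  qed
  show ?thesis
  proof (rule that[OF \<alpha>(1) l0(1) g(1,2)])
    show "g (0, 0) = (a0, \<xi>0)" using g(3) by (simp add: zero_prod_def)
    show "noise_domain \<alpha> l0 \<subseteq> ball 0 r" using dom(5) by auto
    show "norm (g z - (a0, \<xi>0)) \<le> L * norm z" if "z \<in> ball 0 r" for z using g(5)[OF that] by simp
    show "uniform_Ck k (ball 0 r) {g}" if "Ck_torus (Suc k) f" for k
      by (rule g(6)[OF uniform_Ck_optimality[OF that]])
  qed (rule main)
qed

end

theorem theorem2:
  fixes \<phi> :: "torus \<Rightarrow> real"
    and a0 :: "real ^ 'n" and x0 :: "torus ^ 'n" and y0 :: l2
  assumes "Ck_torus 2 \<phi>"
    and "\<forall>i. a0 $ i \<noteq> 0"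
    and "inj (\<lambda>i. x0 $ i)"
    and "y0 = forward \<phi> (spikes a0 x0)"
    and "inj (Gamma_map \<phi> x0)"
    and "ndsc \<phi> a0 x0"
  shows "\<exists>\<alpha>>0. \<exists>l0>0.
    (\<forall>(l, w)\<in>noise_domain \<alpha> l0. \<exists>!m. solves_P \<phi> l (y0 + w) m) \<and>
    (\<exists>(a :: real \<times> l2 \<Rightarrow> real ^ 'n) (x :: real \<times> l2 \<Rightarrow> torus ^ 'n).
       (\<forall>(l, w)\<in>noise_domain \<alpha> l0.
          solves_P \<phi> l (y0 + w) (spikes (a (l, w)) (x (l, w))) \<and>
          inj (\<lambda>i. x (l, w) $ i) \<and>
          (\<forall>i. a (l, w) $ i \<noteq> 0 \<and> sgn (a (l, w) $ i) = sgn (a0 $ i))) \<and>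
       a (0, 0) = a0 \<and> x (0, 0) = x0 \<and>
       (\<forall>k\<ge>2. Ck_torus k \<phi> \<longrightarrow>
          Ck_map_on (k - 1) (noise_domain \<alpha> l0) (\<lambda>z. (a z, x z))) \<and>
       (\<forall>i. (\<lambda>w. dist (x (norm w / \<alpha>, w) $ i) (x0 $ i)) \<in> O[nhds 0](\<lambda>w. norm w)) \<and>
       (\<forall>i. (\<lambda>w. \<bar>a (norm w / \<alpha>, w) $ i - a0 $ i\<bar>) \<in> O[nhds 0](\<lambda>w. norm w)))"
proof -
  have "\<forall>i. \<exists>r. x0 $ i = to_torus r" using surj_to_torus by metis
  then obtain h where h: "\<And>i. x0 $ i = to_torus (h i)" by metis
  define \<xi>0 :: "real ^ 'n" where "\<xi>0 = (\<chi> i. h i)"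
  interpret nondegenerate_spikes \<phi> a0 \<xi>0 x0
    by unfold_locales (use assms h in \<open>auto simp: \<xi>0_def vec_eq_iff\<close>)
  have y0: "forward \<phi> (spikes a0 x0) = y0" using assms(4) by simp
  obtain \<alpha> l0 r L g where g: "\<alpha> > 0" "l0 > 0" "r > 0" "L \<ge> 0" "g (0, 0) = (a0, \<xi>0)"
    "noise_domain \<alpha> l0 \<subseteq> ball 0 r"
    "\<And>z. z \<in> ball 0 r \<Longrightarrow> norm (g z - (a0, \<xi>0)) \<le> L * norm z"
    "\<And>k. Ck_torus (Suc k) \<phi> \<Longrightarrow> uniform_Ck k (ball 0 r) {g}"
    "\<And>l w. (l, w) \<in> noise_domain \<alpha> l0 \<Longrightarrow>
      solves_P \<phi> l (forward \<phi> (spikes a0 x0) + w) (spikes (fst (g (l, w))) (tor (snd (g (l, w))))) \<and>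
      (\<exists>!m. solves_P \<phi> l (forward \<phi> (spikes a0 x0) + w) m) \<and> inj (\<lambda>i. tor (snd (g (l, w))) $ i) \<and>
      (\<forall>i. sgn (fst (g (l, w)) $ i) = sgn (a0 $ i))"
    using that by (rule support_recovery)
  define a where "a z = fst (g z)" for z
  define x where "x z = tor (snd (g z))" for z
  note sol = g(9)[unfolded y0, folded a_def x_def]
  have Ck: "Ck_map_on (k - 1) (noise_domain \<alpha> l0) (\<lambda>z. (a z, x z))" if k: "k \<ge> 2" "Ck_torus k \<phi>" for k
  proof -
    have "Ck_torus (Suc (k - 1)) \<phi>" using k by simp
    note G = g(8)[OF this]
    have 1: "Ck_on (k - 1) (ball 0 r) a"
      unfolding a_def[abs_def]
      by (rule uniform_Ck_imp_Ck_on[OF open_ball uniform_Ck_bounded_linear_single[OF bounded_linear_fst G]])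
    have 2: "Ck_on (k - 1) (ball 0 r) (\<lambda>z. snd (g z))"
      by (rule uniform_Ck_imp_Ck_on[OF open_ball uniform_Ck_bounded_linear_single[OF bounded_linear_snd G]])
    \<comment> \<open>The branch provides one lift of the positions on the whole ball, which serves
      as neighbourhood of each of its points.\<close>
    have 3: "Ck_torus_on (k - 1) (ball 0 r) x"
      unfolding Ck_torus_on_def
    proof (intro conjI ballI open_ball)
      fix z :: "real \<times> l2" assume "z \<in> ball 0 r"
      then show "\<exists>V (h :: real \<times> l2 \<Rightarrow> real ^ 'n). z \<in> V \<and> V \<subseteq> ball 0 r \<and> Ck_on (k - 1) V h \<and>
          (\<forall>z'\<in>V. x z' = (\<chi> i. to_torus (h z' $ i)))"
        using 2 by (intro exI[of _ "ball 0 r"] exI[of _ "\<lambda>z. snd (g z)"]) (simp add: x_def tor_def)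
    qed
    show ?thesis unfolding Ck_map_on_def
      by (intro exI[of _ "ball 0 r"] exI[of _ "\<lambda>z. (a z, x z)"]) (use g(6) 1 3 in simp)
  qed
  \<comment> \<open>The Lipschitz estimate holds on the whole ball, so it suffices that
    \<open>(norm w / \<alpha>, w)\<close> lies in it; \<open>1 / \<alpha> + 1\<close> bounds the
    norm of this point relative to \<open>norm w\<close>.\<close>
  have bound: "\<forall>\<^sub>F w in nhds 0. norm (g (norm w / \<alpha>, w) - (a0, \<xi>0)) \<le> L * (1 / \<alpha> + 1) * norm w"
  proof -
    have n: "norm (norm w / \<alpha>, w) \<le> (1 / \<alpha> + 1) * norm w" for w :: l2
      using norm_Pair_le[of "norm w / \<alpha>" w] g(1) by (simp add: algebra_simps)
    have pos: "1 / \<alpha> + 1 > 0" using g(1) by (simp add: add_pos_pos)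
    have "\<forall>\<^sub>F w :: l2 in nhds 0. norm w < r / (1 / \<alpha> + 1)"
      using order_tendstoD(2)[OF tendsto_norm[OF filterlim_ident[of "nhds (0::l2)"]]] g(3) pos by simp
    then show ?thesis
    proof (rule eventually_mono)
      fix w :: l2 assume "norm w < r / (1 / \<alpha> + 1)"
      then have "norm w * (1 / \<alpha> + 1) < r" using pos by (simp only: pos_less_divide_eq)
      then have "(norm w / \<alpha>, w) \<in> ball 0 r" using n[of w] by (simp add: mult.commute)
      from g(7)[OF this] mult_left_mono[OF n[of w] g(4)]
      show "norm (g (norm w / \<alpha>, w) - (a0, \<xi>0)) \<le> L * (1 / \<alpha> + 1) * norm w" by (simp add: mult.assoc)
    qed
  qed
  have Oa: "(\<lambda>w. \<bar>a (norm w / \<alpha>, w) $ i - a0 $ i\<bar>) \<in> O[nhds 0](\<lambda>w. norm w)" for i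
  proof (rule bigoI[where c = "L * (1 / \<alpha> + 1)"], use bound in eventually_elim)
    case (elim w)
    have "\<bar>a (norm w / \<alpha>, w) $ i - a0 $ i\<bar> \<le> norm (a (norm w / \<alpha>, w) - a0)"
      using component_le_norm_cart[of "a (norm w / \<alpha>, w) - a0" i] by simp
    also have "\<dots> \<le> norm (g (norm w / \<alpha>, w) - (a0, \<xi>0))"
      unfolding a_def by (metis fst_conv fst_diff norm_fst_le prod.collapse)
    finally show ?case using elim by simp
  qed
  have Ox: "(\<lambda>w. dist (x (norm w / \<alpha>, w) $ i) (x0 $ i)) \<in> O[nhds 0](\<lambda>w. norm w)" for i
  proof (rule bigoI[where c = "L * (1 / \<alpha> + 1)"], use bound in eventually_elim)
    case (elim w)
    let ?\<xi> = "snd (g (norm w / \<alpha>, w))"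
    have "dist (x (norm w / \<alpha>, w) $ i) (x0 $ i) \<le> \<bar>?\<xi> $ i - \<xi>0 $ i\<bar>"
      unfolding x_def x0_nth tor_nth by (rule dist_to_torus_le)
    also have "\<dots> \<le> norm (?\<xi> - \<xi>0)"
      using component_le_norm_cart[of "?\<xi> - \<xi>0" i] by simp
    also have "\<dots> \<le> norm (g (norm w / \<alpha>, w) - (a0, \<xi>0))"
      by (metis snd_conv snd_diff norm_snd_le prod.collapse)
    finally show ?case using elim by simp
  qed
  have nz: "a (l, w) $ i \<noteq> 0" if "(l, w) \<in> noise_domain \<alpha> l0" for l w i
  proof -
    have "sgn (a (l, w) $ i) = sgn (a0 $ i)" using sol[OF that] by blast
    then show ?thesis using a0[of i] by (metis sgn_zero_iff)
  qed
  show ?thesis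
  proof (rule exI[of _ \<alpha>], intro conjI g(1), rule exI[of _ l0], intro conjI g(2))
    show "\<forall>(l, w)\<in>noise_domain \<alpha> l0. \<exists>!m. solves_P \<phi> l (y0 + w) m" using sol by blast
    show "\<exists>(a :: real \<times> l2 \<Rightarrow> real ^ 'n) (x :: real \<times> l2 \<Rightarrow> torus ^ 'n).
       (\<forall>(l, w)\<in>noise_domain \<alpha> l0.
          solves_P \<phi> l (y0 + w) (spikes (a (l, w)) (x (l, w))) \<and>
          inj (\<lambda>i. x (l, w) $ i) \<and>
          (\<forall>i. a (l, w) $ i \<noteq> 0 \<and> sgn (a (l, w) $ i) = sgn (a0 $ i))) \<and>
       a (0, 0) = a0 \<and> x (0, 0) = x0 \<and>
       (\<forall>k\<ge>2. Ck_torus k \<phi> \<longrightarrow>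
          Ck_map_on (k - 1) (noise_domain \<alpha> l0) (\<lambda>z. (a z, x z))) \<and>
       (\<forall>i. (\<lambda>w. dist (x (norm w / \<alpha>, w) $ i) (x0 $ i)) \<in> O[nhds 0](\<lambda>w. norm w)) \<and>
       (\<forall>i. (\<lambda>w. \<bar>a (norm w / \<alpha>, w) $ i - a0 $ i\<bar>) \<in> O[nhds 0](\<lambda>w. norm w))"
    proof (rule exI[of _ a], rule exI[of _ x], intro conjI allI impI)
      show "\<forall>(l, w)\<in>noise_domain \<alpha> l0.
          solves_P \<phi> l (y0 + w) (spikes (a (l, w)) (x (l, w))) \<and> inj (\<lambda>i. x (l, w) $ i) \<and>
          (\<forall>i. a (l, w) $ i \<noteq> 0 \<and> sgn (a (l, w) $ i) = sgn (a0 $ i))"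
        using sol nz by blast
      show "a (0, 0) = a0" "x (0, 0) = x0" by (simp_all add: a_def x_def g(5) tor_\<xi>0)
    qed (use Ck Oa Ox in auto)
  qed
qed

end
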